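(* Let $\mathbf{A}\in\mathbb{R}^{n\times d}$, let $k\ge1$, let $1\le b\le k$, choose any $\ell>k$, and let $\varepsilon>0$, $\delta\in(0,1)$. Define $t=\lceil \ell/b\rceil$ and $\ell'=bt$. There is a universal constant $c>0$ such that running Randomized Block Krylov Iteration (RBKI, described in the context) with block size $b$ and \[ q = c\left( \frac{t}{\sqrt{\mathrm{gap}_{k\to\ell}}} \log\left( \frac{\kappa_{\ell'}}{\Delta_{\ell'}} \right) + \frac{1}{\sqrt{\mathrm{gap}_{k\to\ell}}} \log\left( \frac{n}{\delta \varepsilon} \right)\right) \] iterations (rounded up to an integer) solves the low-rank approximation problem (defined in the context) with probability at least $1-\delta$. The total number of matrix-vector products is \[ bq = \mathcal{O}\left( \frac{\ell}{\sqrt{\mathrm{gap}_{k\to \ell}}} \log\left( \frac{\kappa_{\ell'}}{\Delta_{\ell'}} \right) + \frac{b}{\sqrt{\mathrm{gap}_{k\to \ell}}} \log\left( \frac{n}{\delta \varepsilon} \right)\right). \]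
   Context: Let $\sigma_1\ge\sigma_2\ge\cdots$ be the singular values of $\mathbf{A}$ and $\lambda_i=\sigma_i^2$ the eigenvalues of $\mathbf{M}=\mathbf{A}\mathbf{A}^\intercal$. Define $\mathrm{gap}_{k\to\ell}=(\sigma_k^2-\sigma_\ell^2)/\sigma_k^2$, the minimum relative gap $\Delta_{\ell'}=\min_{i=1,\dots,\ell'-1}(\lambda_i-\lambda_{i+1})/\lambda_i$ and the condition number $\kappa_{\ell'}=\lambda_1/\lambda_{\ell'-1}$ (the bound is vacuous if any of these quantities is degenerate, e.g. $\Delta_{\ell'}=0$). For a matrix $\mathbf{X}$, $[\![\mathbf{X}]\!]_k$ denotes a best rank-$k$ approximation of $\mathbf{X}$ in Frobenius norm. Low-rank approximation problem: given $\mathbf{A}$, $k$ and $\varepsilon$, find a rank-$k$ matrix $\hat{\mathbf{A}}$ such that $|||\mathbf{A}-\hat{\mathbf{A}}|||\le(1+\varepsilon)|||\mathbf{A}-[\![\mathbf{A}]\!]_k|||$ and $|\,\|\mathbf{A}\mathbf{q}_i\|_2^2-\sigma_i^2|\le\varepsilon\sigma_k^2$ for all $i=1,\dots,k$, where $|||\cdot|||$ is the Frobenius or spectral norm and $\mathbf{q}_i$ is the $i$-th right singular vector of $\hat{\mathbf{A}}$. RBKI with block size $b$ and iteration count $q$: sample $\mathbf{G}\in\mathbb{R}^{n\times b}$ with i.i.d. standard Gaussian entries; let $\mathbf{Z}$ have orthonormal columns spanning $\operatorname{range}[\mathbf{G},\mathbf{M}\mathbf{G},\dots,\mathbf{M}^{q-1}\mathbf{G}]$;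 output $\hat{\mathbf{A}}=\mathbf{Z}[\![\mathbf{Z}^\intercal\mathbf{A}]\!]_k$.
   Formalization: For ε>1 the term log(n/(δε)) is replaced by log(n/δ), since the stated q can be ≤0 for large ε, where the claim fails (A of rank 1); the bound on bq is stated only for n≥2, since for n=1 its right side can tend to 0 while rounding forces bq≥1. *)

theory Defs
  imports
    "HOL-Probability.Probability"
    "Jordan_Normal_Form.Char_Poly"
    "Jordan_Normal_Form.DL_Rank"
begin

text \<open>
  Matrices are those of \<^theory>\<open>Jordan_Normal_Form.Matrix\<close>, whose dimensions are
  values and can therefore be quantified after the universal constants. Matrix entries are
  indexed from 0, whereas eigenvalues and singular values are numbered from 1.
\<close>

section \<open>Singular values, singular vectors and norms\<close>

text \<open>
  The eigenvalues of \<open>A A\<^sup>T\<close>, with multiplicity and in decreasing order; the sequence is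
  continued by 0 beyond the number of rows of \<open>A\<close>. As \<open>A A\<^sup>T\<close> is symmetric, its
  characteristic polynomial splits over the reals.
\<close>

definition gram_eigenvalues :: "real mat \<Rightarrow> real list" where
  "gram_eigenvalues A =
     rev (sorted_list_of_multiset (proots (char_poly (A * transpose_mat A))))"

definition eigval :: "real mat \<Rightarrow> nat \<Rightarrow> real" where
  "eigval A i = (let es = gram_eigenvalues A in
     if 1 \<le> i \<and> i \<le> length es then es ! (i - 1) else 0)"

definition singval :: "real mat \<Rightarrow> nat \<Rightarrow> real" where
  "singval A i = sqrt (eigval A i)"

text \<open>
  A full singular value decomposition \<open>X = U \<Sigma> V\<^sup>T\<close>. The \<open>i\<close>-th right singular
  vector (counting from 1) is \<open>col V (i - 1)\<close>.
\<close>

definition is_svd :: "real mat \<Rightarrow> real mat \<Rightarrow> (nat \<Rightarrow> real) \<Rightarrow> real mat \<Rightarrow> bool" where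
  "is_svd X U s V \<longleftrightarrow>
     (let n = dim_row X; d = dim_col X in
        U \<in> carrier_mat n n \<and> transpose_mat U * U = 1\<^sub>m n \<and>
        V \<in> carrier_mat d d \<and> transpose_mat V * V = 1\<^sub>m d \<and>
        (\<forall>i < min n d. 0 \<le> s i) \<and>
        (\<forall>i j. i \<le> j \<longrightarrow> j < min n d \<longrightarrow> s j \<le> s i) \<and>
        X = U * Matrix.mat n d (\<lambda>(i, j). if i = j then s i else 0) * transpose_mat V)"

definition l2_norm :: "real Matrix.vec \<Rightarrow> real" where
  "l2_norm v = sqrt (scalar_prod v v)"

definition frobenius_norm :: "real mat \<Rightarrow> real" where
  "frobenius_norm X = sqrt (\<Sum>i<dim_row X. \<Sum>j<dim_col X. (X $$ (i, j))\<^sup>2)"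

definition spectral_norm :: "real mat \<Rightarrow> real" where
  "spectral_norm X =
     (SUP v \<in> {v \<in> carrier_vec (dim_col X). l2_norm v \<le> 1}. l2_norm (X *\<^sub>v v))"

section \<open>Low-rank approximation\<close>

text \<open>As usual, a rank-\<open>k\<close> matrix is one of rank at most \<open>k\<close>.\<close>

definition best_rank_approx :: "nat \<Rightarrow> real mat \<Rightarrow> real mat \<Rightarrow> bool" where
  "best_rank_approx k X Y \<longleftrightarrow>
     Y \<in> carrier_mat (dim_row X) (dim_col X) \<and> vec_space.rank (dim_row X) Y \<le> k \<and>
     (\<forall>W \<in> carrier_mat (dim_row X) (dim_col X). vec_space.rank (dim_row X) W \<le> k \<longrightarrow>
        frobenius_norm (X - Y) \<le> frobenius_norm (X - W))"

text \<open>
  Best rank-\<open>k\<close> approximations and right singular vectors need not be unique; the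
  requirements are imposed for every choice of them.
\<close>

definition solves_lra ::
  "(real mat \<Rightarrow> real) \<Rightarrow> nat \<Rightarrow> real \<Rightarrow> real mat \<Rightarrow> real mat \<Rightarrow> bool" where
  "solves_lra N k \<epsilon> A A' \<longleftrightarrow>
     A' \<in> carrier_mat (dim_row A) (dim_col A) \<and> vec_space.rank (dim_row A) A' \<le> k \<and>
     (\<forall>B. best_rank_approx k A B \<longrightarrow> N (A - A') \<le> (1 + \<epsilon>) * N (A - B)) \<and>
     (\<forall>U s V. is_svd A' U s V \<longrightarrow>
        (\<forall>i \<in> {1..k}. \<bar>(l2_norm (A *\<^sub>v col V (i - 1)))\<^sup>2 - (singval A i)\<^sup>2\<bar>
                        \<le> \<epsilon> * (singval A k)\<^sup>2))"

section \<open>Randomized block Krylov iteration\<close>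

text \<open>The block matrix \<open>[G, M G, \<dots>, M\<^bsup>q-1\<^esup> G]\<close> with \<open>M = A A\<^sup>T\<close>.\<close>

definition krylov_mat :: "real mat \<Rightarrow> real mat \<Rightarrow> nat \<Rightarrow> real mat" where
  "krylov_mat A G q = (let b = dim_col G in
     Matrix.mat (dim_row A) (b * q)
       (\<lambda>(i, j). (((A * transpose_mat A) ^\<^sub>m (j div b)) * G) $$ (i, j mod b)))"

text \<open>
  \<open>A'\<close> is a possible output for the starting block \<open>G\<close>: neither the orthonormal basis \<open>Z\<close>
  nor the best rank-\<open>k\<close> approximation is uniquely determined.
\<close>

definition rbki_output :: "real mat \<Rightarrow> real mat \<Rightarrow> nat \<Rightarrow> nat \<Rightarrow> real mat \<Rightarrow> bool" where
  "rbki_output A G q k A' \<longleftrightarrow>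
     (\<exists>r Z B. Z \<in> carrier_mat (dim_row A) r \<and> transpose_mat Z * Z = 1\<^sub>m r \<and>
        vec_space.col_space (dim_row A) Z = vec_space.col_space (dim_row A) (krylov_mat A G q) \<and>
        best_rank_approx k (transpose_mat Z * A) B \<and> A' = Z * B)"

text \<open>
  The law of the \<open>n * b\<close> independent standard Gaussian entries. A sample \<open>\<omega>\<close> yields the
  starting block \<open>Matrix.mat n b \<omega>\<close>.
\<close>

definition gaussian_entries :: "nat \<Rightarrow> nat \<Rightarrow> (nat \<times> nat \<Rightarrow> real) measure" where
  "gaussian_entries n b = Pi\<^sub>M ({..<n} \<times> {..<b}) (\<lambda>_. std_normal_distribution)"

section \<open>Spectral parameters and iteration count\<close>

definition rel_gap :: "real mat \<Rightarrow> nat \<Rightarrow> nat \<Rightarrow> real" where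
  "rel_gap A k l = ((singval A k)\<^sup>2 - (singval A l)\<^sup>2) / (singval A k)\<^sup>2"

definition min_rel_gap :: "real mat \<Rightarrow> nat \<Rightarrow> real" where
  "min_rel_gap A l' = Min ((\<lambda>i. (eigval A i - eigval A (i + 1)) / eigval A i) ` {1..l' - 1})"

definition cond_number :: "real mat \<Rightarrow> nat \<Rightarrow> real" where
  "cond_number A l' = eigval A 1 / eigval A (l' - 1)"

text \<open>
  \<open>log_accuracy n \<delta> \<epsilon>\<close> is \<open>log (n / (\<delta> \<epsilon>))\<close> for \<open>\<epsilon> \<le> 1\<close>; a larger
  \<open>\<epsilon>\<close> is treated as 1. The literal logarithm is negative once \<open>\<epsilon> > n / \<delta>\<close>: for \<open>A\<close> of
  rank 1 with \<open>k = b = 1\<close> and \<open>l = 2\<close> it is the only contribution to the iteration count,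
  which would then be 0, although no matrix but \<open>A\<close> itself is an admissible output.
  For \<open>n \<ge> 2\<close> the value is at least \<open>ln 2\<close>, so that rounding up the iteration count costs
  only a constant factor. For \<open>n = 1\<close> it can be arbitrarily close to 0.
\<close>

definition log_accuracy :: "nat \<Rightarrow> real \<Rightarrow> real \<Rightarrow> real" where
  "log_accuracy n \<delta> \<epsilon> = ln (real n / (\<delta> * min 1 \<epsilon>))"

end

theory Submission
  imports Defs
begin

text \<open>
  Deterministic part. Let \<open>u\<^sub>1, u\<^sub>2, \<dots>\<close> be the eigenvectors of \<open>A A\<^sup>T\<close>. If for every \<open>j \<le> k\<close> the
  Krylov space contains \<open>u\<^sub>j\<close> up to a tiny combination of eigenvectors beyond the \<open>l'\<close>-th one, then
  comparing with \<open>(\<Sum>\<^sub>j x\<^sub>j u\<^sub>j\<^sup>T) A\<close> bounds the Frobenius error of the output by a small multiple of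
  the tail. The other guarantees follow from the Frobenius one: the spectral bound by
  removing one further direction, and the bounds on the singular vectors because the squared singular
  values \<open>s\<^sub>i\<^sup>2 \<le> \<lambda>\<^sub>i\<close> have almost the same sum as the eigenvalues.

  The vectors \<open>x\<^sub>j\<close> are \<open>M p(M) \<Sum>\<^sub>s M\<^sup>s G w\<^sub>s\<close>, where \<open>p\<close> is a Chebyshev polynomial and the \<open>w\<^sub>s\<close>
  invert the square block Krylov matrix \<open>[H, D H, \<dots>, D\<^bsup>t-1\<^esup> H]\<close> of the top \<open>l'\<close> coordinates, with
  \<open>H\<close> Gaussian by rotation invariance. The inverse is controlled by the distances of the rows
  from the span of the other rows. Such a distance is at least \<open>|\<langle>c, h\<^sub>i\<rangle>|\<close> divided by a factor that,
  like the vector \<open>c\<close>, does not depend on row \<open>h\<^sub>i\<close> and is governed by distances for a matrix with one block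
  less. Taking the expectation of inverse square roots, the factors multiply up to
  \<open>poly(l', \<kappa>/\<Delta>)\<^sup>t\<close>, and a single application of Markov's inequality costs only a fixed power of \<open>1/\<delta>\<close>.
\<close>

section \<open>Inner products and orthogonal residuals\<close>

text \<open>With \<open>b \<le> k\<close> a single block cannot capture all leading directions. The
  matrix to be inverted is then the structured \<open>[H, D H, ...]\<close>, whose blocks are
  dependent; bounds for matrices with independent entries do not apply, whence the induction on the
  number of blocks. At each level one row is independent of all that is extracted from the other
  rows, so the only small-ball estimate is one-dimensional. Square roots are taken because
  \<open>1/|x|\<close> is not integrable at 0 while \<open>1/sqrt |x|\<close> is. The moment bound
  has the form \<open>base ^ t\<close>, and its logarithm gives the first term of \<open>q\<close>:
  telescoping the relative gaps yields \<open>l' - 1 \<le> \<kappa>/\<Delta>\<close>, so polynomial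
  factors in \<open>l'\<close> are absorbed by \<open>ln (\<kappa>/\<Delta>)\<close>. Degenerate
  sizes shape the rest: \<open>l'\<close> may equal \<open>n + 1\<close>, so the nodes are cut to
  \<open>min m n\<close>; for \<open>l' = 2\<close> the ratio may be 1, so constants are charged to
  \<open>log_accuracy\<close>; for \<open>n = 1\<close> that logarithm may be tiny, and the case is
  treated directly. The good event restricts the Gaussian block alone; on it every choice of basis,
  truncation and singular vectors succeeds.\<close>

text \<open>Vectors are plain functions of which only the values on \<open>J\<close> count. The same
  lemmas then serve for row indices and for the pairs (power, column) of a Krylov row.\<close>

definition ip :: "'a set \<Rightarrow> ('a \<Rightarrow> real) \<Rightarrow> ('a \<Rightarrow> real) \<Rightarrow> real" where
  "ip J x y = (\<Sum>a\<in>J. x a * y a)"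

lemma ip_commute: "ip J x y = ip J y x"
  by (simp add: ip_def mult.commute)

lemma ip_add_left: "ip J (\<lambda>a. x a + y a) z = ip J x z + ip J y z"
  and ip_diff_left: "ip J (\<lambda>a. x a - y a) z = ip J x z - ip J y z"
  and ip_scale_left: "ip J (\<lambda>a. c * x a) z = c * ip J x z"
  by (simp_all add: ip_def algebra_simps sum.distrib sum_subtractf sum_distrib_left)

lemma ip_add_right: "ip J z (\<lambda>a. x a + y a) = ip J z x + ip J z y"
  and ip_diff_right: "ip J z (\<lambda>a. x a - y a) = ip J z x - ip J z y"
  and ip_scale_right: "ip J z (\<lambda>a. c * x a) = c * ip J z x"
  by (simp_all add: ip_def algebra_simps sum.distrib sum_subtractf sum_distrib_left)

lemma ip_sum_left: "ip J (\<lambda>a. \<Sum>i\<in>I. x i a) z = (\<Sum>i\<in>I. ip J (x i) z)"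
  unfolding ip_def sum_distrib_right by (rule sum.swap)

lemma ip_sum_right: "ip J z (\<lambda>a. \<Sum>i\<in>I. x i a) = (\<Sum>i\<in>I. ip J z (x i))"
  unfolding ip_def sum_distrib_left by (rule sum.swap)

lemma ip_scale_divide_left: "ip J (\<lambda>a. c * x a / e) z = c * ip J x z / e"
  and ip_scale_divide_right: "ip J z (\<lambda>a. c * x a / e) = c * ip J z x / e"
  using ip_scale_left[of J "c / e" x z] ip_scale_right[of J z "c / e" x] by simp_all

lemmas ip_linear = ip_scale_divide_left ip_scale_divide_right ip_add_left ip_diff_left ip_scale_left ip_sum_left
  ip_add_right ip_diff_right ip_scale_right ip_sum_right

lemma ip_cong: "(\<And>a. a \<in> J \<Longrightarrow> x a = x' a) \<Longrightarrow> (\<And>a. a \<in> J \<Longrightarrow> y a = y' a) \<Longrightarrow> ip J x y = ip J x' y'"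
  unfolding ip_def by (rule sum.cong) auto

lemma ip_nonneg [simp]: "0 \<le> ip J x x"
  by (simp add: ip_def sum_nonneg)

lemma ip_self_eq_0D: "finite J \<Longrightarrow> ip J x x = 0 \<Longrightarrow> a \<in> J \<Longrightarrow> x a = 0"
  unfolding ip_def by (subst (asm) sum_nonneg_eq_0_iff) auto

lemma ip_zero_left: "(\<And>a. a \<in> J \<Longrightarrow> x a = 0) \<Longrightarrow> ip J x y = 0"
  unfolding ip_def by (rule sum.neutral) auto

lemma ip_Cauchy_Schwarz: "(ip J x y)\<^sup>2 \<le> ip J x x * ip J y y"
  using Cauchy_Schwarz_ineq_sum[of x y J] by (simp add: ip_def power2_eq_square)

lemma ip_unit:
  assumes "finite J" "p \<in> J"
  shows "ip J (\<lambda>a. if a = p then 1 else 0) x = x p"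
  using assms by (simp add: ip_def if_distrib[of "\<lambda>z. z * _"] cong: if_cong)

text \<open>
  The residual of \<open>x\<close> after orthogonal projection onto the span of \<open>vs\<close>. If \<open>v\<close> lies in the
  span of \<open>vs\<close>, the division by zero makes the correction term vanish.
\<close>

fun residual :: "'a set \<Rightarrow> ('a \<Rightarrow> real) list \<Rightarrow> ('a \<Rightarrow> real) \<Rightarrow> 'a \<Rightarrow> real" where
  "residual J [] x = x"
| "residual J (v # vs) x =
     (\<lambda>a. residual J vs x a
        - ip J (residual J vs x) (residual J vs v) / ip J (residual J vs v) (residual J vs v) * residual J vs v a)"

text \<open>\<open>residual J vs x\<close> differs from \<open>x\<close> by an element of the span
  of \<open>vs\<close>.\<close>

lemma residual_ip_orthogonal:
  assumes "\<And>v. v \<in> set vs \<Longrightarrow> ip J v w = 0"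
  shows "ip J (residual J vs x) w = ip J x w"
  using assms
proof (induction vs arbitrary: x)
  case (Cons v vs)
  have "ip J (residual J vs v) w = ip J v w" "ip J v w = 0" "ip J (residual J vs x) w = ip J x w"
    using Cons by auto
  then show ?case by (simp add: ip_linear)
qed simp

lemma residual_orthogonal:
  assumes "finite J" "v \<in> set vs"
  shows "ip J v (residual J vs x) = 0"
  using assms(2)
proof (induction vs arbitrary: x v)
  case (Cons v0 vs)
  let ?y = "residual J vs v0" and ?z = "residual J vs x"
  show ?case
  proof (cases "v \<in> set vs")
    case True
    then show ?thesis using Cons.IH by (simp add: ip_linear)
  next
    case False
    then have v: "v = v0" using Cons.prems by simp
    have 1: "ip J v0 ?z = ip J ?y ?z" "ip J v0 ?y = ip J ?y ?y"
      using residual_ip_orthogonal[of vs J _ v0] Cons.IH by simp_all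
    show ?thesis
    proof (cases "ip J ?y ?y = 0")
      \<comment> \<open>A zero residual of \<open>v0\<close> vanishes on all of \<open>J\<close>, so
        the division by zero in the recursion does no harm.\<close>
      case True
      then have "ip J ?y ?z = 0" using ip_self_eq_0D[OF assms(1)] by (intro ip_zero_left) blast
      then show ?thesis using v 1 by (simp add: ip_linear True)
    next
      case False
      then show ?thesis using v 1 by (simp add: ip_linear ip_commute[of J ?z])
    qed
  qed
qed simp

lemma residual_selfadjoint:
  assumes "finite J"
  shows "ip J (residual J vs x) (residual J vs y) = ip J x (residual J vs y)"
  using residual_ip_orthogonal residual_orthogonal[OF assms] by blast

text \<open>Duality for the distance to a span: every \<open>w\<close> orthogonal to the span
  certifies a lower bound. This is how the Krylov distances are bounded from below.\<close>

lemma residual_norm_ge: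
  assumes "finite J" "\<And>v. v \<in> set vs \<Longrightarrow> ip J v w = 0"
  shows "(ip J x w)\<^sup>2 \<le> ip J (residual J vs x) (residual J vs x) * ip J w w"
  using ip_Cauchy_Schwarz[of J "residual J vs x" w] residual_ip_orthogonal[of vs J w x] assms(2) by simp

text \<open>Pythagoras: one more list element removes the component along its own residual.\<close>

lemma residual_Cons_norm:
  assumes "finite J"
  shows "ip J (residual J (v # vs) x) (residual J (v # vs) x) =
    ip J (residual J vs x) (residual J vs x)
      - (ip J x (residual J vs v))\<^sup>2 / ip J (residual J vs v) (residual J vs v)"
proof -
  let ?y = "residual J vs v" and ?z = "residual J vs x"
  have zy: "ip J ?z ?y = ip J x ?y" "ip J ?y ?z = ip J x ?y"
    using residual_selfadjoint[OF assms] ip_commute by metis+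
  show ?thesis
  proof (cases "ip J ?y ?y = 0")
    case True
    then show ?thesis by (simp add: ip_linear)
  next
    case False
    then show ?thesis by (simp add: ip_linear zy) (simp add: field_simps power2_eq_square)
  qed
qed

lemma residual_norm_le:
  assumes "finite J"
  shows "ip J (residual J vs x) (residual J vs x) \<le> ip J x x"
proof (induction vs)
  case (Cons v vs)
  then show ?case
    using residual_Cons_norm[OF assms, of v vs x]
      divide_nonneg_nonneg[OF zero_le_power2 ip_nonneg, of "ip J x (residual J vs v)" J "residual J vs v"]
    by linarith
qed simp

text \<open>By Bessel's inequality each element of \<open>vs\<close> lowers the sum by at most 1.
  For an orthonormal basis this is the statement that projecting off \<open>k\<close> vectors leaves
  trace at least \<open>n - k\<close>.\<close>

lemma sum_residual_orthonormal_ge: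
  assumes J: "finite J" and I: "finite I"
    and orth: "\<And>i j. i \<in> I \<Longrightarrow> j \<in> I \<Longrightarrow> ip J (u i) (u j) = (if i = j then 1 else 0)"
  shows "real (card I) - real (length vs) \<le> (\<Sum>i\<in>I. ip J (residual J vs (u i)) (residual J vs (u i)))"
proof (induction vs)
  case Nil
  then show ?case using orth by simp
next
  case (Cons v vs)
  let ?y = "residual J vs v"
  let ?s = "\<lambda>a. \<Sum>i\<in>I. ip J (u i) ?y * u i a"
  have sy: "ip J ?y ?s = (\<Sum>i\<in>I. (ip J (u i) ?y)\<^sup>2)"
    by (simp add: ip_linear power2_eq_square ip_commute[of J ?y])
  have ss: "ip J ?s ?s = (\<Sum>i\<in>I. (ip J (u i) ?y)\<^sup>2)"
    by (simp add: ip_linear orth power2_eq_square if_distrib[of "\<lambda>z. _ * z"] I sum.delta cong: if_cong sum.cong)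
  have bessel: "(\<Sum>i\<in>I. (ip J (u i) ?y)\<^sup>2) \<le> ip J ?y ?y"
    using ip_nonneg[of J "\<lambda>a. ?y a - ?s a"]
    by (simp add: ip_diff_left ip_diff_right sy ss ip_commute[of J ?s ?y])
  have "(\<Sum>i\<in>I. (ip J (u i) ?y)\<^sup>2 / ip J ?y ?y) \<le> 1"
    unfolding sum_divide_distrib[symmetric]
    by (cases "ip J ?y ?y = 0") (use bessel in \<open>auto simp: divide_simps intro: order.not_eq_order_implies_strict\<close>)
  then show ?case
    using Cons by (simp only: residual_Cons_norm[OF J] sum_subtractf length_Cons of_nat_Suc)
qed

text \<open>Gaussian elimination on the number of equations. The index sets are arbitrary because
  the lemma drives all dimension-counting arguments below, with rows, columns or eigenvectors as
  unknowns.\<close>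

lemma underdetermined_solution:
  fixes M :: "'b \<Rightarrow> 'a \<Rightarrow> real"
  assumes "finite C" "finite J" "card C < card J"
  shows "\<exists>x. (\<forall>c\<in>C. (\<Sum>j\<in>J. M c j * x j) = 0) \<and> (\<exists>j\<in>J. x j \<noteq> 0)"
  using assms
proof (induction arbitrary: J M rule: finite_induct)
  case empty
  then have "J \<noteq> {}" by auto
  then show ?case by (intro exI[of _ "\<lambda>_. 1"]) auto
next
  case (insert c0 C)
  show ?case
  proof (cases "\<forall>j\<in>J. M c0 j = 0")
    case True
    obtain x where "\<forall>c\<in>C. (\<Sum>j\<in>J. M c j * x j) = 0" "\<exists>j\<in>J. x j \<noteq> 0"
      using insert.IH[of J M] insert.prems insert.hyps by auto
    then show ?thesis using True by (intro exI[of _ x]) auto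
  next
    case False
    then obtain p where p: "p \<in> J" "M c0 p \<noteq> 0" by blast
    let ?J = "J - {p}"
    define M' where "M' c j = M c j - M c p / M c0 p * M c0 j" for c j
    have "card C < card ?J" using insert.prems insert.hyps p by simp
    then obtain x where x: "\<forall>c\<in>C. (\<Sum>j\<in>?J. M' c j * x j) = 0" "\<exists>j\<in>?J. x j \<noteq> 0"
      using insert.IH[of ?J M'] insert.prems by auto
    \<comment> \<open>Back substitution: the pivot unknown \<open>p\<close> is chosen to satisfy
      equation \<open>c0\<close>.\<close>
    define y where "y = x(p := - (\<Sum>j\<in>?J. M c0 j * x j) / M c0 p)"
    have split: "(\<Sum>j\<in>J. M c j * y j) = M c p * y p + (\<Sum>j\<in>?J. M c j * x j)" for c
      using p insert.prems(1) by (subst sum.remove[of J p]) (auto simp: y_def intro!: sum.cong)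
    have "(\<Sum>j\<in>J. M c0 j * y j) = 0" using split[of c0] p by (simp add: y_def)
    moreover have "(\<Sum>j\<in>J. M c j * y j) = 0" if "c \<in> C" for c
    proof -
      have "(\<Sum>j\<in>?J. M' c j * x j) = (\<Sum>j\<in>?J. M c j * x j) - M c p / M c0 p * (\<Sum>j\<in>?J. M c0 j * x j)"
        by (simp add: M'_def algebra_simps sum_subtractf sum_distrib_left)
      then show ?thesis using x that split[of c] by (simp add: y_def)
    qed
    moreover have "\<exists>j\<in>J. y j \<noteq> 0" using x by (auto simp: y_def)
    ultimately show ?thesis by blast
  qed
qed

section \<open>Spectral theorem for symmetric real matrices\<close>

definition matvec :: "nat \<Rightarrow> (nat \<Rightarrow> nat \<Rightarrow> real) \<Rightarrow> (nat \<Rightarrow> real) \<Rightarrow> nat \<Rightarrow> real" where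
  "matvec n M x r = (\<Sum>j<n. M r j * x j)"

definition orthonormal :: "'a set \<Rightarrow> nat \<Rightarrow> (nat \<Rightarrow> 'a \<Rightarrow> real) \<Rightarrow> bool" where
  "orthonormal J k u \<longleftrightarrow> (\<forall>i<k. \<forall>j<k. ip J (u i) (u j) = (if i = j then 1 else 0))"

lemma matvec_linear:
  "matvec n M (\<lambda>a. x a + y a) r = matvec n M x r + matvec n M y r"
  "matvec n M (\<lambda>a. c * x a) r = c * matvec n M x r"
  by (simp_all add: matvec_def algebra_simps sum.distrib sum_distrib_left)

lemma ip_matvec_commute:
  assumes "\<And>i j. i < n \<Longrightarrow> j < n \<Longrightarrow> M i j = M j i"
  shows "ip {..<n} (matvec n M x) y = ip {..<n} x (matvec n M y)"
proof -
  have "ip {..<n} (matvec n M x) y = (\<Sum>r<n. \<Sum>j<n. M r j * x j * y r)"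
    by (simp add: ip_def matvec_def sum_distrib_right)
  also have "\<dots> = (\<Sum>j<n. \<Sum>r<n. M r j * x j * y r)" by (rule sum.swap)
  also have "\<dots> = (\<Sum>j<n. \<Sum>r<n. x j * (M j r * y r))"
    using assms by (intro sum.cong refl) simp
  finally show ?thesis by (simp add: ip_def matvec_def sum_distrib_left)
qed

text \<open>First-order optimality: the quadratic attains its minimum 0 at \<open>t = 0\<close>,
  where its derivative is \<open>2 b\<close>.\<close>

lemma quadratic_nonneg_linear_coeff_zero:
  fixes b q :: real
  assumes "\<And>t. 0 \<le> 2 * t * b + t\<^sup>2 * q" "0 \<le> q"
  shows "b = 0"
proof (rule ccontr)
  assume "b \<noteq> 0"
  have "q + 1 \<noteq> 0" using assms(2) by simp
  then have "2 * (- b / (q + 1)) * b + (- b / (q + 1))\<^sup>2 * q = - (b\<^sup>2 * (q + 2)) / (q + 1)\<^sup>2"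
    by (simp add: divide_simps) (simp add: power2_eq_square algebra_simps)
  moreover have "\<dots> < 0" using assms(2) \<open>b \<noteq> 0\<close> by (intro divide_neg_pos) auto
  ultimately show False using assms(1)[of "- b / (q + 1)"] by simp
qed

text \<open>The sphere lives in the function type \<open>nat => real\<close>, with coordinates from
  \<open>n\<close> on equal to 0, so that the dimension stays a value. By Tychonoff it is a closed
  subset of a compact box.\<close>

lemma compact_unit_sphere_coordinates:
  "compact {x :: nat \<Rightarrow> real. (\<forall>i\<ge>n. x i = 0) \<and> ip {..<n} x x = 1}"
proof -
  let ?B = "PiE UNIV (\<lambda>i. if i < n then {-1..1} else {0::real})"
  have "compactin (product_topology (\<lambda>_. euclidean) UNIV) ?B"
    unfolding compactin_PiE by auto
  then have cB: "compact ?B" by (simp add: euclidean_product_topology)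
  have cl: "closed {x :: nat \<Rightarrow> real. ip {..<n} x x = 1}"
    unfolding ip_def by (intro closed_Collect_eq continuous_intros) auto
  have "{x :: nat \<Rightarrow> real. (\<forall>i\<ge>n. x i = 0) \<and> ip {..<n} x x = 1} = ?B \<inter> {x. ip {..<n} x x = 1}"
  proof -
    have "x i \<in> {-1..1}" if "ip {..<n} x x = 1" "i < n" for x :: "nat \<Rightarrow> real" and i
    proof -
      have "(x i)\<^sup>2 \<le> (\<Sum>j<n. (x j)\<^sup>2)" using that by (intro member_le_sum) auto
      then show ?thesis using that abs_square_le_1[of "x i"] by (auto simp: ip_def power2_eq_square)
    qed
    then show ?thesis by (auto simp: PiE_iff split: if_splits)
  qed
  then show ?thesis using cB cl by (simp add: compact_Int_closed)
qed

text \<open>The Rayleigh quotient attains its maximum on the unit sphere of the orthogonal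
  complement of the eigenvectors found so far. That complement is invariant under \<open>M\<close>,
  so the maximiser is an eigenvector.\<close>

lemma constrained_top_eigenvector:
  assumes sym: "\<And>i j. i < n \<Longrightarrow> j < n \<Longrightarrow> M i j = M j i"
    and kn: "k < n"
    and eig: "\<And>i r. i < k \<Longrightarrow> r < n \<Longrightarrow> matvec n M (u i) r = lam i * u i r"
  shows "\<exists>v \<mu>. ip {..<n} v v = 1 \<and> (\<forall>i<k. ip {..<n} (u i) v = 0) \<and>
    (\<forall>r<n. matvec n M v r = \<mu> * v r) \<and>
    (\<forall>x. (\<forall>i<k. ip {..<n} (u i) x = 0) \<longrightarrow> ip {..<n} x (matvec n M x) \<le> \<mu> * ip {..<n} x x)"
proof -
  let ?N = "{..<n}"
  define S where "S = {x :: nat \<Rightarrow> real. (\<forall>i\<ge>n. x i = 0) \<and> ip ?N x x = 1} \<inter> {x. \<forall>i<k. ip ?N (u i) x = 0}"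
  have "closed {x :: nat \<Rightarrow> real. \<forall>i<k. ip ?N (u i) x = 0}"
  proof -
    have "{x :: nat \<Rightarrow> real. \<forall>i<k. ip ?N (u i) x = 0} = (\<Inter>i<k. {x. ip ?N (u i) x = 0})" by auto
    moreover have "closed {x. ip ?N (u i) x = 0}" for i
      unfolding ip_def by (intro closed_Collect_eq continuous_intros) auto
    ultimately show ?thesis by auto
  qed
  then have cS: "compact S" unfolding S_def by (intro compact_Int_closed compact_unit_sphere_coordinates)
  have normalise: "\<exists>y\<in>S. \<forall>a<n. x a = sqrt (ip ?N x x) * y a"
    if x: "\<And>i. i < k \<Longrightarrow> ip ?N (u i) x = 0" and nz: "ip ?N x x \<noteq> 0" for x
  proof -
    define y where "y a = (if a < n then 1 / sqrt (ip ?N x x) * x a else 0)" for a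
    have "ip ?N z y = 1 / sqrt (ip ?N x x) * ip ?N z x" for z
      unfolding ip_scale_right[symmetric] by (rule ip_cong) (auto simp: y_def)
    moreover have "ip ?N y x = 1 / sqrt (ip ?N x x) * ip ?N x x"
      unfolding ip_scale_left[symmetric] by (rule ip_cong) (auto simp: y_def)
    ultimately have "y \<in> S" using x nz by (auto simp: S_def y_def ip_commute[of _ x y])
    then show ?thesis using nz by (intro bexI[of _ y]) (auto simp: y_def)
  qed
  obtain x where x: "\<And>i. i < k \<Longrightarrow> ip ?N (u i) x = 0" "\<exists>j\<in>?N. x j \<noteq> 0"
    using underdetermined_solution[of "{..<k}" ?N u] kn by (auto simp: ip_def)
  then have "ip ?N x x \<noteq> 0" using ip_self_eq_0D[of ?N x] by auto
  then have "S \<noteq> {}" using normalise[of x] x by blast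
  moreover have "continuous_on S (\<lambda>x. ip ?N x (matvec n M x))"
    unfolding ip_def matvec_def
    by (intro continuous_intros) (auto intro: continuous_on_subset[OF continuous_on_product_coordinates])
  ultimately obtain v where v: "v \<in> S" "\<And>y. y \<in> S \<Longrightarrow> ip ?N y (matvec n M y) \<le> ip ?N v (matvec n M v)"
    using continuous_attains_sup[OF cS] by metis
  define \<mu> where "\<mu> = ip ?N v (matvec n M v)"
  have vv: "ip ?N v v = 1" and vu: "\<And>i. i < k \<Longrightarrow> ip ?N (u i) v = 0" using v(1) by (auto simp: S_def)
  have max: "ip ?N x (matvec n M x) \<le> \<mu> * ip ?N x x" if x: "\<And>i. i < k \<Longrightarrow> ip ?N (u i) x = 0" for x
  proof (cases "ip ?N x x = 0")
    case True
    then show ?thesis using ip_self_eq_0D[of ?N x] ip_zero_left[of ?N x "matvec n M x"] by auto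
  next
    case False
    then obtain y where y: "y \<in> S" "\<forall>a<n. x a = sqrt (ip ?N x x) * y a" using normalise[OF x] by blast
    have "matvec n M x r = sqrt (ip ?N x x) * matvec n M y r" for r
      unfolding matvec_def sum_distrib_left using y(2) by (intro sum.cong refl) (metis lessThan_iff mult.left_commute)
    then have "ip ?N x (matvec n M x) = ip ?N (\<lambda>a. sqrt (ip ?N x x) * y a) (\<lambda>a. sqrt (ip ?N x x) * matvec n M y a)"
      using y(2) by (intro ip_cong) auto
    also have "\<dots> = ip ?N x x * ip ?N y (matvec n M y)" by (simp add: ip_linear)
    finally show ?thesis using mult_left_mono[OF v(2)[OF y(1)] ip_nonneg[of ?N x]] by (simp add: \<mu>_def mult.commute)
  qed
  define y where "y r = \<mu> * v r - matvec n M v r" for r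
  have yu: "ip ?N (u i) y = 0" if "i < k" for i
  proof -
    have "ip ?N (u i) (matvec n M v) = ip ?N (matvec n M (u i)) v" by (rule ip_matvec_commute[OF sym, symmetric])
    also have "\<dots> = ip ?N (\<lambda>r. lam i * u i r) v" using eig that by (intro ip_cong) auto
    finally show ?thesis using vu[OF that] unfolding y_def by (simp add: ip_linear)
  qed
  let ?q = "\<mu> * ip ?N y y - ip ?N y (matvec n M y)"
  \<comment> \<open>This is \<open>\<mu> |v + t y|^2 - <v + t y, M (v + t y)>\<close>: the constant
    terms cancel, and the linear coefficient is \<open>2 |y|^2\<close> by the definition of
    \<open>y\<close>.\<close>
  have "0 \<le> 2 * t * ip ?N y y + t\<^sup>2 * ?q" for t
  proof -
    have eqs: "ip ?N y (matvec n M v) = \<mu> * ip ?N v y - ip ?N y y"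
      "ip ?N v (matvec n M y) = \<mu> * ip ?N v y - ip ?N y y"
    proof -
      have "ip ?N y z = \<mu> * ip ?N v z - ip ?N (matvec n M v) z" for z
        unfolding y_def by (simp add: ip_linear)
      moreover have "ip ?N (matvec n M v) y = ip ?N v (matvec n M y)" by (rule ip_matvec_commute[OF sym])
      ultimately show "ip ?N y (matvec n M v) = \<mu> * ip ?N v y - ip ?N y y"
        "ip ?N v (matvec n M y) = \<mu> * ip ?N v y - ip ?N y y"
        by (simp_all add: ip_commute[of _ y "matvec n M v"])
    qed
    have "ip ?N (\<lambda>a. v a + t * y a) (matvec n M (\<lambda>a. v a + t * y a)) \<le> \<mu> * ip ?N (\<lambda>a. v a + t * y a) (\<lambda>a. v a + t * y a)"
      by (rule max) (simp add: ip_linear vu yu)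
    moreover have "matvec n M (\<lambda>a. v a + t * y a) = (\<lambda>a. matvec n M v a + t * matvec n M y a)"
      by (simp add: fun_eq_iff matvec_linear)
    ultimately show ?thesis
      by (simp add: ip_linear eqs vv \<mu>_def[symmetric] ip_commute[of _ y v]) (simp add: algebra_simps power2_eq_square)
  qed
  moreover have "0 \<le> ?q" using max[OF yu] by simp
  ultimately have "ip ?N y y = 0" by (rule quadratic_nonneg_linear_coeff_zero)
  then have "matvec n M v r = \<mu> * v r" if "r < n" for r
    using ip_self_eq_0D[of ?N y r] that by (simp add: y_def)
  then show ?thesis using vv vu max by blast
qed

text \<open>The induction carries along that each eigenvalue maximises the Rayleigh quotient subject
  to the earlier constraints; the decreasing order is read off from this at the end.\<close>

lemma symmetric_eigenbasis:
  assumes sym: "\<And>i j. i < n \<Longrightarrow> j < n \<Longrightarrow> M i j = M j i"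
  obtains u lam where "orthonormal {..<n} n u"
    "\<And>i r. i < n \<Longrightarrow> r < n \<Longrightarrow> matvec n M (u i) r = lam i * u i r"
    "\<And>i j. i \<le> j \<Longrightarrow> j < n \<Longrightarrow> lam j \<le> lam i"
proof -
  let ?N = "{..<n}"
  have "\<exists>(u :: nat \<Rightarrow> nat \<Rightarrow> real) lam. orthonormal ?N k u \<and> (\<forall>i<k. \<forall>r<n. matvec n M (u i) r = lam i * u i r)
      \<and> (\<forall>i<k. \<forall>x. (\<forall>j<i. ip ?N (u j) x = 0) \<longrightarrow> ip ?N x (matvec n M x) \<le> lam i * ip ?N x x)"
    if "k \<le> n" for k
    using that
  proof (induction k)
    case 0
    then show ?case by (auto simp: orthonormal_def)
  next
    case (Suc k)
    then obtain u lam where IH: "orthonormal ?N k u"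
      "\<forall>i<k. \<forall>r<n. matvec n M (u i) r = lam i * u i r"
      "\<forall>i<k. \<forall>x. (\<forall>j<i. ip ?N (u j) x = 0) \<longrightarrow> ip ?N x (matvec n M x) \<le> lam i * ip ?N x x" by auto
    have "\<exists>v \<mu>. ip ?N v v = 1 \<and> (\<forall>i<k. ip ?N (u i) v = 0) \<and> (\<forall>r<n. matvec n M v r = \<mu> * v r) \<and>
      (\<forall>x. (\<forall>i<k. ip ?N (u i) x = 0) \<longrightarrow> ip ?N x (matvec n M x) \<le> \<mu> * ip ?N x x)"
    proof (rule constrained_top_eigenvector)
      show "M i j = M j i" if "i < n" "j < n" for i j using that by (rule sym)
      show "k < n" using Suc.prems by simp
      show "matvec n M (u i) r = lam i * u i r" if "i < k" "r < n" for i r using IH(2) that by blast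
    qed
    then obtain v \<mu> where v: "ip ?N v v = 1" "\<forall>i<k. ip ?N (u i) v = 0" "\<forall>r<n. matvec n M v r = \<mu> * v r"
      "\<forall>x. (\<forall>i<k. ip ?N (u i) x = 0) \<longrightarrow> ip ?N x (matvec n M x) \<le> \<mu> * ip ?N x x" by blast
    have vu: "\<forall>i<k. ip ?N v (u i) = 0" using v(2) by (simp add: ip_commute[of _ v])
    show ?case
    proof (intro exI[of _ "u(k := v)"] exI[of _ "lam(k := \<mu>)"] conjI)
      show "orthonormal ?N (Suc k) (u(k := v))"
        using IH(1) v(1,2) vu by (auto simp: orthonormal_def less_Suc_eq)
      show "\<forall>i<Suc k. \<forall>r<n. matvec n M ((u(k := v)) i) r = (lam(k := \<mu>)) i * (u(k := v)) i r"
        using IH(2) v(3) by (auto simp: less_Suc_eq)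
      show "\<forall>i<Suc k. \<forall>x. (\<forall>j<i. ip ?N ((u(k := v)) j) x = 0) \<longrightarrow>
              ip ?N x (matvec n M x) \<le> (lam(k := \<mu>)) i * ip ?N x x"
        using IH(3) v(4) by (auto simp: less_Suc_eq)
    qed
  qed
  then obtain u lam where u: "orthonormal ?N n u" "\<forall>i<n. \<forall>r<n. matvec n M (u i) r = lam i * u i r"
    "\<forall>i<n. \<forall>x. (\<forall>j<i. ip ?N (u j) x = 0) \<longrightarrow> ip ?N x (matvec n M x) \<le> lam i * ip ?N x x" by blast
  have "lam j \<le> lam i" if "i \<le> j" "j < n" for i j
  proof -
    have "ip ?N (u j) (matvec n M (u j)) = ip ?N (u j) (\<lambda>r. lam j * u j r)"
      using u(2) that by (intro ip_cong) auto
    also have "\<dots> = lam j" using u(1) that by (simp add: ip_linear orthonormal_def)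
    moreover have "\<forall>j'<i. ip ?N (u j') (u j) = 0" "ip ?N (u j) (u j) = 1"
      using u(1) that by (auto simp: orthonormal_def)
    ultimately show ?thesis using u(3) that by (metis le_less_trans mult.right_neutral)
  qed
  then show thesis using that u by blast
qed

text \<open>A left inverse of a square matrix is a right inverse, so orthonormal rows force
  orthonormal columns.\<close>

lemma orthonormal_dual:
  assumes "orthonormal {..<n} n u" "r < n" "r' < n"
  shows "(\<Sum>i<n. u i r * u i r') = (if r = r' then 1 else 0)"
proof -
  define U where "U = mat n n (\<lambda>(i, r). u i r)"
  have U: "U \<in> carrier_mat n n" by (simp add: U_def)
  have "U * transpose_mat U = 1\<^sub>m n"
    using assms(1) by (intro eq_matI) (auto simp: U_def scalar_prod_def orthonormal_def ip_def lessThan_atLeast0)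
  then have "transpose_mat U * U = 1\<^sub>m n" using U mat_mult_left_right_inverse by (metis transpose_carrier_mat)
  then have "(transpose_mat U * U) $$ (r, r') = (1\<^sub>m n :: real mat) $$ (r, r')" by simp
  then show ?thesis using assms(2,3) by (simp add: U_def scalar_prod_def lessThan_atLeast0)
qed

lemma orthonormal_parseval:
  assumes "orthonormal {..<n} n u"
  shows "(\<Sum>i<n. ip {..<n} (u i) x * ip {..<n} (u i) y) = ip {..<n} x y"
proof -
  have "(\<Sum>i<n. ip {..<n} (u i) x * ip {..<n} (u i) y) = (\<Sum>i<n. \<Sum>r<n. \<Sum>r'<n. x r * y r' * (u i r * u i r'))"
    by (simp add: ip_def sum_product algebra_simps)
  also have "\<dots> = (\<Sum>r<n. \<Sum>r'<n. x r * y r' * (\<Sum>i<n. u i r * u i r'))"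
    unfolding sum_distrib_left by (subst sum.swap, rule sum.cong[OF refl], rule sum.swap)
  also have "\<dots> = (\<Sum>r<n. \<Sum>r'<n. if r = r' then x r * y r' else 0)"
    by (intro sum.cong refl) (simp add: orthonormal_dual[OF assms])
  also have "\<dots> = ip {..<n} x y" by (simp add: ip_def)
  finally show ?thesis .
qed

text \<open>\<^const>\<open>eigval\<close> counts eigenvalues from 1, the eigenbasis \<open>u\<close> from 0.\<close>

lemma gram_eigenbasis:
  fixes A :: "real mat"
  assumes A: "A \<in> carrier_mat n d"
  obtains u where "orthonormal {..<n} n u"
    "\<And>i r. i < n \<Longrightarrow> r < n \<Longrightarrow> matvec n (\<lambda>r j. (A * transpose_mat A) $$ (r, j)) (u i) r = eigval A (Suc i) * u i r"
    "\<And>i. 0 \<le> eigval A (Suc i)"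
    "\<And>i j. i \<le> j \<Longrightarrow> eigval A (Suc j) \<le> eigval A (Suc i)"
    "\<And>i. n \<le> i \<Longrightarrow> eigval A (Suc i) = 0"
proof -
  let ?N = "{..<n}"
  let ?M = "A * transpose_mat A"
  have M: "?M \<in> carrier_mat n n" using A by simp
  have sym: "?M $$ (i, j) = ?M $$ (j, i)" if "i < n" "j < n" for i j
    using A that by (simp add: comm_scalar_prod[of _ d])
  obtain u lam where u: "orthonormal ?N n u"
    "\<And>i r. i < n \<Longrightarrow> r < n \<Longrightarrow> matvec n (\<lambda>r j. ?M $$ (r, j)) (u i) r = lam i * u i r"
    "\<And>i j. i \<le> j \<Longrightarrow> j < n \<Longrightarrow> lam j \<le> lam i"
    using symmetric_eigenbasis[of n "\<lambda>r j. ?M $$ (r, j)"] sym by metis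
  have nonneg: "0 \<le> lam i" if i: "i < n" for i
  proof -
    \<comment> \<open>The eigenvalue is the squared norm of \<open>A^T\<close> applied to
      \<open>u i\<close>.\<close>
    have "lam i = ip ?N (u i) (\<lambda>r. lam i * u i r)" using u(1) i by (simp add: ip_linear orthonormal_def)
    also have "\<dots> = ip ?N (u i) (matvec n (\<lambda>r j. ?M $$ (r, j)) (u i))" using u(2) i by (intro ip_cong) auto
    also have "\<dots> = (\<Sum>r<n. \<Sum>j<n. \<Sum>c<d. (A $$ (r, c) * u i r) * (A $$ (j, c) * u i j))"
      using A by (simp add: ip_def matvec_def scalar_prod_def sum_distrib_left sum_distrib_right
          lessThan_atLeast0 algebra_simps)
    also have "\<dots> = (\<Sum>c<d. (\<Sum>r<n. A $$ (r, c) * u i r)\<^sup>2)"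
      unfolding power2_eq_square sum_product
      by (subst sum.swap[of _ "{..<n}" "{..<d}"], rule sum.cong[OF refl], rule sum.swap)
    also have "\<dots> \<ge> 0" by (intro sum_nonneg) simp
    finally show ?thesis .
  qed
  define U where "U = mat n n (\<lambda>(r, i). u i r)"
  define D where "D = mat n n (\<lambda>(i, j). if i = j then lam i else 0)"
  have car: "U \<in> carrier_mat n n" "D \<in> carrier_mat n n" by (auto simp: U_def D_def)
  have UU: "transpose_mat U * U = 1\<^sub>m n"
    using u(1) by (intro eq_matI) (auto simp: U_def scalar_prod_def orthonormal_def ip_def lessThan_atLeast0)
  then have UU': "U * transpose_mat U = 1\<^sub>m n" using car mat_mult_left_right_inverse by (metis transpose_carrier_mat)
  have MU: "?M * U = U * D"
  proof (rule eq_matI)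
    fix r i assume "r < dim_row (U * D)" "i < dim_col (U * D)"
    then have ri: "r < n" "i < n" by (auto simp: U_def D_def)
    have "(?M * U) $$ (r, i) = matvec n (\<lambda>r j. ?M $$ (r, j)) (u i) r"
      using ri M car A by (simp add: matvec_def scalar_prod_def lessThan_atLeast0 U_def)
    also have "\<dots> = lam i * u i r" using u(2) ri by simp
    also have "\<dots> = (U * D) $$ (r, i)"
      using ri by (simp add: U_def D_def scalar_prod_def if_distrib[of "\<lambda>z. _ * z"] cong: if_cong)
    finally show "(?M * U) $$ (r, i) = (U * D) $$ (r, i)" .
  qed (use A in \<open>auto simp: U_def D_def\<close>)
  have "?M = ?M * (U * transpose_mat U)" unfolding UU' by (rule right_mult_one_mat[OF M, symmetric])
  also have "\<dots> = (?M * U) * transpose_mat U" using M car by (simp add: assoc_mult_mat[of _ n n _ n _ n])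
  finally have "?M = U * D * transpose_mat U" using MU by simp
  then have "similar_mat ?M D" using M car UU UU' by (intro similar_matI[of _ _ U "transpose_mat U" n]) auto
  then have "char_poly ?M = char_poly D" by (rule char_poly_similar)
  also have "\<dots> = (\<Prod>a\<leftarrow>diag_mat D. [:- a, 1:])"
    by (rule char_poly_upper_triangular[OF car(2)]) (auto simp: D_def)
  also have "diag_mat D = map lam [0..<n]" by (auto simp: diag_mat_def D_def)
  finally have cp: "char_poly ?M = (\<Prod>a\<leftarrow>map lam [0..<n]. [:- a, 1:])" .
  \<comment> \<open>Roots with multiplicity of the split characteristic polynomial; together with
    the ordering of \<open>lam\<close> they determine the list
    \<open>gram_eigenvalues A\<close>.\<close>
  have "proots (\<Prod>a\<leftarrow>xs. [:- a, 1:]) = mset xs" for xs :: "real list"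
  proof (induction xs)
    case (Cons x xs)
    have "(\<Prod>a\<leftarrow>xs. [:- a, 1:]) \<noteq> (0 :: real poly)"
      by (induction xs) (auto simp del: mult_pCons_left)
    then show ?case using Cons by (simp add: proots_mult del: mult_pCons_left)
  qed simp
  then have pr: "proots (char_poly ?M) = mset (map lam [0..<n])" unfolding cp .
  have "sorted (rev (map lam [0..<n]))"
    by (auto simp: sorted_iff_nth_mono rev_nth intro!: u(3))
  moreover have "mset (rev (map lam [0..<n])) = proots (char_poly ?M)" using pr by simp
  ultimately have "sorted_list_of_multiset (proots (char_poly ?M)) = rev (map lam [0..<n])"
    by (metis sorted_list_of_multiset_mset sorted_sort_id)
  then have es: "gram_eigenvalues A = map lam [0..<n]" by (simp add: gram_eigenvalues_def)
  have ev: "eigval A (Suc i) = (if i < n then lam i else 0)" for i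
    by (simp add: eigval_def es Suc_le_eq)
  show thesis
    by (rule that[of u]) (use u nonneg ev in \<open>auto simp: not_less\<close>)
qed

section \<open>Low-rank approximation in the Frobenius norm\<close>

text \<open>A rank factorisation written entrywise, as a sum of \<open>k\<close> dyads. Later
  arguments test against the functions \<open>f p\<close> or \<open>g p\<close> and never handle
  column spaces.\<close>

definition factors_through :: "nat \<Rightarrow> real mat \<Rightarrow> bool" where
  "factors_through k W \<longleftrightarrow>
     (\<exists>f g. \<forall>r<dim_row W. \<forall>j<dim_col W. W $$ (r, j) = (\<Sum>p<k. f p r * g p j))"

lemma factors_throughI:
  assumes "W \<in> carrier_mat n d" "\<And>r j. r < n \<Longrightarrow> j < d \<Longrightarrow> W $$ (r, j) = (\<Sum>p<k. f p r * g p j)"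
  shows "factors_through k W"
  using assms unfolding factors_through_def by (metis carrier_matD)

lemma factors_throughE:
  assumes "factors_through k W" "W \<in> carrier_mat n d"
  obtains f g where "\<And>r j. r < n \<Longrightarrow> j < d \<Longrightarrow> W $$ (r, j) = (\<Sum>p<k. f p r * g p j)"
  using assms unfolding factors_through_def by (metis carrier_matD)

text \<open>A maximal independent set of columns spans all columns, which gives the factorisation.
  Conversely, more than \<open>k\<close> columns that are combinations of the \<open>k\<close>
  functions \<open>f p\<close> are dependent by counting.\<close>

lemma rank_le_iff_factors_through:
  assumes W: "W \<in> carrier_mat n d"
  shows "vec_space.rank n W \<le> k \<longleftrightarrow> factors_through k W"
proof -
  interpret V: vec_space "TYPE(real)" n .
  have cols: "set (cols W) \<subseteq> carrier_vec n" using W cols_dim by blast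
  obtain S where S: "finite S" "maximal S (\<lambda>T. T \<subseteq> set (cols W) \<and> V.lin_indpt T)"
    using maximal_exists_superset[of "set (cols W)" "\<lambda>T. T \<subseteq> set (cols W) \<and> V.lin_indpt T" "{}"]
    by (auto simp: V.lin_dep_def)
  have sub: "S \<subseteq> set (cols W)" "V.lin_indpt S" using S(2) by (auto simp: maximal_def)
  have rank: "V.rank W = card S" by (rule V.rank_card_indpt[OF W S(2)])
  have Sc: "S \<subseteq> carrier_vec n" using sub cols by blast
  obtain h where h: "bij_betw h {..<card S} S" using ex_bij_betw_nat_finite[OF S(1)] by (auto simp: lessThan_atLeast0)
  show ?thesis
  proof
    assume "V.rank W \<le> k"
    then have k: "card S \<le> k" using rank by simp
    have "\<exists>c. \<forall>r<n. col W j $ r = (\<Sum>p<card S. c p * h p $ r)" if j: "j < d" for j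
    proof -
      have cj: "col W j \<in> set (cols W)" using j W by (auto simp: cols_def)
      have "col W j \<in> V.span S"
      proof (rule ccontr)
        assume n: "col W j \<notin> V.span S"
        have "col W j \<notin> S" using n V.span_mem Sc by blast
        moreover have "V.lin_indpt (S \<union> {col W j})"
          using n V.lin_dep_iff_in_span[of S "col W j"] Sc sub(2) cj cols calculation by auto
        ultimately show False using S(2) sub(1) cj unfolding maximal_def
          by (metis Un_insert_right insertI1 insert_subset sup_bot.right_neutral subset_insertI)
      qed
      then obtain a where a: "col W j = V.lincomb a S" using V.finite_span[OF S(1)] Sc by auto
      have "col W j $ r = (\<Sum>p<card S. a (h p) * h p $ r)" if "r < n" for r
        unfolding a V.lincomb_index[OF that Sc] by (rule sum.reindex_bij_betw[OF h, symmetric])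
      then show ?thesis by (intro exI[of _ "\<lambda>p. a (h p)"]) auto
    qed
    then obtain c where c: "\<And>j r. j < d \<Longrightarrow> r < n \<Longrightarrow> col W j $ r = (\<Sum>p<card S. c j p * h p $ r)" by metis
    show "factors_through k W"
    proof (rule factors_throughI[OF W])
      fix r j assume rj: "r < n" "j < d"
      have "(\<Sum>p<k. (if p < card S then h p $ r else 0) * c j p) = (\<Sum>p<card S. h p $ r * c j p)"
        using k by (intro sum.mono_neutral_cong_right) auto
      then show "W $$ (r, j) = (\<Sum>p<k. (if p < card S then h p $ r else 0) * c j p)"
        using c[OF rj(2,1)] rj W by (simp add: mult.commute)
    qed
  next
    assume "factors_through k W"
    then obtain f g where fg: "\<And>r j. r < n \<Longrightarrow> j < d \<Longrightarrow> W $$ (r, j) = (\<Sum>p<k. f p r * g p j)"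
      using factors_throughE[OF _ W] by blast
    have "\<exists>c. \<forall>r<n. v $ r = (\<Sum>p<k. c p * f p r)" if "v \<in> S" for v
    proof -
      have "v \<in> set (cols W)" using that sub(1) by blast
      then obtain j where "j < d" "v = col W j" using W by (auto simp: cols_def)
      then show ?thesis using fg W by (intro exI[of _ "\<lambda>p. g p j"]) (simp add: mult.commute)
    qed
    then obtain c where c: "\<And>v r. v \<in> S \<Longrightarrow> r < n \<Longrightarrow> v $ r = (\<Sum>p<k. c v p * f p r)" by metis
    show "V.rank W \<le> k"
    proof (rule ccontr)
      assume "\<not> V.rank W \<le> k"
      then have "card {..<k} < card S" using rank by simp
      then obtain x where x: "\<forall>p<k. (\<Sum>v\<in>S. c v p * x v) = 0" "\<exists>v\<in>S. x v \<noteq> 0"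
        using underdetermined_solution[of "{..<k}" S "\<lambda>p v. c v p"] S(1) by auto
      have "V.lincomb x S = 0\<^sub>v n"
      proof (rule eq_vecI)
        fix r assume "r < dim_vec (0\<^sub>v n :: real vec)"
        then have r: "r < n" by simp
        have "V.lincomb x S $ r = (\<Sum>v\<in>S. x v * (\<Sum>p<k. c v p * f p r))"
          unfolding V.lincomb_index[OF r Sc] using c r by (intro sum.cong) auto
        also have "\<dots> = (\<Sum>p<k. f p r * (\<Sum>v\<in>S. c v p * x v))"
          unfolding sum_distrib_left by (subst sum.swap) (simp add: algebra_simps)
        also have "\<dots> = 0" using x(1) by simp
        finally show "V.lincomb x S $ r = (0\<^sub>v n) $ r" using r by simp
      qed (use V.lincomb_dim[OF S(1) Sc] in auto)
      then have "V.lin_dep S" unfolding V.lin_dep_def using x(2) S(1) by (auto intro!: exI[of _ S] exI[of _ x])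
      then show False using sub(2) by simp
    qed
  qed
qed

lemma frobenius_norm_sq:
  assumes "X \<in> carrier_mat n d"
  shows "(frobenius_norm X)\<^sup>2 = (\<Sum>j<d. ip {..<n} (\<lambda>r. X $$ (r, j)) (\<lambda>r. X $$ (r, j)))"
proof -
  have "0 \<le> (\<Sum>i<n. \<Sum>j<d. (X $$ (i, j))\<^sup>2)" by (intro sum_nonneg) auto
  then have "(frobenius_norm X)\<^sup>2 = (\<Sum>i<n. \<Sum>j<d. (X $$ (i, j))\<^sup>2)" using assms by (auto simp: frobenius_norm_def)
  also have "\<dots> = (\<Sum>j<d. \<Sum>i<n. (X $$ (i, j))\<^sup>2)" by (rule sum.swap)
  finally show ?thesis by (simp add: ip_def power2_eq_square)
qed

lemma frobenius_norm_nonneg: "0 \<le> frobenius_norm X"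
  unfolding frobenius_norm_def by (intro real_sqrt_ge_zero sum_nonneg) auto

text \<open>Bathtub principle: with weights in \<open>[0, 1]\<close> of total at least
  \<open>n - k\<close>, the sum is smallest when the weight sits on the \<open>n - k\<close>
  smallest values.\<close>

lemma sum_weighted_ge_tail:
  fixes lam e :: "nat \<Rightarrow> real"
  assumes lam: "\<And>i. 0 \<le> lam i" "\<And>i j. i \<le> j \<Longrightarrow> lam j \<le> lam i"
    and e: "\<And>i. i < n \<Longrightarrow> 0 \<le> e i" "\<And>i. i < n \<Longrightarrow> e i \<le> 1" "real n - real k \<le> (\<Sum>i<n. e i)"
  shows "(\<Sum>i=k..<n. lam i) \<le> (\<Sum>i<n. lam i * e i)"
proof (cases "k \<le> n")
  case False
  then show ?thesis using lam(1) e(1) by (auto intro!: sum_nonneg mult_nonneg_nonneg)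
next
  case True
  have split: "(\<Sum>i<n. h i) = (\<Sum>i<k. h i) + (\<Sum>i=k..<n. h i)" for h :: "nat \<Rightarrow> real"
    using sum.atLeastLessThan_concat[of 0 k n h] True by (simp add: lessThan_atLeast0)
  have "(\<Sum>i=k..<n. lam i * (1 - e i)) \<le> (\<Sum>i=k..<n. lam k * (1 - e i))"
    using lam e(2) by (intro sum_mono mult_right_mono) auto
  moreover have "(\<Sum>i<k. lam k * e i) \<le> (\<Sum>i<k. lam i * e i)"
    using lam e(1) True by (intro sum_mono mult_right_mono) auto
  moreover have "lam k * (\<Sum>i=k..<n. 1 - e i) \<le> lam k * (\<Sum>i<k. e i)"
    using e(3) True by (intro mult_left_mono lam(1)) (simp add: split sum_subtractf of_nat_diff)
  ultimately show ?thesis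
    by (simp add: split right_diff_distrib sum_subtractf sum_distrib_left[symmetric] mult.commute[of _ "lam k"])
qed

text \<open>\<open>u i\<close> is the left singular vector number \<open>i + 1\<close> and
  \<open>lam i\<close> its squared singular value. Extending \<open>lam\<close> by 0 keeps it
  decreasing on all of \<open>nat\<close>, so indices beyond \<open>n\<close> may be used
  freely.\<close>

locale gram_basis =
  fixes n d :: nat and A :: "real mat" and u :: "nat \<Rightarrow> nat \<Rightarrow> real" and lam :: "nat \<Rightarrow> real"
  assumes A: "A \<in> carrier_mat n d"
    and orthonormal: "orthonormal {..<n} n u"
    and eigenvector: "\<And>i r. i < n \<Longrightarrow> r < n \<Longrightarrow>
          matvec n (\<lambda>r j. (A * transpose_mat A) $$ (r, j)) (u i) r = lam i * u i r"
    and lam_nonneg: "\<And>i. 0 \<le> lam i"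
    and lam_antimono: "\<And>i j. i \<le> j \<Longrightarrow> lam j \<le> lam i"
    and lam_zero: "\<And>i. n \<le> i \<Longrightarrow> lam i = 0"
begin

abbreviation ipn :: "(nat \<Rightarrow> real) \<Rightarrow> (nat \<Rightarrow> real) \<Rightarrow> real" where "ipn \<equiv> ip {..<n}"
abbreviation acol :: "nat \<Rightarrow> nat \<Rightarrow> real" where "acol j \<equiv> (\<lambda>r. A $$ (r, j))"

lemma ip_u: "i < n \<Longrightarrow> j < n \<Longrightarrow> ipn (u i) (u j) = (if i = j then 1 else 0)"
  using orthonormal by (simp add: orthonormal_def)

lemma parseval: "(\<Sum>i<n. (ipn (u i) x)\<^sup>2) = ipn x x"
  using orthonormal_parseval[OF orthonormal, of x x] by (simp add: power2_eq_square)

text \<open>Both sides are the quadratic form of \<open>A A^T\<close> at \<open>x\<close>, once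
  through the columns of \<open>A\<close> and once in the eigenbasis.\<close>

lemma gram_identity:
  "(\<Sum>j<d. (ipn x (acol j))\<^sup>2) = (\<Sum>i<n. lam i * (ipn (u i) x)\<^sup>2)"
proof -
  let ?M = "\<lambda>r j. (A * transpose_mat A) $$ (r, j)"
  have sym: "?M i j = ?M j i" if "i < n" "j < n" for i j
    using A that by (simp add: comm_scalar_prod[of _ d])
  have "(\<Sum>j<d. (ipn x (acol j))\<^sup>2) = (\<Sum>j<d. \<Sum>r<n. \<Sum>r'<n. x r * (A $$ (r, j) * A $$ (r', j) * x r'))"
    by (simp add: ip_def power2_eq_square sum_product algebra_simps)
  also have "\<dots> = (\<Sum>r<n. \<Sum>r'<n. \<Sum>j<d. x r * (A $$ (r, j) * A $$ (r', j) * x r'))"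
    by (subst sum.swap, rule sum.cong[OF refl], rule sum.swap)
  also have "\<dots> = ipn x (matvec n ?M x)"
    using A by (simp add: ip_def matvec_def scalar_prod_def sum_distrib_left sum_distrib_right lessThan_atLeast0)
  also have "\<dots> = (\<Sum>i<n. ipn (u i) x * ipn (u i) (matvec n ?M x))"
    by (rule orthonormal_parseval[OF orthonormal, symmetric])
  also have "\<dots> = (\<Sum>i<n. lam i * (ipn (u i) x)\<^sup>2)"
  proof (rule sum.cong[OF refl])
    fix i assume "i \<in> {..<n}"
    then have "ipn (matvec n ?M (u i)) x = ipn (\<lambda>r. lam i * u i r) x"
      using eigenvector by (intro ip_cong) auto
    moreover have "ipn (matvec n ?M (u i)) x = ipn (u i) (matvec n ?M x)" by (rule ip_matvec_commute[OF sym])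
    ultimately show "ipn (u i) x * ipn (u i) (matvec n ?M x) = lam i * (ipn (u i) x)\<^sup>2"
      by (simp add: ip_linear power2_eq_square)
  qed
  finally show ?thesis .
qed

lemma frobenius_norm_sq_A: "(frobenius_norm A)\<^sup>2 = (\<Sum>i<n. lam i)"
proof -
  have "(frobenius_norm A)\<^sup>2 = (\<Sum>j<d. \<Sum>i<n. (ipn (u i) (acol j))\<^sup>2)"
    by (simp add: frobenius_norm_sq[OF A] parseval)
  also have "\<dots> = (\<Sum>i<n. \<Sum>j<d. (ipn (u i) (acol j))\<^sup>2)" by (rule sum.swap)
  also have "\<dots> = (\<Sum>i<n. \<Sum>i'<n. lam i' * (ipn (u i') (u i))\<^sup>2)" by (simp only: gram_identity)
  also have "\<dots> = (\<Sum>i<n. \<Sum>i'<n. if i' = i then lam i' else 0)"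
    by (intro sum.cong refl) (simp add: ip_u)
  finally show ?thesis by simp
qed

text \<open>The lower bound of Eckart and Young. Let \<open>E\<close> project onto the complement of
  the column space of \<open>W\<close>. Then \<open>A - W\<close> is at least as large as
  \<open>E A\<close>, whose squared norm is the sum of the \<open>lam i\<close> weighted by
  \<open>|E (u i)|^2\<close>; these weights are at most 1 and have total at least
  \<open>n - k\<close>.\<close>

theorem frobenius_norm_sq_diff_ge:
  assumes W: "W \<in> carrier_mat n d" "factors_through k W"
  shows "(\<Sum>i=k..<n. lam i) \<le> (frobenius_norm (A - W))\<^sup>2"
proof -
  obtain f g where fg: "\<And>r j. r < n \<Longrightarrow> j < d \<Longrightarrow> W $$ (r, j) = (\<Sum>p<k. f p r * g p j)"
    using factors_throughE[OF W(2,1)] by blast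
  define E where "E = residual {..<n} (map f [0..<k])"
  have E: "ipn (E x) (E y) = ipn x (E y)" for x y unfolding E_def by (rule residual_selfadjoint) simp
  let ?unit = "\<lambda>p a. if a = p then 1 else 0 :: real"
  have col: "ipn (E (acol j)) (E (acol j)) \<le> ipn (\<lambda>r. (A - W) $$ (r, j)) (\<lambda>r. (A - W) $$ (r, j))" if j: "j < d" for j
  proof -
    let ?e = "E (acol j)" and ?w = "\<lambda>r. \<Sum>p<k. g p j * f p r"
    have "ipn (f p) ?e = 0" if "p < k" for p unfolding E_def by (rule residual_orthogonal) (use that in auto)
    then have "ipn ?w ?e = 0" by (simp add: ip_linear)
    then have "ipn (\<lambda>r. acol j r - ?w r) ?e = ipn ?e ?e" using E[of "acol j" "acol j"] by (simp add: ip_linear)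
    moreover have "ipn (\<lambda>r. acol j r - ?w r) y = ipn (\<lambda>r. (A - W) $$ (r, j)) y" for y
      using A W(1) fg j by (intro ip_cong) (auto simp: mult.commute)
    ultimately have "(ipn ?e ?e)\<^sup>2 \<le> ipn (\<lambda>r. (A - W) $$ (r, j)) (\<lambda>r. (A - W) $$ (r, j)) * ipn ?e ?e"
      using ip_Cauchy_Schwarz[of "{..<n}" "\<lambda>r. (A - W) $$ (r, j)" ?e] by simp
    then show ?thesis
      using ip_nonneg[of "{..<n}" ?e] by (cases "ipn ?e ?e = 0") (auto simp: power2_eq_square)
  qed
  \<comment> \<open>Since \<open>E\<close> is symmetric, the entries of \<open>E x\<close> are inner
    products of \<open>x\<close> with fixed vectors; this lets the Gram identity be applied under
    the sum.\<close>
  have entry: "ipn (E x) (E x) = (\<Sum>p<n. (ipn x (E (?unit p)))\<^sup>2)" for x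
  proof -
    have "ipn (?unit p) (E x) = ipn x (E (?unit p))" for p by (metis E ip_commute)
    then have "E x p = ipn x (E (?unit p))" if "p < n" for p using that ip_unit[of "{..<n}" p "E x"] by simp
    then show ?thesis by (simp add: ip_def power2_eq_square)
  qed
  have "(\<Sum>i=k..<n. lam i) \<le> (\<Sum>i<n. lam i * ipn (E (u i)) (E (u i)))"
  proof (rule sum_weighted_ge_tail[OF lam_nonneg lam_antimono])
    show "ipn (E (u i)) (E (u i)) \<le> 1" if "i < n" for i
      using residual_norm_le[of "{..<n}" "map f [0..<k]" "u i"] ip_u[OF that that] by (simp add: E_def)
    show "real n - real k \<le> (\<Sum>i<n. ipn (E (u i)) (E (u i)))"
      using sum_residual_orthonormal_ge[of "{..<n}" "{..<n}" u "map f [0..<k]"] ip_u by (simp add: E_def)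
  qed auto
  also have "\<dots> = (\<Sum>p<n. \<Sum>i<n. lam i * (ipn (u i) (E (?unit p)))\<^sup>2)"
    unfolding entry sum_distrib_left by (rule sum.swap)
  also have "\<dots> = (\<Sum>p<n. \<Sum>j<d. (ipn (acol j) (E (?unit p)))\<^sup>2)"
    unfolding gram_identity[symmetric] by (simp add: ip_commute)
  also have "\<dots> = (\<Sum>j<d. ipn (E (acol j)) (E (acol j)))"
    unfolding entry by (rule sum.swap)
  also have "\<dots> \<le> (frobenius_norm (A - W))\<^sup>2"
    using col A W(1) by (subst frobenius_norm_sq[of _ n d]) (auto intro!: sum_mono)
  finally show ?thesis .
qed

end

section \<open>Low-rank approximation in the spectral norm\<close>

abbreviation app :: "real mat \<Rightarrow> (nat \<Rightarrow> real) \<Rightarrow> nat \<Rightarrow> real" where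
  "app X \<equiv> matvec (dim_col X) (\<lambda>r c. X $$ (r, c))"

lemma l2_norm_sq: "(l2_norm v)\<^sup>2 = ip {..<dim_vec v} (($) v) (($) v)"
  by (simp add: l2_norm_def scalar_prod_def ip_def lessThan_atLeast0 sum_nonneg)

lemma l2_norm_nonneg [simp]: "0 \<le> l2_norm v"
  by (simp add: l2_norm_def scalar_prod_def sum_nonneg)

lemma index_mult_mat_vec_app:
  "r < dim_row X \<Longrightarrow> v \<in> carrier_vec (dim_col X) \<Longrightarrow> (X *\<^sub>v v) $ r = app X (($) v) r"
  by (simp add: scalar_prod_def matvec_def lessThan_atLeast0)

lemma l2_norm_mult_sq:
  assumes "X \<in> carrier_mat n d" "v \<in> carrier_vec d"
  shows "(l2_norm (X *\<^sub>v v))\<^sup>2 = ip {..<n} (app X (($) v)) (app X (($) v))"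
proof -
  have "(X *\<^sub>v v) $ r = app X (($) v) r" if "r < n" for r
    using that assms by (intro index_mult_mat_vec_app) auto
  then show ?thesis using assms(1) by (auto simp: l2_norm_sq ip_def)
qed

lemma l2_norm_smult: "l2_norm (c \<cdot>\<^sub>v v) = \<bar>c\<bar> * l2_norm v"
proof -
  have "(c \<cdot>\<^sub>v v) \<bullet> (c \<cdot>\<^sub>v v) = c\<^sup>2 * (v \<bullet> v)"
    by (simp add: scalar_prod_def sum_distrib_left power2_eq_square algebra_simps)
  then show ?thesis by (simp add: l2_norm_def real_sqrt_mult)
qed

lemma frobenius_norm_sq_rows:
  assumes "X \<in> carrier_mat n d"
  shows "(frobenius_norm X)\<^sup>2 = (\<Sum>r<n. ip {..<d} (\<lambda>j. X $$ (r, j)) (\<lambda>j. X $$ (r, j)))"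
  unfolding frobenius_norm_sq[OF assms] ip_def by (rule sum.swap)

lemma l2_norm_mult_le_frobenius:
  assumes "X \<in> carrier_mat n d" "v \<in> carrier_vec d"
  shows "l2_norm (X *\<^sub>v v) \<le> frobenius_norm X * l2_norm v"
proof (rule power2_le_imp_le)
  have "(l2_norm (X *\<^sub>v v))\<^sup>2 = (\<Sum>r<n. (ip {..<d} (\<lambda>j. X $$ (r, j)) (($) v))\<^sup>2)"
    using assms unfolding l2_norm_mult_sq[OF assms] by (simp add: ip_def matvec_def power2_eq_square)
  also have "\<dots> \<le> (\<Sum>r<n. ip {..<d} (\<lambda>j. X $$ (r, j)) (\<lambda>j. X $$ (r, j)) * ip {..<d} (($) v) (($) v))"
    by (intro sum_mono ip_Cauchy_Schwarz)
  also have "\<dots> = (frobenius_norm X * l2_norm v)\<^sup>2"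
    using assms(2) by (simp add: power_mult_distrib frobenius_norm_sq_rows[OF assms(1)] l2_norm_sq sum_distrib_right)
  finally show "(l2_norm (X *\<^sub>v v))\<^sup>2 \<le> (frobenius_norm X * l2_norm v)\<^sup>2" .
qed (simp add: frobenius_norm_nonneg)

lemma l2_norm_mult_le_spectral:
  assumes X: "X \<in> carrier_mat n d" and v: "v \<in> carrier_vec d"
  shows "l2_norm (X *\<^sub>v v) \<le> spectral_norm X * l2_norm v"
proof -
  let ?S = "{v \<in> carrier_vec (dim_col X). l2_norm v \<le> 1}"
  have bdd: "bdd_above ((\<lambda>v. l2_norm (X *\<^sub>v v)) ` ?S)"
  proof (rule bdd_aboveI2)
    fix v assume "v \<in> ?S"
    then show "l2_norm (X *\<^sub>v v) \<le> frobenius_norm X"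
      using l2_norm_mult_le_frobenius[OF X, of v] X frobenius_norm_nonneg[of X]
        mult_left_mono[of "l2_norm v" 1 "frobenius_norm X"] by auto
  qed
  show ?thesis
  proof (cases "l2_norm v = 0")
    case True
    then show ?thesis using l2_norm_mult_le_frobenius[OF X v] by simp
  next
    case False
    let ?w = "(1 / l2_norm v) \<cdot>\<^sub>v v"
    have "l2_norm ?w = 1" using False by (simp add: l2_norm_smult)
    then have "?w \<in> ?S" using v X by simp
    then have "l2_norm (X *\<^sub>v ?w) \<le> spectral_norm X" unfolding spectral_norm_def by (rule cSUP_upper[OF _ bdd])
    moreover have "X *\<^sub>v ?w = (1 / l2_norm v) \<cdot>\<^sub>v (X *\<^sub>v v)" using X v by (rule mult_mat_vec)
    moreover have "0 < l2_norm v" using False l2_norm_nonneg[of v] by linarith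
    ultimately show ?thesis by (simp add: l2_norm_smult field_simps)
  qed
qed

lemma spectral_norm_nonneg: "0 \<le> spectral_norm X"
proof -
  let ?v = "unit_vec (dim_col X) 0 :: real vec"
  show ?thesis
  proof (cases "dim_col X = 0")
    case True
    have "l2_norm (X *\<^sub>v v) = 0" if "v \<in> carrier_vec (dim_col X)" for v
      using that True by (simp add: l2_norm_def scalar_prod_def)
    moreover have "0\<^sub>v (dim_col X) \<in> {v \<in> carrier_vec (dim_col X). l2_norm v \<le> 1}" by (simp add: l2_norm_def)
    ultimately have "(\<lambda>v. l2_norm (X *\<^sub>v v)) ` {v \<in> carrier_vec (dim_col X). l2_norm v \<le> 1} = {0}" by force
    then show ?thesis by (simp add: spectral_norm_def)
  next
    case False
    then have "l2_norm ?v = 1" by (simp add: l2_norm_def)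
    then show ?thesis using l2_norm_mult_le_spectral[of X "dim_row X" "dim_col X" ?v] 
      by (auto intro: order_trans[OF l2_norm_nonneg])
  qed
qed

lemma spectral_norm_le:
  assumes X: "X \<in> carrier_mat n d"
    and le: "\<And>v. v \<in> carrier_vec d \<Longrightarrow> l2_norm v \<le> 1 \<Longrightarrow> l2_norm (X *\<^sub>v v) \<le> c"
  shows "spectral_norm X \<le> c"
  unfolding spectral_norm_def
proof (rule cSUP_least)
  have "0\<^sub>v (dim_col X) \<in> {v \<in> carrier_vec (dim_col X). l2_norm v \<le> 1}" by (simp add: l2_norm_def)
  then show "{v \<in> carrier_vec (dim_col X). l2_norm v \<le> 1} \<noteq> {}" by blast
qed (use X le in auto)

lemma orthonormal_cols:
  assumes "V \<in> carrier_mat d k" "transpose_mat V * V = 1\<^sub>m k"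
  shows "orthonormal {..<d} k (\<lambda>i c. V $$ (c, i))"
  unfolding orthonormal_def
proof (intro allI impI)
  fix i j assume ij: "i < k" "j < k"
  have "(transpose_mat V * V) $$ (i, j) = (1\<^sub>m k :: real mat) $$ (i, j)" using assms by simp
  then show "ip {..<d} (\<lambda>c. V $$ (c, i)) (\<lambda>c. V $$ (c, j)) = (if i = j then 1 else 0)"
    using ij assms(1) by (simp add: ip_def scalar_prod_def lessThan_atLeast0)
qed

lemma frobenius_norm_sq_orthonormal:
  assumes X: "X \<in> carrier_mat n d" and v: "orthonormal {..<d} d v"
  shows "(frobenius_norm X)\<^sup>2 = (\<Sum>i<d. ip {..<n} (app X (v i)) (app X (v i)))"
proof -
  have "(frobenius_norm X)\<^sup>2 = (\<Sum>r<n. \<Sum>i<d. ip {..<d} (v i) (\<lambda>j. X $$ (r, j)) * ip {..<d} (v i) (\<lambda>j. X $$ (r, j)))"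
    unfolding frobenius_norm_sq_rows[OF X] by (simp only: orthonormal_parseval[OF v])
  also have "\<dots> = (\<Sum>i<d. \<Sum>r<n. ip {..<d} (v i) (\<lambda>j. X $$ (r, j)) * ip {..<d} (v i) (\<lambda>j. X $$ (r, j)))"
    by (rule sum.swap)
  finally show ?thesis using X by (simp add: ip_def matvec_def mult.commute)
qed

lemma orthonormal_sum_norm:
  assumes "orthonormal J k v" "j \<le> k"
  shows "ip J (\<lambda>c. \<Sum>i<j. a i * v i c) (\<lambda>c. \<Sum>i<j. a i * v i c) = (\<Sum>i<j. (a i)\<^sup>2)"
proof -
  have "ip J (\<lambda>c. \<Sum>i<j. a i * v i c) (\<lambda>c. \<Sum>i<j. a i * v i c) = (\<Sum>i<j. \<Sum>i'<j. a i * (a i' * ip J (v i) (v i')))"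
    by (simp add: ip_linear sum_distrib_left)
  also have "\<dots> = (\<Sum>i<j. \<Sum>i'<j. if i' = i then (a i)\<^sup>2 else 0)"
    using assms by (intro sum.cong refl) (auto simp: orthonormal_def power2_eq_square)
  finally show ?thesis by simp
qed

lemma matvec_sum: "matvec n M (\<lambda>c. \<Sum>i\<in>I. a i * v i c) r = (\<Sum>i\<in>I. a i * matvec n M (v i) r)"
  unfolding matvec_def sum_distrib_left by (subst sum.swap) (simp add: algebra_simps)

text \<open>The update projects every row of \<open>X\<close> off the unit vector \<open>v\<close>,
  so the identity is Pythagoras row by row.\<close>

lemma frobenius_norm_sq_rank_one_update:
  assumes X: "X \<in> carrier_mat n d" and v: "ip {..<d} v v = 1"
  shows "(frobenius_norm (X - mat n d (\<lambda>(r, j). app X v r * v j)))\<^sup>2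
    = (frobenius_norm X)\<^sup>2 - ip {..<n} (app X v) (app X v)"
proof -
  let ?Y = "X - mat n d (\<lambda>(r, j). app X v r * v j)"
  have Y: "?Y \<in> carrier_mat n d" by (rule minus_carrier_mat) simp
  have "ip {..<d} (\<lambda>j. ?Y $$ (r, j)) (\<lambda>j. ?Y $$ (r, j))
      = ip {..<d} (\<lambda>j. X $$ (r, j)) (\<lambda>j. X $$ (r, j)) - (app X v r)\<^sup>2" if r: "r < n" for r
  proof -
    have a: "ip {..<d} (\<lambda>j. X $$ (r, j)) v = app X v r" "ip {..<d} v (\<lambda>j. X $$ (r, j)) = app X v r"
      using X by (simp_all add: matvec_def ip_def mult.commute)
    have "ip {..<d} (\<lambda>j. ?Y $$ (r, j)) (\<lambda>j. ?Y $$ (r, j))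
      = ip {..<d} (\<lambda>j. X $$ (r, j) - app X v r * v j) (\<lambda>j. X $$ (r, j) - app X v r * v j)"
      using X r by (intro ip_cong) auto
    also have "\<dots> = ip {..<d} (\<lambda>j. X $$ (r, j)) (\<lambda>j. X $$ (r, j)) - (app X v r)\<^sup>2"
      by (simp add: ip_linear v a power2_eq_square)
    finally show ?thesis .
  qed
  then show ?thesis
    unfolding frobenius_norm_sq_rows[OF X] frobenius_norm_sq_rows[OF Y] by (simp add: ip_def[of "{..<n}"] sum_subtractf power2_eq_square)
qed

context gram_basis
begin

text \<open>Removing the direction \<open>v\<close> from \<open>A - W\<close> costs one rank and lowers the squared Frobenius error
  by \<open>\<parallel>(A - W) v\<parallel>\<^sup>2\<close>.\<close>

lemma frobenius_near_optimal_imp_spectral: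
  assumes W: "W \<in> carrier_mat n d" "factors_through k W"
    and opt: "(frobenius_norm (A - W))\<^sup>2 \<le> (\<Sum>i=k..<n. lam i) + \<eta>"
    and v: "v \<in> carrier_vec d"
  shows "(l2_norm ((A - W) *\<^sub>v v))\<^sup>2 \<le> (lam k + \<eta>) * (l2_norm v)\<^sup>2"
proof -
  have AW: "A - W \<in> carrier_mat n d" using W(1) by (rule minus_carrier_mat)
  have unit: "ipn (app (A - W) y) (app (A - W) y) \<le> lam k + \<eta>" if y: "ip {..<d} y y = 1" for y
  proof -
    let ?R = "mat n d (\<lambda>(r, j). app (A - W) y r * y j)"
    obtain f g where fg: "\<And>r j. r < n \<Longrightarrow> j < d \<Longrightarrow> W $$ (r, j) = (\<Sum>p<k. f p r * g p j)"
      using factors_throughE[OF W(2,1)] by blast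
    have WR: "W + ?R \<in> carrier_mat n d" using W(1) by simp
    have "factors_through (Suc k) (W + ?R)"
      by (rule factors_throughI[OF WR, where f = "f(k := app (A - W) y)" and g = "g(k := y)"]) (use fg W(1) in auto)
    then have "(\<Sum>i=Suc k..<n. lam i) \<le> (frobenius_norm (A - (W + ?R)))\<^sup>2"
      by (rule frobenius_norm_sq_diff_ge[OF WR])
    moreover have "A - (W + ?R) = (A - W) - ?R" using A W(1) by (intro eq_matI) auto
    moreover have "(\<Sum>i=k..<n. lam i) = lam k + (\<Sum>i=Suc k..<n. lam i)"
      using lam_zero[of k] by (cases "k < n") (auto simp: sum.atLeast_Suc_lessThan)
    ultimately show ?thesis using frobenius_norm_sq_rank_one_update[OF AW y] opt by simp
  qed
  show ?thesis
  proof (cases "l2_norm v = 0")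
    case True
    then have "(l2_norm ((A - W) *\<^sub>v v))\<^sup>2 \<le> 0"
      using l2_norm_mult_le_frobenius[OF AW v] l2_norm_nonneg[of "(A - W) *\<^sub>v v"] by simp
    then show ?thesis using True by simp
  next
    case False
    let ?c = "l2_norm v"
    let ?y = "\<lambda>j. 1 / ?c * v $ j"
    have "ip {..<d} ?y ?y = 1"
      using False v l2_norm_sq[of v, symmetric] unfolding ip_scale_left ip_scale_right
      by (simp add: power2_eq_square)
    then have "ipn (app (A - W) ?y) (app (A - W) ?y) \<le> lam k + \<eta>" by (rule unit)
    moreover have "app (A - W) ?y = (\<lambda>r. 1 / ?c * app (A - W) (($) v) r)" by (rule ext) (rule matvec_linear(2))
    ultimately have "1 / ?c * (1 / ?c * ipn (app (A - W) (($) v)) (app (A - W) (($) v))) \<le> lam k + \<eta>"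
      by (simp only: ip_scale_left ip_scale_right)
    then have "(l2_norm ((A - W) *\<^sub>v v))\<^sup>2 / ?c\<^sup>2 \<le> lam k + \<eta>"
      unfolding l2_norm_mult_sq[OF AW v] by (simp add: power2_eq_square)
    moreover have "0 < ?c\<^sup>2" using False by simp
    ultimately show ?thesis by (simp add: pos_divide_le_eq)
  qed
qed

text \<open>Among the \<open>k + 1\<close> leading eigenvectors some combination \<open>x\<close> is
  orthogonal to the column space of \<open>W\<close>. Then \<open>x^T (A - W) = x^T A\<close>, and
  the Gram identity bounds its norm from below by \<open>sqrt (lam k) |x|\<close>.\<close>

lemma spectral_norm_diff_ge:
  assumes W: "W \<in> carrier_mat n d" "factors_through k W"
  shows "sqrt (lam k) \<le> spectral_norm (A - W)"
proof (cases "lam k = 0")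
  case True
  then show ?thesis using spectral_norm_nonneg by simp
next
  case False
  then have kn: "k < n" using lam_zero by (meson linorder_not_less)
  have AW: "A - W \<in> carrier_mat n d" using W(1) by (rule minus_carrier_mat)
  obtain f g where fg: "\<And>r j. r < n \<Longrightarrow> j < d \<Longrightarrow> W $$ (r, j) = (\<Sum>p<k. f p r * g p j)"
    using factors_throughE[OF W(2,1)] by blast
  obtain a where a: "\<forall>p<k. (\<Sum>i<Suc k. ipn (f p) (u i) * a i) = 0" "\<exists>i<Suc k. a i \<noteq> 0"
    using underdetermined_solution[of "{..<k}" "{..<Suc k}" "\<lambda>p i. ipn (f p) (u i)"] by auto
  define x where "x r = (\<Sum>i<Suc k. a i * u i r)" for r
  have fx: "ipn (f p) x = 0" if "p < k" for p
    using a(1) that by (simp add: x_def[abs_def] ip_linear mult.commute del: sum.lessThan_Suc)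
  have xx: "ipn x x = (\<Sum>i<Suc k. (a i)\<^sup>2)"
    using orthonormal_sum_norm[OF orthonormal, of "Suc k" a] kn by (simp add: x_def[abs_def] del: sum.lessThan_Suc)
  have "0 < ipn x x" unfolding xx using a(2) by (auto simp del: sum.lessThan_Suc intro!: sum_pos2)
  have ux: "ipn (u i) x = (if i < Suc k then a i else 0)" if "i < n" for i
  proof -
    have "ipn (u i) x = (\<Sum>i'<Suc k. if i' = i then a i' else 0)"
      using that kn unfolding x_def[abs_def] ip_linear by (intro sum.cong refl) (auto simp: ip_u)
    then show ?thesis by (simp del: sum.lessThan_Suc)
  qed
  \<comment> \<open>\<open>y = A^T x\<close> serves as the test vector on the right-hand
    side.\<close>
  define y where "y j = ipn x (acol j)" for j
  have "lam k * ipn x x \<le> (\<Sum>i<Suc k. lam i * (a i)\<^sup>2)"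
    unfolding xx sum_distrib_left using lam_antimono by (intro sum_mono mult_right_mono) auto
  also have "\<dots> = (\<Sum>i<n. lam i * (ipn (u i) x)\<^sup>2)"
    using kn ux by (intro sum.mono_neutral_cong_left) auto
  also have "\<dots> = ip {..<d} y y"
    unfolding gram_identity[symmetric] by (simp add: ip_def[of "{..<d}"] y_def power2_eq_square)
  finally have yy: "lam k * ipn x x \<le> ip {..<d} y y" .
  define v where "v = vec d y"
  have v: "v \<in> carrier_vec d" and vv: "(l2_norm v)\<^sup>2 = ip {..<d} y y"
    by (auto simp: v_def l2_norm_sq intro!: ip_cong)
  have "ipn x (\<lambda>r. (A - W) $$ (r, j)) = y j" if j: "j < d" for j
  proof -
    have "ipn x (\<lambda>r. (A - W) $$ (r, j)) = ipn x (\<lambda>r. acol j r - (\<Sum>p<k. g p j * f p r))"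
      using A W(1) fg j by (intro ip_cong) (auto simp: mult.commute)
    also have "\<dots> = y j" using fx by (simp add: ip_linear y_def ip_commute[of _ x "f _"])
    finally show ?thesis .
  qed
  then have "ip {..<d} y y = (\<Sum>j<d. ipn x (\<lambda>r. (A - W) $$ (r, j)) * y j)" by (simp add: ip_def[of "{..<d}"])
  also have "\<dots> = ipn x (app (A - W) (($) v))"
    using W(1) unfolding ip_def[of "{..<n}"] matvec_def sum_distrib_left sum_distrib_right
    by (subst sum.swap) (simp add: v_def mult.assoc)
  finally have "(ip {..<d} y y)\<^sup>2 \<le> ipn x x * (l2_norm ((A - W) *\<^sub>v v))\<^sup>2"
    using ip_Cauchy_Schwarz[of "{..<n}" x "app (A - W) (($) v)"] by (simp add: l2_norm_mult_sq[OF AW v])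
  also have "\<dots> \<le> ipn x x * ((spectral_norm (A - W))\<^sup>2 * (l2_norm v)\<^sup>2)"
    using power_mono[OF l2_norm_mult_le_spectral[OF AW v] l2_norm_nonneg, of 2]
    by (intro mult_left_mono) (auto simp: power_mult_distrib)
  finally have *: "(ip {..<d} y y)\<^sup>2 \<le> ipn x x * (spectral_norm (A - W))\<^sup>2 * ip {..<d} y y"
    by (simp add: vv mult.assoc)
  have "0 < lam k" using False lam_nonneg[of k] by simp
  then have pos: "0 < ip {..<d} y y" using yy mult_pos_pos[OF _ \<open>0 < ipn x x\<close>, of "lam k"] by linarith
  have "ip {..<d} y y \<le> ipn x x * (spectral_norm (A - W))\<^sup>2"
    using * pos by (simp add: power2_eq_square)
  then have "lam k * ipn x x \<le> (spectral_norm (A - W))\<^sup>2 * ipn x x" using yy by (simp add: mult.commute)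
  then have "lam k \<le> (spectral_norm (A - W))\<^sup>2" using \<open>0 < ipn x x\<close> by simp
  then show ?thesis using spectral_norm_nonneg by (simp add: real_le_lsqrt)
qed

end

section \<open>Approximation within the range of a matrix with orthonormal columns\<close>

lemma app_mult:
  assumes "X \<in> carrier_mat n r" "Y \<in> carrier_mat r d" "i < n"
  shows "app (X * Y) x i = (\<Sum>q<r. X $$ (i, q) * app Y x q)"
proof -
  have "app (X * Y) x i = (\<Sum>c<d. \<Sum>q<r. X $$ (i, q) * (Y $$ (q, c) * x c))"
    using assms by (simp add: matvec_def scalar_prod_def lessThan_atLeast0 sum_distrib_right mult.assoc)
  also have "\<dots> = (\<Sum>q<r. X $$ (i, q) * app Y x q)"
    using assms by (subst sum.swap) (simp add: matvec_def sum_distrib_left)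
  finally show ?thesis .
qed

lemma factors_through_mult_left:
  assumes "Z \<in> carrier_mat n r" "W \<in> carrier_mat r d" "factors_through k W"
  shows "factors_through k (Z * W)"
proof -
  obtain f g where fg: "\<And>q j. q < r \<Longrightarrow> j < d \<Longrightarrow> W $$ (q, j) = (\<Sum>p<k. f p q * g p j)"
    using factors_throughE[OF assms(3,2)] by blast
  show ?thesis
  proof (rule factors_throughI)
    show "Z * W \<in> carrier_mat n d" using assms by simp
    fix i j assume ij: "i < n" "j < d"
    have "(Z * W) $$ (i, j) = (\<Sum>q<r. \<Sum>p<k. Z $$ (i, q) * f p q * g p j)"
      using assms ij fg by (simp add: scalar_prod_def lessThan_atLeast0 sum_distrib_left mult.assoc)
    also have "\<dots> = (\<Sum>p<k. (\<Sum>q<r. Z $$ (i, q) * f p q) * g p j)"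
      unfolding sum_distrib_right by (rule sum.swap)
    finally show "(Z * W) $$ (i, j) = (\<Sum>p<k. (\<Sum>q<r. Z $$ (i, q) * f p q) * g p j)" .
  qed
qed

lemma orthonormal_cols_isometry:
  assumes Z: "Z \<in> carrier_mat n r" "transpose_mat Z * Z = 1\<^sub>m r"
  shows "ip {..<n} (\<lambda>i. \<Sum>q<r. Z $$ (i, q) * y q) (\<lambda>i. \<Sum>q<r. Z $$ (i, q) * y q) = ip {..<r} y y"
  using orthonormal_sum_norm[OF orthonormal_cols[OF Z], of r y]
  by (simp add: ip_def[of "{..<r}"] power2_eq_square mult.commute)

lemma ip_adjoint:
  "ip {..<n} x (\<lambda>i. \<Sum>q<r. Z $$ (i, q) * y q) = ip {..<r} (\<lambda>q. \<Sum>i<n. Z $$ (i, q) * x i) y"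
  unfolding ip_def sum_distrib_left sum_distrib_right by (subst sum.swap) (simp add: algebra_simps)

text \<open>\<open>A - Z B\<close> splits orthogonally into \<open>(I - Z Z^T) A\<close> and
  \<open>Z (Z^T A - B)\<close>. Hence a best approximation \<open>B\<close> of \<open>Z^T A\<close>
  is also best for \<open>A\<close> among the candidates \<open>Z W\<close>.\<close>

lemma frobenius_norm_sq_diff_mult:
  assumes A: "A \<in> carrier_mat n d" and Z: "Z \<in> carrier_mat n r" "transpose_mat Z * Z = 1\<^sub>m r"
    and B: "B \<in> carrier_mat r d"
  shows "(frobenius_norm (A - Z * B))\<^sup>2
    = (frobenius_norm A)\<^sup>2 - (frobenius_norm (transpose_mat Z * A))\<^sup>2 + (frobenius_norm (transpose_mat Z * A - B))\<^sup>2"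
proof -
  let ?Y = "transpose_mat Z * A"
  have car: "A - Z * B \<in> carrier_mat n d" "?Y \<in> carrier_mat r d" "?Y - B \<in> carrier_mat r d"
    using A Z B by (auto intro!: minus_carrier_mat)
  have "ip {..<n} (\<lambda>i. (A - Z * B) $$ (i, j)) (\<lambda>i. (A - Z * B) $$ (i, j))
      = ip {..<n} (\<lambda>i. A $$ (i, j)) (\<lambda>i. A $$ (i, j)) - ip {..<r} (\<lambda>i. ?Y $$ (i, j)) (\<lambda>i. ?Y $$ (i, j))
        + ip {..<r} (\<lambda>i. (?Y - B) $$ (i, j)) (\<lambda>i. (?Y - B) $$ (i, j))" if j: "j < d" for j
  proof -
    let ?b = "\<lambda>q. B $$ (q, j)" and ?a = "\<lambda>i. A $$ (i, j)" and ?y = "\<lambda>q. ?Y $$ (q, j)"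
    let ?zb = "\<lambda>i. \<Sum>q<r. Z $$ (i, q) * ?b q"
    have "ip {..<n} (\<lambda>i. (A - Z * B) $$ (i, j)) (\<lambda>i. (A - Z * B) $$ (i, j))
        = ip {..<n} (\<lambda>i. ?a i - ?zb i) (\<lambda>i. ?a i - ?zb i)"
      using A Z B j by (intro ip_cong) (auto simp: scalar_prod_def lessThan_atLeast0)
    also have "\<dots> = ip {..<n} ?a ?a - 2 * ip {..<n} ?a ?zb + ip {..<n} ?zb ?zb"
      unfolding ip_diff_left ip_diff_right ip_commute[of "{..<n}" ?zb ?a] by simp
    also have "ip {..<n} ?zb ?zb = ip {..<r} ?b ?b" by (rule orthonormal_cols_isometry[OF Z])
    also have "ip {..<n} ?a ?zb = ip {..<r} ?y ?b"
      unfolding ip_adjoint using A Z j by (intro ip_cong) (auto simp: scalar_prod_def lessThan_atLeast0)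
    also have "ip {..<n} ?a ?a - 2 * ip {..<r} ?y ?b + ip {..<r} ?b ?b
      = ip {..<n} ?a ?a - ip {..<r} ?y ?y + ip {..<r} (\<lambda>q. ?y q - ?b q) (\<lambda>q. ?y q - ?b q)"
      unfolding ip_diff_left ip_diff_right ip_commute[of "{..<r}" ?b ?y] by simp
    also have "ip {..<r} (\<lambda>q. ?y q - ?b q) (\<lambda>q. ?y q - ?b q) = ip {..<r} (\<lambda>i. (?Y - B) $$ (i, j)) (\<lambda>i. (?Y - B) $$ (i, j))"
      using Z B j by (intro ip_cong) auto
    finally show ?thesis .
  qed
  then show ?thesis
    by (simp only: frobenius_norm_sq[OF A] frobenius_norm_sq[OF car(1)] frobenius_norm_sq[OF car(2)]
        frobenius_norm_sq[OF car(3)] sum_subtractf[symmetric] sum.distrib[symmetric]) (intro sum.cong, auto)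
qed

context gram_basis
begin

text \<open>The comparison matrix is \<open>C A\<close> with \<open>C = \<Sum>\<^sub>j x\<^sub>j u\<^sub>j\<^sup>T\<close>: its columns lie in the range of
  \<open>Z\<close>, and \<open>u\<^sub>j - x\<^sub>j\<close> has only components along the discarded eigenvectors.\<close>

lemma projected_best_approx_error:
  assumes Z: "Z \<in> carrier_mat n r" "transpose_mat Z * Z = 1\<^sub>m r"
    and B: "best_rank_approx k (transpose_mat Z * A) B"
    and km: "k \<le> m" "k \<le> n"
    and x: "\<And>j i. j < k \<Longrightarrow> i < n \<Longrightarrow> x j i = (\<Sum>q<r. Z $$ (i, q) * y j q)"
    and x_top: "\<And>i j. j < k \<Longrightarrow> i < n \<Longrightarrow> i < m \<Longrightarrow> ipn (u i) (x j) = (if i = j then 1 else 0)"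
    and x_tail: "\<And>i j. j < k \<Longrightarrow> m \<le> i \<Longrightarrow> i < n \<Longrightarrow> lam j * (ipn (u i) (x j))\<^sup>2 \<le> \<tau> * lam i"
  shows "(frobenius_norm (A - Z * B))\<^sup>2 \<le> (\<Sum>i=k..<n. lam i) + real k * \<tau> * (\<Sum>i=m..<n. lam i)"
proof -
  let ?Y = "transpose_mat Z * A"
  have Bc: "B \<in> carrier_mat r d" using B Z A by (auto simp: best_rank_approx_def)
  define W where "W = mat r d (\<lambda>(q, c). \<Sum>j<k. y j q * ipn (u j) (acol c))"
  have W: "W \<in> carrier_mat r d" by (simp add: W_def)
  have "factors_through k W" by (rule factors_throughI[OF W]) (simp add: W_def)
  then have "vec_space.rank r W \<le> k" using rank_le_iff_factors_through[OF W] by simp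
  then have "frobenius_norm (?Y - B) \<le> frobenius_norm (?Y - W)"
    using B W Z A by (auto simp: best_rank_approx_def)
  then have "(frobenius_norm (?Y - B))\<^sup>2 \<le> (frobenius_norm (?Y - W))\<^sup>2"
    by (intro power_mono frobenius_norm_nonneg)
  then have le: "(frobenius_norm (A - Z * B))\<^sup>2 \<le> (frobenius_norm (A - Z * W))\<^sup>2"
    using frobenius_norm_sq_diff_mult[OF A Z Bc] frobenius_norm_sq_diff_mult[OF A Z W] by simp
  \<comment> \<open>With \<open>C\<close> the sum of the dyads \<open>x j (u j)^T\<close>, the
    vector \<open>w i\<close> is \<open>(I - C)^T (u i)\<close>. It turns coefficients of
    \<open>A - C A\<close> into inner products with the columns of \<open>A\<close>.\<close>
  define w where "w i c = u i c - (\<Sum>j<k. ipn (u i) (x j) * u j c)" for i c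
  have AZW: "A - Z * W \<in> carrier_mat n d" using Z W by (intro minus_carrier_mat) simp
  have ZW: "(Z * W) $$ (a, c) = (\<Sum>j<k. x j a * ipn (u j) (acol c))" if "a < n" "c < d" for a c
  proof -
    have "(Z * W) $$ (a, c) = (\<Sum>q<r. \<Sum>j<k. Z $$ (a, q) * y j q * ipn (u j) (acol c))"
      using Z W that by (simp add: scalar_prod_def lessThan_atLeast0 sum_distrib_left W_def mult.assoc)
    also have "\<dots> = (\<Sum>j<k. x j a * ipn (u j) (acol c))"
      using x that by (subst sum.swap) (simp add: sum_distrib_right)
    finally show ?thesis .
  qed
  have coef: "ipn (u i) (\<lambda>a. (A - Z * W) $$ (a, c)) = ipn (w i) (acol c)" if c: "c < d" for i c
  proof -
    have "ipn (u i) (\<lambda>a. (A - Z * W) $$ (a, c))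
        = ipn (u i) (\<lambda>a. acol c a - (\<Sum>j<k. ipn (u j) (acol c) * x j a))"
      using Z W c ZW by (intro ip_cong) (auto simp: mult.commute)
    also have "\<dots> = ipn (w i) (acol c)" 
      unfolding w_def[abs_def] ip_linear by (simp add: mult.commute)
    finally show ?thesis .
  qed
  have "(frobenius_norm (A - Z * W))\<^sup>2 = (\<Sum>c<d. \<Sum>i<n. (ipn (w i) (acol c))\<^sup>2)"
    unfolding frobenius_norm_sq[OF AZW] using coef by (simp add: parseval[symmetric])
  also have "\<dots> = (\<Sum>i<n. \<Sum>c<d. (ipn (w i) (acol c))\<^sup>2)" by (rule sum.swap)
  also have "\<dots> = (\<Sum>i<n. \<Sum>i'<n. lam i' * (ipn (u i') (w i))\<^sup>2)" by (simp only: gram_identity)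
  also have "\<dots> \<le> (\<Sum>i<n. (if i < k then 0 else lam i) + (if i < m then 0 else real k * \<tau> * lam i))"
  proof (rule sum_mono)
    fix i assume "i \<in> {..<n}"
    then have i: "i < n" by simp
    have uw: "ipn (u i') (w i) = (if i' = i then 1 else 0) - (if i' < k then ipn (u i) (x i') else 0)" if "i' < n" for i'
    proof -
      have "(\<Sum>j<k. ipn (u i) (x j) * ipn (u i') (u j)) = (\<Sum>j<k. if j = i' then ipn (u i) (x j) else 0)"
        using km that by (intro sum.cong) (auto simp: ip_u)
      then show ?thesis using i that by (simp add: w_def[abs_def] ip_linear ip_u)
    qed
    \<comment> \<open>For \<open>i < k\<close> the vector \<open>w i\<close> vanishes on the
      eigenbasis; for \<open>k \<le> i < m\<close> it is \<open>u i\<close>; beyond \<open>m\<close>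
      it is \<open>u i\<close> plus the small components of the \<open>x j\<close>, which the tail
      hypothesis bounds.\<close>
    consider "i < k" | "k \<le> i" "i < m" | "m \<le> i" by linarith
    then show "(\<Sum>i'<n. lam i' * (ipn (u i') (w i))\<^sup>2) \<le> (if i < k then 0 else lam i) + (if i < m then 0 else real k * \<tau> * lam i)"
    proof cases
      case 1
      then have "ipn (u i') (w i) = 0" if "i' < n" for i' using uw[OF that] x_top[of i' i] i km by auto
      then show ?thesis using 1 km by simp
    next
      case 2
      then have "ipn (u i') (w i) = (if i' = i then 1 else 0)" if "i' < n" for i' using uw[OF that] x_top[of i' i] i by auto
      then have "(\<Sum>i'<n. lam i' * (ipn (u i') (w i))\<^sup>2) = (\<Sum>i'<n. if i' = i then lam i' else 0)" by (intro sum.cong) auto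
      then show ?thesis using 2 i by simp
    next
      case 3
      have "lam i' * (ipn (u i') (w i))\<^sup>2 \<le> (if i' = i then lam i' else 0) + (if i' < k then \<tau> * lam i else 0)"
        if "i' < n" for i'
        using uw[OF that] x_tail[of i' i] 3 i km by auto
      then have "(\<Sum>i'<n. lam i' * (ipn (u i') (w i))\<^sup>2) \<le> (\<Sum>i'<n. (if i' = i then lam i' else 0) + (if i' < k then \<tau> * lam i else 0))"
        by (intro sum_mono) auto
      also have "\<dots> = lam i + (\<Sum>i'<k. \<tau> * lam i)"
      proof -
        have "(\<Sum>i'<n. if i' < k then \<tau> * lam i else 0) = (\<Sum>i'<k. \<tau> * lam i)"
          using km by (intro sum.mono_neutral_cong_right) auto
        then show ?thesis using i by (simp add: sum.distrib)
      qed
      finally show ?thesis using 3 km by (simp add: mult.assoc)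
    qed
  qed
  also have "\<dots> = (\<Sum>i=k..<n. lam i) + real k * \<tau> * (\<Sum>i=m..<n. lam i)"
  proof -
    have "(\<Sum>i<n. if i < p then 0 else h i) = (\<Sum>i=p..<n. h i)" for p and h :: "nat \<Rightarrow> real"
      by (intro sum.mono_neutral_cong_right) auto
    then show ?thesis by (simp add: sum.distrib sum_distrib_left)
  qed
  finally show ?thesis using le by simp
qed

text \<open>Courant and Fischer by counting: a subspace of dimension \<open>j + 1\<close> contains a
  nonzero \<open>x\<close> whose image under \<open>A\<close> is orthogonal to the first
  \<open>j\<close> eigenvectors, and on such images the form of \<open>A A^T\<close> is at most
  \<open>lam j\<close>.\<close>

lemma weyl_upper:
  assumes v: "orthonormal {..<d} d v" and j: "j < d" and s: "0 \<le> s"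
    and lower: "\<And>a. s * (\<Sum>i<Suc j. (a i)\<^sup>2) \<le>
        ipn (app A (\<lambda>c. \<Sum>i<Suc j. a i * v i c)) (app A (\<lambda>c. \<Sum>i<Suc j. a i * v i c))"
  shows "s \<le> lam j"
proof -
  obtain a where a: "\<forall>p<j. (\<Sum>i<Suc j. ipn (u p) (app A (v i)) * a i) = 0" "\<exists>i<Suc j. a i \<noteq> 0"
    using underdetermined_solution[of "{..<j}" "{..<Suc j}" "\<lambda>p i. ipn (u p) (app A (v i))"] by auto
  define x where "x = (\<lambda>c. \<Sum>i<Suc j. a i * v i c)"
  define w where "w = app A x"
  have xx: "ip {..<d} x x = (\<Sum>i<Suc j. (a i)\<^sup>2)"
    unfolding x_def by (rule orthonormal_sum_norm[OF v]) (use j in simp)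
  have pos: "0 < ip {..<d} x x" unfolding xx using a(2) by (auto simp del: sum.lessThan_Suc intro!: sum_pos2)
  have "ipn (u p) w = 0" if "p < j" for p
  proof -
    have "w = (\<lambda>r. \<Sum>i<Suc j. a i * app A (v i) r)" unfolding w_def x_def by (rule ext) (rule matvec_sum)
    then have "ipn (u p) w = (\<Sum>i<Suc j. a i * ipn (u p) (app A (v i)))" by (simp only: ip_linear)
    then show ?thesis using a(1) that by (simp add: mult.commute del: sum.lessThan_Suc)
  qed
  then have "(\<Sum>i<n. lam i * (ipn (u i) w)\<^sup>2) \<le> (\<Sum>i<n. lam j * (ipn (u i) w)\<^sup>2)"
    using lam_antimono by (intro sum_mono) (metis linorder_not_le mult_right_mono order_refl zero_eq_power2 mult_zero_right zero_le_power2)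
  then have le: "(\<Sum>c<d. (ipn w (acol c))\<^sup>2) \<le> lam j * ipn w w"
    unfolding gram_identity by (simp add: sum_distrib_left[symmetric] parseval)
  \<comment> \<open>Writing \<open>|A x|^2 = <A^T w, x>\<close> with \<open>w = A x\<close> uses
    only the left Gram identity, so no eigenbasis of \<open>A^T A\<close> has to be built.\<close>
  have "ipn w w = (\<Sum>c<d. ipn w (acol c) * x c)"
    using A unfolding w_def ip_def matvec_def sum_distrib_left sum_distrib_right
    by (subst sum.swap) (simp add: mult.assoc)
  then have "(ipn w w)\<^sup>2 \<le> (\<Sum>c<d. (ipn w (acol c))\<^sup>2) * ip {..<d} x x"
    using ip_Cauchy_Schwarz[of "{..<d}" "\<lambda>c. ipn w (acol c)" x] by (simp add: ip_def[of "{..<d}"] power2_eq_square)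
  also have "\<dots> \<le> (lam j * ipn w w) * ip {..<d} x x" by (intro mult_right_mono le) simp
  finally have *: "ipn w w * ipn w w \<le> (lam j * ip {..<d} x x) * ipn w w" by (simp add: power2_eq_square algebra_simps)
  have "ipn w w \<le> lam j * ip {..<d} x x"
  proof (cases "ipn w w = 0")
    case True
    then show ?thesis using lam_nonneg pos by simp
  next
    case False
    then have "0 < ipn w w" using ip_nonneg[of "{..<n}" w] by linarith
    then show ?thesis using * by simp
  qed
  moreover have "s * ip {..<d} x x \<le> ipn w w" unfolding xx using lower[of a] by (simp only: x_def w_def)
  ultimately have "s * ip {..<d} x x \<le> lam j * ip {..<d} x x" by simp
  then show ?thesis using pos by simp
qed

end

section \<open>Singular vectors of the projected approximation\<close>

lemma is_svdD:
  assumes "is_svd X U s V" "X \<in> carrier_mat n d"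
  shows "U \<in> carrier_mat n n" "transpose_mat U * U = 1\<^sub>m n"
    "V \<in> carrier_mat d d" "transpose_mat V * V = 1\<^sub>m d"
    "\<And>i. i < min n d \<Longrightarrow> 0 \<le> s i" "\<And>i j. i \<le> j \<Longrightarrow> j < min n d \<Longrightarrow> s j \<le> s i"
    "X = U * mat n d (\<lambda>(i, j). if i = j then s i else 0) * transpose_mat V"
  using assms by (auto simp: is_svd_def Let_def)

lemma svd_app:
  assumes svd: "is_svd X U s V" and X: "X \<in> carrier_mat n d" and i: "i < d" and r: "r < n"
  shows "app X (\<lambda>c. V $$ (c, i)) r = (if i < n then s i * U $$ (r, i) else 0)"
proof -
  let ?S = "mat n d (\<lambda>(i, j). if i = j then s i else 0)"
  have U: "U \<in> carrier_mat n n" and V: "V \<in> carrier_mat d d" "transpose_mat V * V = 1\<^sub>m d"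
    and eq: "X = U * ?S * transpose_mat V"
    using is_svdD[OF svd X] by blast+
  have "X * V = U * ?S * (transpose_mat V * V)"
    unfolding eq using U V(1) by (intro assoc_mult_mat[of _ n d _ d _ d]) auto
  then have XV: "X * V = U * ?S" using U V(2) by simp
  have "app X (\<lambda>c. V $$ (c, i)) r = (X * V) $$ (r, i)"
    using X V(1) i r by (simp add: matvec_def scalar_prod_def lessThan_atLeast0)
  also have "\<dots> = (\<Sum>a<n. U $$ (r, a) * (if a = i then s a else 0))"
    unfolding XV using U i r by (simp add: scalar_prod_def lessThan_atLeast0)
  also have "\<dots> = (\<Sum>a<n. if a = i then s a * U $$ (r, a) else 0)" by (intro sum.cong) auto
  finally show ?thesis by simp
qed

text \<open>A nonzero \<open>s i\<close> with \<open>i \<ge> k\<close> would make the first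
  \<open>k + 1\<close> singular values positive, so \<open>X\<close> would be injective on the span
  of \<open>k + 1\<close> right singular vectors; but a factorisation through \<open>k\<close>
  functionals has a kernel there.\<close>

lemma svd_singular_values_zero:
  assumes svd: "is_svd X U s V" and X: "X \<in> carrier_mat n d" and rank: "factors_through k X"
    and i: "k \<le> i" "i < n" "i < d"
  shows "s i = 0"
proof (rule ccontr)
  assume "s i \<noteq> 0"
  have U: "U \<in> carrier_mat n n" "transpose_mat U * U = 1\<^sub>m n" and V: "V \<in> carrier_mat d d" "transpose_mat V * V = 1\<^sub>m d"
    and s: "\<And>i. i < min n d \<Longrightarrow> 0 \<le> s i" "\<And>i j. i \<le> j \<Longrightarrow> j < min n d \<Longrightarrow> s j \<le> s i"
    using is_svdD[OF svd X] by blast+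
  have pos: "0 < s p" if "p < Suc k" for p
    using s(1)[of i] s(2)[of p i] \<open>s i \<noteq> 0\<close> i that by auto
  let ?v = "\<lambda>i c. V $$ (c, i)"
  obtain f g where fg: "\<And>r j. r < n \<Longrightarrow> j < d \<Longrightarrow> X $$ (r, j) = (\<Sum>p<k. f p r * g p j)"
    using factors_throughE[OF rank X] by blast
  obtain a where a: "\<forall>p<k. (\<Sum>i<Suc k. ip {..<d} (g p) (?v i) * a i) = 0" "\<exists>i<Suc k. a i \<noteq> 0"
    using underdetermined_solution[of "{..<k}" "{..<Suc k}" "\<lambda>p i. ip {..<d} (g p) (?v i)"] by auto
  let ?x = "\<lambda>c. \<Sum>i<Suc k. a i * ?v i c"
  have "ip {..<d} (g p) ?x = 0" if "p < k" for p
    unfolding ip_linear using a(1) that by (simp add: mult.commute del: sum.lessThan_Suc)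
  then have "(\<Sum>p<k. f p r * ip {..<d} (g p) ?x) = 0" for r by simp
  moreover have "app X ?x r = (\<Sum>p<k. f p r * ip {..<d} (g p) ?x)" if "r < n" for r
  proof -
    have "app X ?x r = (\<Sum>c<d. \<Sum>p<k. f p r * (g p c * ?x c))"
      using X fg that by (simp add: matvec_def sum_distrib_right mult.assoc del: sum.lessThan_Suc)
    also have "\<dots> = (\<Sum>p<k. f p r * ip {..<d} (g p) ?x)"
      unfolding ip_def sum_distrib_left by (rule sum.swap)
    finally show ?thesis .
  qed
  ultimately have "app X ?x r = 0" if "r < n" for r using that by simp
  moreover have "app X ?x r = (\<Sum>i<Suc k. (a i * s i) * U $$ (r, i))" if "r < n" for r
    unfolding matvec_sum using svd_app[OF svd X _ that] i by (intro sum.cong) auto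
  ultimately have "(\<Sum>i<Suc k. (a i * s i) * U $$ (r, i)) = 0" if "r < n" for r using that by simp
  then have "ip {..<n} (\<lambda>r. \<Sum>i<Suc k. (a i * s i) * U $$ (r, i)) (\<lambda>r. \<Sum>i<Suc k. (a i * s i) * U $$ (r, i)) = 0"
    by (intro ip_zero_left) simp
  moreover have "ip {..<n} (\<lambda>r. \<Sum>i<Suc k. (a i * s i) * U $$ (r, i)) (\<lambda>r. \<Sum>i<Suc k. (a i * s i) * U $$ (r, i))
      = (\<Sum>i<Suc k. (a i * s i)\<^sup>2)"
    by (rule orthonormal_sum_norm[OF orthonormal_cols[OF U]]) (use i in simp)
  moreover obtain p where "p < Suc k" "a p \<noteq> 0" using a(2) by blast
  then have "(\<Sum>i<Suc k. (a i * s i)\<^sup>2) > 0"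
    using pos[of p] by (intro sum_pos2[of _ p]) auto
  ultimately show False by simp
qed

context gram_basis
begin

text \<open>Optimality of \<open>B\<close> makes \<open>Z B\<close> agree with
  \<open>Z Z^T A\<close> on its leading right singular vectors. The squared error is then
  \<open>|A|^2\<close> minus the sum of the \<open>s i\<close> squared, so near-optimality bounds
  the sum of \<open>lam i - (s i)^2\<close>, all nonnegative by \<open>weyl_upper\<close>. Since
  \<open>(s i)^2\<close> is at most the Rayleigh quotient, each quotient is nearly at least
  \<open>lam i\<close>; the upper bound comes from Ky Fan's inequality for their sum.\<close>

lemma rayleigh_quotients_near_eigenvalues:
  assumes Z: "Z \<in> carrier_mat n r" "transpose_mat Z * Z = 1\<^sub>m r"
    and B: "best_rank_approx k (transpose_mat Z * A) B"
    and k: "k \<le> n" "k \<le> d"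
    and opt: "(frobenius_norm (A - Z * B))\<^sup>2 \<le> (\<Sum>i=k..<n. lam i) + \<eta>"
    and svd: "is_svd (Z * B) U s V"
    and i: "i < k"
  shows "\<bar>ipn (app A (\<lambda>c. V $$ (c, i))) (app A (\<lambda>c. V $$ (c, i))) - lam i\<bar> \<le> \<eta>"
proof -
  let ?Y = "transpose_mat Z * A"
  let ?v = "\<lambda>i c. V $$ (c, i)"
  have Y: "?Y \<in> carrier_mat r d" using Z A by simp
  have Bc: "B \<in> carrier_mat r d" and Br: "factors_through k B"
    using B Z A rank_le_iff_factors_through[of B r d k] by (auto simp: best_rank_approx_def)
  have ZB: "Z * B \<in> carrier_mat n d" using Z Bc by simp
  have U: "U \<in> carrier_mat n n" "transpose_mat U * U = 1\<^sub>m n" and V: "V \<in> carrier_mat d d" "transpose_mat V * V = 1\<^sub>m d"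
    and s: "\<And>i. i < min n d \<Longrightarrow> 0 \<le> s i" "\<And>i j. i \<le> j \<Longrightarrow> j < min n d \<Longrightarrow> s j \<le> s i"
    using is_svdD[OF svd ZB] by blast+
  have v: "orthonormal {..<d} d ?v" by (rule orthonormal_cols[OF V])
  have iso: "ip {..<r} (app B x) (app B x) = ipn (app (Z * B) x) (app (Z * B) x)" for x
    unfolding orthonormal_cols_isometry[OF Z, symmetric]
    using app_mult[OF Z(1) Bc] by (intro ip_cong) auto
  have "app (Z * B) (?v i) a = 0" if "k \<le> i" "i < d" "a < n" for i a
    using svd_app[OF svd ZB that(2,3)] svd_singular_values_zero[OF svd ZB factors_through_mult_left[OF Z(1) Bc Br] that(1) _ that(2)]
    by simp
  then have "ip {..<r} (app B (?v i)) (app B (?v i)) = 0" if "k \<le> i" "i < d" for i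
    unfolding iso using that by (intro ip_zero_left) auto
  then have Bv0: "app B (?v i) q = 0" if "k \<le> i" "i < d" "q < r" for i q
    using ip_self_eq_0D[of "{..<r}" "app B (?v i)" q] that by auto

  \<comment> \<open>\<open>P M p\<close> is \<open>M\<close> composed with the projection onto the
    first \<open>k\<close> right singular vectors, a competitor of rank at most
    \<open>k\<close>.\<close>
  define P where "P M p = mat p d (\<lambda>(q, c). \<Sum>i<k. app M (?v i) q * ?v i c)" for M p
  have Pv: "app (P M p) (?v i) q = (if i < k then app M (?v i) q else 0)" if "i < d" "q < p" for M p i q
  proof -
    have "app (P M p) (?v i) q = ip {..<d} (\<lambda>c. \<Sum>i'<k. app M (?v i') q * ?v i' c) (?v i)"
      using that unfolding ip_def by (subst matvec_def) (auto simp: P_def intro!: sum.cong)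
    also have "\<dots> = (\<Sum>i'<k. if i' = i then app M (?v i') q else 0)"
      unfolding ip_linear using v that k by (intro sum.cong) (auto simp: orthonormal_def)
    finally show ?thesis by simp
  qed
  have split: "(\<Sum>i<d. h i) = (\<Sum>i<k. h i) + (\<Sum>i=k..<d. h i)" for h :: "nat \<Rightarrow> real"
    using sum.atLeastLessThan_concat[of 0 k d h] k by (simp add: lessThan_atLeast0)
  have app_diff: "app (M - M') x q = app M x q - app M' x q"
    if "M \<in> carrier_mat p d" "M' \<in> carrier_mat p d" "q < p" for M M' x p q
    using that by (simp add: matvec_def sum_subtractf[symmetric] algebra_simps)
  have Pf: "factors_through k (P M p)" "P M p \<in> carrier_mat p d" for M p
  proof -
    show c: "P M p \<in> carrier_mat p d" by (simp add: P_def)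
    show "factors_through k (P M p)" by (rule factors_throughI[OF c]) (simp add: P_def)
  qed
  have Pdiff: "(frobenius_norm (M - P M p))\<^sup>2 = (\<Sum>i=k..<d. ip {..<p} (app M (?v i)) (app M (?v i)))"
    if M: "M \<in> carrier_mat p d" for M p
  proof -
    have "M - P M p \<in> carrier_mat p d" by (intro minus_carrier_mat Pf)
    then have "(frobenius_norm (M - P M p))\<^sup>2 = (\<Sum>i<d. ip {..<p} (app (M - P M p) (?v i)) (app (M - P M p) (?v i)))"
      by (rule frobenius_norm_sq_orthonormal[OF _ v])
    also have "\<dots> = (\<Sum>i<d. if i < k then 0 else ip {..<p} (app M (?v i)) (app M (?v i)))"
      by (intro sum.cong) (auto simp: ip_def app_diff[OF M Pf(2)] Pv simp del: index_minus_mat)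
    finally show ?thesis by (simp add: split)
  qed

  \<comment> \<open>On the vectors \<open>?v i\<close> with \<open>i \<ge> k\<close> both
    \<open>B\<close> and the competitor vanish and leave the same error. On the first
    \<open>k\<close> the competitor has no error, so optimality forces \<open>B\<close> to have none
    either.\<close>
  have "frobenius_norm (?Y - B) \<le> frobenius_norm (?Y - P ?Y r)"
    using B Pf[of ?Y r] rank_le_iff_factors_through[OF Pf(2)] Z A by (auto simp: best_rank_approx_def)
  then have "(frobenius_norm (?Y - B))\<^sup>2 \<le> (\<Sum>i=k..<d. ip {..<r} (app ?Y (?v i)) (app ?Y (?v i)))"
    unfolding Pdiff[OF Y, symmetric] by (intro power_mono frobenius_norm_nonneg)
  moreover have "?Y - B \<in> carrier_mat r d" by (intro minus_carrier_mat Bc)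
  then have "(frobenius_norm (?Y - B))\<^sup>2 = (\<Sum>i<d. ip {..<r} (app (?Y - B) (?v i)) (app (?Y - B) (?v i)))"
    by (rule frobenius_norm_sq_orthonormal[OF _ v])
  moreover have "(\<Sum>i=k..<d. ip {..<r} (app (?Y - B) (?v i)) (app (?Y - B) (?v i))) = (\<Sum>i=k..<d. ip {..<r} (app ?Y (?v i)) (app ?Y (?v i)))"
    by (intro sum.cong ip_cong refl) (auto simp: app_diff[OF Y Bc] Bv0 simp del: index_minus_mat)
  ultimately have "(\<Sum>i<k. ip {..<r} (app (?Y - B) (?v i)) (app (?Y - B) (?v i))) \<le> 0" by (simp add: split)
  then have "(\<Sum>i<k. ip {..<r} (app (?Y - B) (?v i)) (app (?Y - B) (?v i))) = 0"
    by (intro antisym sum_nonneg) auto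
  then have "ip {..<r} (app (?Y - B) (?v i)) (app (?Y - B) (?v i)) = 0" if "i < k" for i
    using that by (subst (asm) sum_nonneg_eq_0_iff) auto
  then have YB: "app ?Y (?v i) q = app B (?v i) q" if "i < k" "q < r" for i q
    using ip_self_eq_0D[of "{..<r}" "app (?Y - B) (?v i)" q] that app_diff[OF Y Bc] by force

  \<comment> \<open>\<open>Z B x\<close> is the orthogonal projection of \<open>A x\<close> onto the
    range of \<open>Z\<close>, for every \<open>x\<close> in the span of the leading right singular
    vectors.\<close>
  have cross: "ipn (app A x) (app (Z * B) x) = ipn (app (Z * B) x) (app (Z * B) x)"
    if x: "x = (\<lambda>c. \<Sum>i<j. a i * ?v i c)" "j \<le> k" for x a j
  proof -
    have "app ?Y x q = app B x q" if "q < r" for q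
      unfolding x(1) matvec_sum using YB that x(2) Y Bc by (intro sum.cong) auto
    moreover have "ipn (app A x) (app (Z * B) x) = ipn (app A x) (\<lambda>i. \<Sum>q<r. Z $$ (i, q) * app B x q)"
      using app_mult[OF Z(1) Bc] by (intro ip_cong) auto
    moreover have "app ?Y x q = (\<Sum>i<n. Z $$ (i, q) * app A x i)" if "q < r" for q
      using Z(1) that by (subst app_mult[of _ r n _ d]) (auto simp: A intro!: sum.cong)
    ultimately have "ipn (app A x) (app (Z * B) x) = ip {..<r} (app B x) (app B x)"
      unfolding ip_adjoint by (simp add: ip_def)
    then show ?thesis by (simp add: iso)
  qed
  have dominate: "ipn (app (Z * B) x) (app (Z * B) x) \<le> ipn (app A x) (app A x)"
    if x: "x = (\<lambda>c. \<Sum>i<j. a i * ?v i c)" "j \<le> k" for x a j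
    using ip_nonneg[of "{..<n}" "\<lambda>c. app A x c - app (Z * B) x c"] cross[OF x]
    unfolding ip_diff_left ip_diff_right ip_commute[of _ "app (Z * B) x" "app A x"] by simp
  have ZBv: "ipn (app (Z * B) (\<lambda>c. \<Sum>i<j. a i * ?v i c)) (app (Z * B) (\<lambda>c. \<Sum>i<j. a i * ?v i c)) = (\<Sum>i<j. (a i * s i)\<^sup>2)"
    if "j \<le> k" for a j
  proof -
    have "app (Z * B) (\<lambda>c. \<Sum>i<j. a i * ?v i c) q = (\<Sum>i<j. (a i * s i) * U $$ (q, i))" if "q < n" for q
      unfolding matvec_sum using svd_app[OF svd ZB _ that] k \<open>j \<le> k\<close> by (intro sum.cong) auto
    then have "ipn (app (Z * B) (\<lambda>c. \<Sum>i<j. a i * ?v i c)) (app (Z * B) (\<lambda>c. \<Sum>i<j. a i * ?v i c))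
      = ipn (\<lambda>q. \<Sum>i<j. (a i * s i) * U $$ (q, i)) (\<lambda>q. \<Sum>i<j. (a i * s i) * U $$ (q, i))"
      by (intro ip_cong) auto
    also have "\<dots> = (\<Sum>i<j. (a i * s i)\<^sup>2)"
      by (rule orthonormal_sum_norm[OF orthonormal_cols[OF U]]) (use k that in simp)
    finally show ?thesis .
  qed
  have single: "?v i = (\<lambda>c. \<Sum>i'<Suc i. (if i' = i then 1 else 0) * ?v i' c)" for i
    by (simp add: fun_eq_iff)
  have ZBs: "ipn (app (Z * B) (?v i)) (app (Z * B) (?v i)) = (s i)\<^sup>2" if "i < k" for i
    using ZBv[of "Suc i" "\<lambda>i'. if i' = i then 1 else 0"] that unfolding single[symmetric] by simp
  let ?n = "\<lambda>i. ipn (app A (?v i)) (app A (?v i))"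
  have lower: "(s i)\<^sup>2 \<le> ?n i" if "i < k" for i
    using dominate[OF single, of i] that ZBs[OF that] by simp

  have weyl: "(s j)\<^sup>2 \<le> lam j" if j: "j < k" for j
  proof (rule weyl_upper[OF v])
    fix a :: "nat \<Rightarrow> real"
    have "(s j)\<^sup>2 * (\<Sum>i<Suc j. (a i)\<^sup>2) \<le> (\<Sum>i<Suc j. (a i * s i)\<^sup>2)"
      unfolding sum_distrib_left power_mult_distrib using s j k
      by (intro sum_mono) (subst mult.commute, intro mult_left_mono power_mono, auto)
    also have "\<dots> \<le> ipn (app A (\<lambda>c. \<Sum>i<Suc j. a i * ?v i c)) (app A (\<lambda>c. \<Sum>i<Suc j. a i * ?v i c))"
      using ZBv[of "Suc j" a] dominate[OF refl, of "Suc j" a] j by simp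
    finally show "(s j)\<^sup>2 * (\<Sum>i<Suc j. (a i)\<^sup>2) \<le> ipn (app A (\<lambda>c. \<Sum>i<Suc j. a i * ?v i c)) (app A (\<lambda>c. \<Sum>i<Suc j. a i * ?v i c))" .
  qed (use j k in auto)

  have FA: "(\<Sum>i<d. ?n i) = (\<Sum>i<n. lam i)"
    using frobenius_norm_sq_orthonormal[OF A v] frobenius_norm_sq_A by simp
  have lsplit: "(\<Sum>i<n. lam i) = (\<Sum>i<k. lam i) + (\<Sum>i=k..<n. lam i)"
    using sum.atLeastLessThan_concat[of 0 k n lam] k by (simp add: lessThan_atLeast0)
  have AZB: "A - Z * B \<in> carrier_mat n d" by (intro minus_carrier_mat ZB)
  have "(frobenius_norm (A - Z * B))\<^sup>2 = (\<Sum>i<d. ?n i - (if i < k then (s i)\<^sup>2 else 0))"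
    unfolding frobenius_norm_sq_orthonormal[OF AZB v]
  proof (rule sum.cong[OF refl])
    fix i assume "i \<in> {..<d}"
    then have id: "i < d" by simp
    have "ipn (app (A - Z * B) (?v i)) (app (A - Z * B) (?v i))
      = ipn (\<lambda>q. app A (?v i) q - app (Z * B) (?v i) q) (\<lambda>q. app A (?v i) q - app (Z * B) (?v i) q)"
      by (intro ip_cong) (auto simp: app_diff[OF A ZB] simp del: index_minus_mat)
    also have "\<dots> = ?n i - (if i < k then (s i)\<^sup>2 else 0)"
    proof (cases "i < k")
      case True
      then show ?thesis
        using cross[OF single, of i] ZBs[OF True]
        unfolding ip_diff_left ip_diff_right ip_commute[of _ "app (Z * B) (?v i)" "app A (?v i)"] by simp
    next
      case False
      then have "app (Z * B) (?v i) q = 0" if "q < n" for q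
        using app_mult[OF Z(1) Bc that, of "?v i"] Bv0[of i] id by simp
      then have "ipn (\<lambda>q. app A (?v i) q - app (Z * B) (?v i) q) (\<lambda>q. app A (?v i) q - app (Z * B) (?v i) q) = ?n i"
        by (intro ip_cong) auto
      then show ?thesis using False by simp
    qed
    finally show "ipn (app (A - Z * B) (?v i)) (app (A - Z * B) (?v i)) = ?n i - (if i < k then (s i)\<^sup>2 else 0)" .
  qed
  also have "\<dots> = (\<Sum>i<n. lam i) - (\<Sum>i<k. (s i)\<^sup>2)"
    unfolding sum_subtractf FA by (simp add: split)
  finally have defect: "(\<Sum>i<k. lam i - (s i)\<^sup>2) \<le> \<eta>" using opt lsplit by (simp add: sum_subtractf)
  have part: "(\<Sum>j\<in>J. lam j - (s j)\<^sup>2) \<le> \<eta>" if "J \<subseteq> {..<k}" for J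
    using sum_mono2[of "{..<k}" J "\<lambda>j. lam j - (s j)\<^sup>2"] that weyl defect by force
  \<comment> \<open>Ky Fan's inequality, obtained from the Eckart-Young bound applied to the
    competitor \<open>P A n\<close>.\<close>
  have "(\<Sum>i=k..<n. lam i) \<le> (\<Sum>i=k..<d. ?n i)"
    using frobenius_norm_sq_diff_ge[OF Pf(2,1), of A] Pdiff[OF A] by simp
  then have kyfan: "(\<Sum>i<k. ?n i) \<le> (\<Sum>i<k. lam i)" using FA lsplit split[of ?n] by simp
  have rem: "(\<Sum>j<k. h j) = h i + (\<Sum>j\<in>{..<k} - {i}. h j)" for h :: "nat \<Rightarrow> real"
    using i by (intro sum.remove) auto
  \<comment> \<open>Ky Fan bounds quotient \<open>i\<close> by the sum of all \<open>lam j\<close>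
    minus the other quotients; replacing these by the smaller \<open>(s j)^2\<close> leaves
    \<open>lam i\<close> plus a partial defect.\<close>
  have "(\<Sum>j\<in>{..<k} - {i}. (s j)\<^sup>2) \<le> (\<Sum>j\<in>{..<k} - {i}. ?n j)" by (intro sum_mono lower) auto
  then have "?n i \<le> lam i + \<eta>"
    using kyfan part[of "{..<k} - {i}"] rem[of ?n] rem[of lam] by (auto simp: sum_subtractf)
  moreover have "lam i - \<eta> \<le> ?n i" using part[of "{i}"] lower[OF i] i by simp
  ultimately show ?thesis by linarith
qed

end

section \<open>From Krylov subspaces to low-rank approximation\<close>

context gram_basis
begin

text \<open>\<open>A\<close> factors through its \<open>d\<close> columns, so the Eckart-Young bound
  for \<open>A\<close> itself makes all eigenvalues from index \<open>d\<close> on vanish.\<close>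

lemma positive_eigenvalue_imp_le_dim_col:
  assumes "0 < lam (k - 1)"
  shows "k \<le> d"
proof (rule ccontr)
  assume "\<not> k \<le> d"
  then have kd: "d \<le> k - 1" by simp
  have kn: "k - 1 < n" using assms lam_zero by (metis less_irrefl linorder_not_le)
  have "factors_through d A"
  proof (rule factors_throughI[OF A])
    fix r j assume "r < n" "j < d"
    then show "A $$ (r, j) = (\<Sum>p<d. A $$ (r, p) * (if p = j then 1 else 0))"
      by (simp add: if_distrib[of "\<lambda>z. _ * z"] cong: if_cong)
  qed
  then have "(\<Sum>i=d..<n. lam i) \<le> (frobenius_norm (A - A))\<^sup>2" by (rule frobenius_norm_sq_diff_ge[OF A])
  also have "\<dots> = 0" using A by (simp add: frobenius_norm_def)
  finally have "(\<Sum>i=d..<n. lam i) \<le> 0" .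
  moreover have "lam (k - 1) \<le> (\<Sum>i=d..<n. lam i)" using kd kn lam_nonneg by (intro member_le_sum) auto
  ultimately show False using assms by simp
qed

theorem projected_best_approx_solves_lra:
  assumes eigval: "\<And>i. lam i = eigval A (Suc i)"
    and Z: "Z \<in> carrier_mat n r" "transpose_mat Z * Z = 1\<^sub>m r"
    and B: "best_rank_approx k (transpose_mat Z * A) B"
    and k: "1 \<le> k" "k \<le> m" "0 < lam (k - 1)"
    and x: "\<And>j i. j < k \<Longrightarrow> i < n \<Longrightarrow> x j i = (\<Sum>q<r. Z $$ (i, q) * y j q)"
    and x_top: "\<And>i j. j < k \<Longrightarrow> i < n \<Longrightarrow> i < m \<Longrightarrow> ipn (u i) (x j) = (if i = j then 1 else 0)"
    and x_tail: "\<And>i j. j < k \<Longrightarrow> m \<le> i \<Longrightarrow> i < n \<Longrightarrow> lam j * (ipn (u i) (x j))\<^sup>2 \<le> \<tau> * lam i"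
    and \<tau>: "0 \<le> \<tau>" "real n * real n * \<tau> \<le> min 1 \<epsilon>" and \<epsilon>: "0 < \<epsilon>"
    and N: "N \<in> {frobenius_norm, spectral_norm}"
  shows "solves_lra N k \<epsilon> A (Z * B)"
proof -
  have "k - 1 < n" using k(3) lam_zero by (metis less_irrefl linorder_not_le)
  then have kn: "k \<le> n" using k(1) by simp
  have kd: "k \<le> d" by (rule positive_eigenvalue_imp_le_dim_col[OF k(3)])
  have Bc: "B \<in> carrier_mat r d" and Br: "factors_through k B"
    using B Z A rank_le_iff_factors_through[of B r d k] by (auto simp: best_rank_approx_def)
  have ZB: "Z * B \<in> carrier_mat n d" using Z Bc by simp
  have ZBf: "factors_through k (Z * B)" by (rule factors_through_mult_left[OF Z(1) Bc Br])
  have AZB: "A - Z * B \<in> carrier_mat n d" by (intro minus_carrier_mat ZB)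
  \<comment> \<open>One excess serves all three guarantees. It is at most \<open>\<epsilon>\<close>
    times the Frobenius tail, and, as the sum has at most \<open>n\<close> terms, also at most
    \<open>\<epsilon> * lam p\<close> for every \<open>p \<le> k\<close>. The factor
    \<open>n * n\<close> in the hypothesis on \<open>\<tau>\<close> pays for \<open>k\<close> and
    for this number of terms.\<close>
  define \<eta> where "\<eta> = real k * \<tau> * (\<Sum>i=m..<n. lam i)"
  have opt: "(frobenius_norm (A - Z * B))\<^sup>2 \<le> (\<Sum>i=k..<n. lam i) + \<eta>"
    unfolding \<eta>_def by (rule projected_best_approx_error[OF Z B k(2) kn x x_top x_tail])
  have k\<tau>: "real k * \<tau> \<le> real n * \<tau>" using kn \<tau> by (intro mult_right_mono) auto
  have n1: "1 \<le> real n" using kn k by simp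
  have kn\<tau>: "real k * \<tau> * real n \<le> \<epsilon>" "real k * \<tau> * real n \<le> 1"
    using mult_right_mono[OF k\<tau>, of "real n"] \<tau>(2) by (auto simp: mult_ac)
  have k\<epsilon>: "real k * \<tau> \<le> \<epsilon>"
    using kn\<tau>(1) mult_left_mono[OF n1, of "real k * \<tau>"] \<tau>(1) by simp
  have tail0: "0 \<le> (\<Sum>i=p..<n. lam i)" for p by (intro sum_nonneg lam_nonneg)
  have "(\<Sum>i=m..<n. lam i) \<le> (\<Sum>i=k..<n. lam i)" using k lam_nonneg by (intro sum_mono2) auto
  then have \<eta>F: "\<eta> \<le> \<epsilon> * (\<Sum>i=k..<n. lam i)"
    unfolding \<eta>_def using k\<epsilon> \<tau> tail0 \<epsilon> by (intro mult_mono) auto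
  have \<eta>S: "\<eta> \<le> \<epsilon> * lam p" if "p \<le> k" for p
  proof -
    have "(\<Sum>i=m..<n. lam i) \<le> (\<Sum>i=m..<n. lam p)" using that k by (intro sum_mono lam_antimono) auto
    also have "\<dots> \<le> real n * lam p" using lam_nonneg by (auto intro!: mult_right_mono)
    finally have "\<eta> \<le> real k * \<tau> * (real n * lam p)" unfolding \<eta>_def using \<tau> by (intro mult_left_mono) auto
    also have "\<dots> = (real k * \<tau> * real n) * lam p" by simp
    also have "\<dots> \<le> \<epsilon> * lam p" using kn\<tau> lam_nonneg by (intro mult_right_mono) auto
    finally show ?thesis .
  qed
  \<comment> \<open>It suffices to lose a factor \<open>1 + \<epsilon>\<close> in the squares, since
    this is at most \<open>(1 + \<epsilon>)^2\<close>.\<close>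
  have sq: "c \<le> (1 + \<epsilon>) * c'" if "0 \<le> c'" "c\<^sup>2 \<le> (1 + \<epsilon>) * c'\<^sup>2" for c c' :: real
  proof (rule power2_le_imp_le)
    have "(1 + \<epsilon>) * c'\<^sup>2 \<le> (1 + \<epsilon>)\<^sup>2 * c'\<^sup>2"
      using \<epsilon> by (intro mult_right_mono) (auto simp: power2_eq_square)
    then show "c\<^sup>2 \<le> ((1 + \<epsilon>) * c')\<^sup>2" using that by (simp add: power_mult_distrib)
  qed (use that \<epsilon> in simp)
  have norm: "N (A - Z * B) \<le> (1 + \<epsilon>) * N (A - B')" if B': "best_rank_approx k A B'" for B'
  proof -
    have B'c: "B' \<in> carrier_mat n d" and B'f: "factors_through k B'"
      using B' A rank_le_iff_factors_through[of B' n d k] by (auto simp: best_rank_approx_def)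
    from N consider "N = frobenius_norm" | "N = spectral_norm" by blast
    then show ?thesis
    proof cases
      case 1
      have "(1 + \<epsilon>) * (\<Sum>i=k..<n. lam i) \<le> (1 + \<epsilon>) * (frobenius_norm (A - B'))\<^sup>2"
        using frobenius_norm_sq_diff_ge[OF B'c B'f] \<epsilon> by (intro mult_left_mono) auto
      then show ?thesis
        unfolding 1 using opt \<eta>F by (intro sq[OF frobenius_norm_nonneg]) (simp add: algebra_simps)
    next
      case 2
      let ?l = "(1 + \<epsilon>) * lam k"
      have "spectral_norm (A - Z * B) \<le> sqrt ?l"
      proof (rule spectral_norm_le[OF AZB])
        fix v :: "real vec" assume v: "v \<in> carrier_vec d" "l2_norm v \<le> 1"
        have "(l2_norm ((A - Z * B) *\<^sub>v v))\<^sup>2 \<le> (lam k + \<eta>) * (l2_norm v)\<^sup>2"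
          by (rule frobenius_near_optimal_imp_spectral[OF ZB ZBf opt v(1)])
        also have "\<dots> \<le> ?l * (l2_norm v)\<^sup>2"
          using \<eta>S[of k] by (intro mult_right_mono) (auto simp: algebra_simps)
        also have "\<dots> \<le> ?l * 1"
          using v(2) \<epsilon> lam_nonneg[of k] by (intro mult_left_mono) (auto intro: power_le_one)
        finally show "l2_norm ((A - Z * B) *\<^sub>v v) \<le> sqrt ?l"
          by (intro real_le_rsqrt) simp
      qed
      moreover have "0 \<le> ?l" using \<epsilon> lam_nonneg[of k] by simp
      ultimately have "(spectral_norm (A - Z * B))\<^sup>2 \<le> ?l"
        using power_mono[OF _ spectral_norm_nonneg, of "A - Z * B" "sqrt ?l" 2] by simp
      also have "\<dots> \<le> (1 + \<epsilon>) * (spectral_norm (A - B'))\<^sup>2"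
        using power_mono[OF spectral_norm_diff_ge[OF B'c B'f], of 2] lam_nonneg[of k] \<epsilon>
        by (intro mult_left_mono) auto
      finally show ?thesis unfolding 2 by (rule sq[OF spectral_norm_nonneg])
    qed
  qed
  have vec: "\<bar>(l2_norm (A *\<^sub>v col V (i - 1)))\<^sup>2 - (singval A i)\<^sup>2\<bar> \<le> \<epsilon> * (singval A k)\<^sup>2"
    if svd: "is_svd (Z * B) U s V" and i: "i \<in> {1..k}" for U s V i
  proof -
    have V: "V \<in> carrier_mat d d" using is_svdD(3)[OF svd ZB] .
    have sv: "(singval A i)\<^sup>2 = lam (i - 1)" if "1 \<le> i" for i
      using that eigval[of "i - 1"] lam_nonneg[of "i - 1"] by (simp add: singval_def)
    have "col V (i - 1) \<in> carrier_vec d" using V i kd by auto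
    then have "(l2_norm (A *\<^sub>v col V (i - 1)))\<^sup>2 = ipn (app A (($) (col V (i - 1)))) (app A (($) (col V (i - 1))))"
      by (rule l2_norm_mult_sq[OF A])
    also have "app A (($) (col V (i - 1))) = app A (\<lambda>c. V $$ (c, i - 1))"
      using A V i kd by (auto simp: fun_eq_iff matvec_def intro!: sum.cong)
    finally have "\<bar>(l2_norm (A *\<^sub>v col V (i - 1)))\<^sup>2 - lam (i - 1)\<bar> \<le> \<eta>"
      using rayleigh_quotients_near_eigenvalues[OF Z B kn kd opt svd, of "i - 1"] i by auto
    also have "\<eta> \<le> \<epsilon> * lam (k - 1)" by (rule \<eta>S) simp
    finally show ?thesis using sv i k by simp
  qed
  show ?thesis
    unfolding solves_lra_def using A ZB ZBf rank_le_iff_factors_through[OF ZB] norm vec by auto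
qed

lemma ip_krylov_col:
  assumes "G \<in> carrier_mat n b" "i < n" "c < b"
  shows "ipn (u i) (\<lambda>r. ((A * transpose_mat A) ^\<^sub>m s * G) $$ (r, c)) = lam i ^ s * ipn (u i) (\<lambda>r. G $$ (r, c))"
  using assms(1)
proof (induction s arbitrary: G)
  case 0
  have "(1\<^sub>m n * G) = G" using 0 by simp
  then show ?case using A by simp
next
  case (Suc s)
  let ?M = "A * transpose_mat A"
  have M: "?M \<in> carrier_mat n n" using A by simp
  have sym: "?M $$ (i, j) = ?M $$ (j, i)" if "i < n" "j < n" for i j
    using A that by (simp add: comm_scalar_prod[of _ d])
  have "?M ^\<^sub>m Suc s * G = ?M ^\<^sub>m s * (?M * G)"
    using Suc.prems M by (simp add: assoc_mult_mat[of _ n n _ n _ b])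
  then have "ipn (u i) (\<lambda>r. (?M ^\<^sub>m Suc s * G) $$ (r, c)) = lam i ^ s * ipn (u i) (\<lambda>r. (?M * G) $$ (r, c))"
    using Suc.IH[of "?M * G"] Suc.prems M by (simp del: pow_mat.simps)
  also have "ipn (u i) (\<lambda>r. (?M * G) $$ (r, c)) = ipn (u i) (matvec n (\<lambda>r j. ?M $$ (r, j)) (\<lambda>r. G $$ (r, c)))"
  proof (rule ip_cong[OF refl])
    fix r assume "r \<in> {..<n}"
    then have "(?M * G) $$ (r, c) = (\<Sum>j<n. ?M $$ (r, j) * G $$ (j, c))"
      using M Suc.prems assms(3) by (subst index_mult_mat(1)) (auto simp: scalar_prod_def lessThan_atLeast0)
    then show "(?M * G) $$ (r, c) = matvec n (\<lambda>r j. ?M $$ (r, j)) (\<lambda>r. G $$ (r, c)) r" by (simp add: matvec_def)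
  qed
  also have "\<dots> = ipn (matvec n (\<lambda>r j. ?M $$ (r, j)) (u i)) (\<lambda>r. G $$ (r, c))"
    by (rule ip_matvec_commute[OF sym, symmetric])
  also have "\<dots> = ipn (\<lambda>r. lam i * u i r) (\<lambda>r. G $$ (r, c))"
    using eigenvector assms(2) by (intro ip_cong) auto
  finally show ?case by (simp add: ip_linear)
qed

text \<open>An element of the block Krylov space is given by one polynomial per column of the
  starting block, and on an eigenvector each power of \<open>A A^T\<close> acts as a power of its
  eigenvalue.\<close>

lemma krylov_polynomial_combination:
  assumes G: "G \<in> carrier_mat n b" and b: "0 < b"
    and Z: "Z \<in> carrier_mat n r" "vec_space.col_space n Z = vec_space.col_space n (krylov_mat A G q)"
    and P: "\<And>c. c < b \<Longrightarrow> degree (P c) < q"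
  shows "\<exists>x y. (\<forall>i<n. x i = (\<Sum>p<r. Z $$ (i, p) * y p)) \<and>
    (\<forall>i<n. ipn (u i) x = (\<Sum>c<b. poly (P c) (lam i) * ipn (u i) (\<lambda>r. G $$ (r, c))))"
proof -
  interpret V: vec_space "TYPE(real)" n .
  let ?K = "krylov_mat A G q"
  let ?M = "A * transpose_mat A"
  have K: "?K \<in> carrier_mat n (b * q)" using A G by (simp add: krylov_mat_def Let_def)
  \<comment> \<open>Column \<open>j = s * b + c\<close> of the Krylov matrix is power
    \<open>s\<close> applied to column \<open>c\<close> of \<open>G\<close>.\<close>
  define a where "a = vec (b * q) (\<lambda>j. coeff (P (j mod b)) (j div b))"
  have "?K *\<^sub>v a \<in> V.col_space ?K"
    unfolding V.col_space_eq[OF K] using K by (auto simp: a_def intro!: bexI[of _ a])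
  then have "?K *\<^sub>v a \<in> V.col_space Z" using Z(2) by simp
  then obtain y where y: "y \<in> carrier_vec r" "Z *\<^sub>v y = ?K *\<^sub>v a"
    unfolding V.col_space_eq[OF Z(1)] using Z(1) by auto
  let ?x = "\<lambda>i. (?K *\<^sub>v a) $ i"
  have "?x i = (\<Sum>p<r. Z $$ (i, p) * y $ p)" if "i < n" for i
    unfolding y(2)[symmetric] using that Z(1) y(1) by (simp add: scalar_prod_def lessThan_atLeast0)
  moreover have "ipn (u i) ?x = (\<Sum>c<b. poly (P c) (lam i) * ipn (u i) (\<lambda>r. G $$ (r, c)))" if i: "i < n" for i
  proof -
    have "ipn (u i) ?x = ipn (u i) (\<lambda>r. \<Sum>j<b * q. coeff (P (j mod b)) (j div b) * (?M ^\<^sub>m (j div b) * G) $$ (r, j mod b))"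
      using A G by (intro ip_cong)
        (auto simp: krylov_mat_def Let_def a_def scalar_prod_def lessThan_atLeast0 mult.commute intro!: sum.cong)
    also have "\<dots> = (\<Sum>j<b * q. coeff (P (j mod b)) (j div b) * (lam i ^ (j div b) * ipn (u i) (\<lambda>r. G $$ (r, j mod b))))"
      unfolding ip_linear using ip_krylov_col[OF G i] b by (intro sum.cong) auto
    also have "\<dots> = (\<Sum>s<q. \<Sum>c<b. coeff (P c) s * (lam i ^ s * ipn (u i) (\<lambda>r. G $$ (r, c))))"
    proof -
      let ?h = "\<lambda>j. coeff (P (j mod b)) (j div b) * (lam i ^ (j div b) * ipn (u i) (\<lambda>r. G $$ (r, j mod b)))"
      have "(\<Sum>j<b * q. ?h j) = (\<Sum>s<q. \<Sum>j\<in>{s*b..<s*b+b}. ?h j)"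
        using sum.nat_group[of ?h b q] by (simp add: mult.commute)
      also have "\<dots> = (\<Sum>s<q. \<Sum>c<b. ?h (s * b + c))"
      proof (rule sum.cong[OF refl])
        fix s show "(\<Sum>j\<in>{s*b..<s*b+b}. ?h j) = (\<Sum>c<b. ?h (s * b + c))"
          by (rule sum.reindex_bij_witness[of _ "\<lambda>c. s * b + c" "\<lambda>j. j - s * b"]) auto
      qed
      finally show ?thesis by simp
    qed
    also have "\<dots> = (\<Sum>c<b. (\<Sum>s<q. coeff (P c) s * lam i ^ s) * ipn (u i) (\<lambda>r. G $$ (r, c)))"
      unfolding sum_distrib_right by (subst sum.swap) (simp add: mult.assoc)
    also have "\<dots> = (\<Sum>c<b. poly (P c) (lam i) * ipn (u i) (\<lambda>r. G $$ (r, c)))"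
    proof (rule sum.cong[OF refl])
      fix c assume "c \<in> {..<b}"
      then have "degree (P c) < q" using P by simp
      then have "(\<Sum>s<q. coeff (P c) s * lam i ^ s) = poly (P c) (lam i)"
        unfolding poly_altdef by (intro sum.mono_neutral_right) (auto simp: coeff_eq_0)
      then show "(\<Sum>s<q. coeff (P c) s * lam i ^ s) * ipn (u i) (\<lambda>r. G $$ (r, c)) = poly (P c) (lam i) * ipn (u i) (\<lambda>r. G $$ (r, c))" by simp
    qed
    finally show ?thesis .
  qed
  ultimately show ?thesis by blast
qed

end

section \<open>Rotation invariance of Gaussian vectors\<close>

text \<open>For a fixed second coordinate a shear is a translation of the first, and vice versa;
  Fubini does the rest.\<close>

lemma nn_integral_lborel_shear:
  fixes g :: "real \<Rightarrow> real \<Rightarrow> ennreal"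
  assumes [measurable]: "case_prod g \<in> borel_measurable (borel \<Otimes>\<^sub>M borel)"
  shows "(\<integral>\<^sup>+x. \<integral>\<^sup>+y. g (x + a * y) y \<partial>lborel \<partial>lborel) = (\<integral>\<^sup>+x. \<integral>\<^sup>+y. g x y \<partial>lborel \<partial>lborel)"
    and "(\<integral>\<^sup>+x. \<integral>\<^sup>+y. g x (y + a * x) \<partial>lborel \<partial>lborel) = (\<integral>\<^sup>+x. \<integral>\<^sup>+y. g x y \<partial>lborel \<partial>lborel)"
proof -
  have [measurable]: "(\<lambda>p. g (f p) (h p)) \<in> borel_measurable M"
    if [measurable]: "f \<in> borel_measurable M" "h \<in> borel_measurable M" for f h and M :: "'c measure"
  proof -
    have "(\<lambda>p. case_prod g (f p, h p)) \<in> borel_measurable M" by measurable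
    then show ?thesis by simp
  qed
  have "(\<integral>\<^sup>+x. \<integral>\<^sup>+y. g (x + a * y) y \<partial>lborel \<partial>lborel) = (\<integral>\<^sup>+y. \<integral>\<^sup>+x. g (x + a * y) y \<partial>lborel \<partial>lborel)"
    by (rule lborel_pair.Fubini'[symmetric]) measurable
  also have "\<dots> = (\<integral>\<^sup>+y. \<integral>\<^sup>+x. g x y \<partial>lborel \<partial>lborel)"
  proof (rule nn_integral_cong)
    fix y show "(\<integral>\<^sup>+x. g (x + a * y) y \<partial>lborel) = (\<integral>\<^sup>+x. g x y \<partial>lborel)"
      using nn_integral_real_affine[of "\<lambda>x. g x y" 1 "a * y"] by (simp add: add.commute)
  qed
  also have "\<dots> = (\<integral>\<^sup>+x. \<integral>\<^sup>+y. g x y \<partial>lborel \<partial>lborel)"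
    by (rule lborel_pair.Fubini') measurable
  finally show "(\<integral>\<^sup>+x. \<integral>\<^sup>+y. g (x + a * y) y \<partial>lborel \<partial>lborel) = (\<integral>\<^sup>+x. \<integral>\<^sup>+y. g x y \<partial>lborel \<partial>lborel)" .
  show "(\<integral>\<^sup>+x. \<integral>\<^sup>+y. g x (y + a * x) \<partial>lborel \<partial>lborel) = (\<integral>\<^sup>+x. \<integral>\<^sup>+y. g x y \<partial>lborel \<partial>lborel)"
  proof (rule nn_integral_cong)
    fix x show "(\<integral>\<^sup>+y. g x (y + a * x) \<partial>lborel) = (\<integral>\<^sup>+y. g x y \<partial>lborel)"
      using nn_integral_real_affine[of "\<lambda>y. g x y" 1 "a * x"] by (simp add: add.commute)
  qed
qed

text \<open>A rotation is a product of three shears.\<close>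

lemma nn_integral_lborel_rotation:
  fixes g :: "real \<Rightarrow> real \<Rightarrow> ennreal"
  assumes [measurable]: "case_prod g \<in> borel_measurable (borel \<Otimes>\<^sub>M borel)"
    and cs: "c\<^sup>2 + s\<^sup>2 = 1" "s \<noteq> 0"
  shows "(\<integral>\<^sup>+x. \<integral>\<^sup>+y. g (c * x - s * y) (s * x + c * y) \<partial>lborel \<partial>lborel) = (\<integral>\<^sup>+x. \<integral>\<^sup>+y. g x y \<partial>lborel \<partial>lborel)"
proof -
  \<comment> \<open>For \<open>c\<close> and \<open>s\<close> the cosine and sine of an angle,
    \<open>a\<close> is minus the tangent of half the angle, the shear factor of the classical
    decomposition; hence \<open>s \<noteq> 0\<close>.\<close>
  define a where "a = (c - 1) / s"
  have [measurable]: "(\<lambda>p. g (f p) (h p)) \<in> borel_measurable M"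
    if [measurable]: "f \<in> borel_measurable M" "h \<in> borel_measurable M" for f h and M :: "'c measure"
  proof -
    have "(\<lambda>p. case_prod g (f p, h p)) \<in> borel_measurable M" by measurable
    then show ?thesis by simp
  qed
  have 1: "y + s * (x + a * y) = s * x + c * y" for x y using cs(2) by (simp add: a_def field_simps)
  have 2: "(x + a * y) + a * (s * x + c * y) = c * x - s * y" for x y
  proof -
    have "a * (1 + c) = - s"
      using cs by (simp add: a_def field_simps power2_eq_square)
    moreover have "a * s = c - 1" using cs(2) by (simp add: a_def)
    moreover have "(x + a * y) + a * (s * x + c * y) = x + (a * s) * x + (a * (1 + c)) * y" by (simp add: algebra_simps)
    ultimately have "(x + a * y) + a * (s * x + c * y) = x + (c - 1) * x + - s * y" by (simp only:)
    then show ?thesis by (simp add: algebra_simps)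
  qed
  have "(\<integral>\<^sup>+x. \<integral>\<^sup>+y. g x y \<partial>lborel \<partial>lborel) = (\<integral>\<^sup>+x. \<integral>\<^sup>+y. g (x + a * y) y \<partial>lborel \<partial>lborel)"
    by (rule nn_integral_lborel_shear(1)[symmetric]) measurable
  also have "\<dots> = (\<integral>\<^sup>+x. \<integral>\<^sup>+y. g (x + a * (y + s * x)) (y + s * x) \<partial>lborel \<partial>lborel)"
    by (rule nn_integral_lborel_shear(2)[of "\<lambda>x y. g (x + a * y) y", symmetric]) measurable
  also have "\<dots> = (\<integral>\<^sup>+x. \<integral>\<^sup>+y. g ((x + a * y) + a * (y + s * (x + a * y))) (y + s * (x + a * y)) \<partial>lborel \<partial>lborel)"
    by (rule nn_integral_lborel_shear(1)[of "\<lambda>x y. g (x + a * (y + s * x)) (y + s * x)", symmetric]) measurable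
  finally show ?thesis by (simp only: 1 2)
qed

text \<open>The product of the two densities depends only on \<open>x^2 + y^2\<close>, which the
  rotation preserves.\<close>

lemma nn_integral_std_normal_rotation:
  fixes f :: "real \<Rightarrow> real \<Rightarrow> ennreal"
  assumes [measurable]: "case_prod f \<in> borel_measurable (borel \<Otimes>\<^sub>M borel)"
    and cs: "c\<^sup>2 + s\<^sup>2 = 1" "s \<noteq> 0"
  shows "(\<integral>\<^sup>+x. \<integral>\<^sup>+y. f (c * x - s * y) (s * x + c * y) \<partial>std_normal_distribution \<partial>std_normal_distribution)
    = (\<integral>\<^sup>+x. \<integral>\<^sup>+y. f x y \<partial>std_normal_distribution \<partial>std_normal_distribution)"
proof -
  have [measurable]: "(\<lambda>p. f (h p) (h' p)) \<in> borel_measurable M"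
    if [measurable]: "h \<in> borel_measurable M" "h' \<in> borel_measurable M" for h h' and M :: "'c measure"
  proof -
    have "(\<lambda>p. case_prod f (h p, h' p)) \<in> borel_measurable M" by measurable
    then show ?thesis by simp
  qed
  define g where "g x y = ennreal (std_normal_density x * std_normal_density y) * f x y" for x y
  have g: "(\<integral>\<^sup>+x. \<integral>\<^sup>+y. h x y \<partial>std_normal_distribution \<partial>std_normal_distribution)
      = (\<integral>\<^sup>+x. \<integral>\<^sup>+y. ennreal (std_normal_density x * std_normal_density y) * h x y \<partial>lborel \<partial>lborel)"
    if [measurable]: "case_prod h \<in> borel_measurable (borel \<Otimes>\<^sub>M borel)" for h :: "real \<Rightarrow> real \<Rightarrow> ennreal"
    by (simp add: nn_integral_density nn_integral_cmult[symmetric] ennreal_mult mult.assoc)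
  have dens: "std_normal_density (c * x - s * y) * std_normal_density (s * x + c * y)
      = std_normal_density x * std_normal_density y" for x y
  proof -
    have "(c * x - s * y)\<^sup>2 + (s * x + c * y)\<^sup>2 = (c\<^sup>2 + s\<^sup>2) * (x\<^sup>2 + y\<^sup>2)"
      by (simp add: power2_eq_square algebra_simps)
    then have "- (c * x - s * y)\<^sup>2 / 2 + - (s * x + c * y)\<^sup>2 / 2 = - x\<^sup>2 / 2 + - y\<^sup>2 / 2" using cs by simp
    then have "exp (- (c * x - s * y)\<^sup>2 / 2) * exp (- (s * x + c * y)\<^sup>2 / 2) = exp (- x\<^sup>2 / 2) * exp (- y\<^sup>2 / 2)"
      by (simp only: exp_add[symmetric])
    then show ?thesis by (simp add: std_normal_density_def)
  qed
  have "(\<integral>\<^sup>+x. \<integral>\<^sup>+y. f (c * x - s * y) (s * x + c * y) \<partial>std_normal_distribution \<partial>std_normal_distribution)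
      = (\<integral>\<^sup>+x. \<integral>\<^sup>+y. g (c * x - s * y) (s * x + c * y) \<partial>lborel \<partial>lborel)"
    by (subst g) (simp_all add: g_def dens)
  also have "\<dots> = (\<integral>\<^sup>+x. \<integral>\<^sup>+y. g x y \<partial>lborel \<partial>lborel)"
    by (rule nn_integral_lborel_rotation[OF _ cs]) (simp add: g_def[abs_def])
  also have "\<dots> = (\<integral>\<^sup>+x. \<integral>\<^sup>+y. f x y \<partial>std_normal_distribution \<partial>std_normal_distribution)"
    unfolding g[OF assms(1)] g_def ..
  finally show ?thesis .
qed

lemma nn_integral_std_normal_reflect:
  assumes [measurable]: "f \<in> borel_measurable borel"
  shows "(\<integral>\<^sup>+x. f (- x) \<partial>std_normal_distribution) = (\<integral>\<^sup>+x. f x \<partial>std_normal_distribution)"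
proof -
  have "(\<integral>\<^sup>+x. f x \<partial>std_normal_distribution) = (\<integral>\<^sup>+x. ennreal (std_normal_density x) * f x \<partial>lborel)"
    by (simp add: nn_integral_density)
  also have "\<dots> = (\<integral>\<^sup>+x. ennreal (std_normal_density (- x)) * f (- x) \<partial>lborel)"
    by (subst nn_integral_real_affine[where c = "-1" and t = 0]) simp_all
  also have "\<dots> = (\<integral>\<^sup>+x. f (- x) \<partial>std_normal_distribution)"
    by (simp add: nn_integral_density std_normal_density_def)
  finally show ?thesis by simp
qed

section \<open>Invariance of the product Gaussian law under orthogonal maps\<close>

abbreviation gauss :: "'a set \<Rightarrow> ('a \<Rightarrow> real) measure" where
  "gauss J \<equiv> Pi\<^sub>M J (\<lambda>_. std_normal_distribution)"

interpretation std_normal: prob_space std_normal_distribution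
  by (rule prob_space_normal_density) simp

interpretation std_normal_product: product_prob_space "\<lambda>_. std_normal_distribution" J for J
  by unfold_locales

text \<open>Invariance of the law is phrased through integrals of nonnegative functions, the form in
  which iterated integrals prove it and Markov's inequality consumes it.\<close>

definition preserves_gauss :: "'a set \<Rightarrow> (('a \<Rightarrow> real) \<Rightarrow> 'a \<Rightarrow> real) \<Rightarrow> bool" where
  "preserves_gauss J T \<longleftrightarrow> T \<in> measurable (gauss J) (gauss J) \<and>
     (\<forall>f \<in> borel_measurable (gauss J). (\<integral>\<^sup>+x. f (T x) \<partial>gauss J) = (\<integral>\<^sup>+x. f x \<partial>gauss J))"

lemma preserves_gauss_comp:
  assumes "preserves_gauss J S" "preserves_gauss J T"
    and eq: "\<And>x. x \<in> space (gauss J) \<Longrightarrow> R x = S (T x)"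
  shows "preserves_gauss J R"
  unfolding preserves_gauss_def
proof (intro conjI ballI)
  have S: "S \<in> measurable (gauss J) (gauss J)" and T: "T \<in> measurable (gauss J) (gauss J)"
    using assms by (auto simp: preserves_gauss_def)
  then have ST: "(\<lambda>x. S (T x)) \<in> measurable (gauss J) (gauss J)" by (rule measurable_compose[rotated])
  then show "R \<in> measurable (gauss J) (gauss J)" using eq by (simp cong: measurable_cong)
  fix f :: "_ \<Rightarrow> ennreal" assume f: "f \<in> borel_measurable (gauss J)"
  have "(\<integral>\<^sup>+x. f (R x) \<partial>gauss J) = (\<integral>\<^sup>+x. f (S (T x)) \<partial>gauss J)" using eq by (intro nn_integral_cong) auto
  also have "\<dots> = (\<integral>\<^sup>+x. f (S x) \<partial>gauss J)"
    using assms(2)[unfolded preserves_gauss_def, THEN conjunct2] measurable_compose[OF S f] by (rule bspec)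
  also have "\<dots> = (\<integral>\<^sup>+x. f x \<partial>gauss J)" using assms(1) f by (simp add: preserves_gauss_def)
  finally show "(\<integral>\<^sup>+x. f (R x) \<partial>gauss J) = (\<integral>\<^sup>+x. f x \<partial>gauss J)" .
qed

lemma preserves_gauss_id:
  assumes "\<And>x. x \<in> space (gauss J) \<Longrightarrow> T x = x"
  shows "preserves_gauss J T"
proof -
  have "T \<in> measurable (gauss J) (gauss J)" using measurable_ident assms by (simp cong: measurable_cong)
  moreover have "(\<integral>\<^sup>+x. f (T x) \<partial>gauss J) = (\<integral>\<^sup>+x. f x \<partial>gauss J)" for f :: "_ \<Rightarrow> ennreal"
    using assms by (intro nn_integral_cong) simp
  ultimately show ?thesis by (simp add: preserves_gauss_def)
qed

lemma preserves_gauss_reflect: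
  assumes J: "finite J" "p \<in> J"
  shows "preserves_gauss J (\<lambda>x. x(p := - x p))"
  unfolding preserves_gauss_def
proof (intro conjI ballI)
  define K where "K = J - {p}"
  have K: "J = insert p K" "p \<notin> K" "finite K" using J by (auto simp: K_def)
  show T[measurable]: "(\<lambda>x. x(p := - x p)) \<in> measurable (gauss J) (gauss J)"
    unfolding fun_upd_def using J(2) by (intro measurable_PiM_single') (auto simp: space_PiM PiE_iff extensional_def)
  fix f :: "_ \<Rightarrow> ennreal" assume f[measurable]: "f \<in> borel_measurable (gauss J)"
  have fT: "(\<lambda>x. f (x(p := - x p))) \<in> borel_measurable (gauss J)" by measurable
  note ins = product_sigma_finite.product_nn_integral_insert[OF std_normal_product.product_sigma_finite_axioms K(3,2)]
  have [measurable]: "f \<in> borel_measurable (gauss (insert p K))" using f K(1) by simp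
  have "(\<integral>\<^sup>+x. f (x(p := - x p)) \<partial>gauss J) = (\<integral>\<^sup>+x. \<integral>\<^sup>+y. f (x(p := - y)) \<partial>std_normal_distribution \<partial>gauss K)"
    using ins[of "\<lambda>x. f (x(p := - x p))"] fT K(1) by simp
  also have "\<dots> = (\<integral>\<^sup>+x. \<integral>\<^sup>+y. f (x(p := y)) \<partial>std_normal_distribution \<partial>gauss K)"
  proof (rule nn_integral_cong)
    fix x assume x[measurable]: "x \<in> space (gauss K)"
    have "(\<lambda>y. f (x(p := y))) \<in> borel_measurable borel"
      using measurable_component_update[OF x K(2)] \<open>f \<in> borel_measurable (gauss (insert p K))\<close>
      by (auto intro: measurable_compose)
    then show "(\<integral>\<^sup>+y. f (x(p := - y)) \<partial>std_normal_distribution) = (\<integral>\<^sup>+y. f (x(p := y)) \<partial>std_normal_distribution)"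
      by (rule nn_integral_std_normal_reflect)
  qed
  also have "\<dots> = (\<integral>\<^sup>+x. f x \<partial>gauss J)" using ins[of f] K(1) by simp
  finally show "(\<integral>\<^sup>+x. f (x(p := - x p)) \<partial>gauss J) = (\<integral>\<^sup>+x. f x \<partial>gauss J)" .
qed

lemma preserves_gauss_plane_rotation:
  assumes J: "finite J" "p \<in> J" "q \<in> J" "p \<noteq> q" and cs: "c\<^sup>2 + s\<^sup>2 = 1" "s \<noteq> 0"
  shows "preserves_gauss J (\<lambda>x. x(p := c * x p - s * x q, q := s * x p + c * x q))"
  unfolding preserves_gauss_def
proof (intro conjI ballI)
  let ?T = "\<lambda>x. x(p := c * x p - s * x q, q := s * x p + c * x q)"
  define K where "K = J - {p, q}"
  have K: "J = insert p (insert q K)" "p \<notin> insert q K" "q \<notin> K" "finite K" using J by (auto simp: K_def)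
  show T[measurable]: "?T \<in> measurable (gauss J) (gauss J)"
    unfolding fun_upd_def using J by (intro measurable_PiM_single') (auto simp: space_PiM PiE_iff extensional_def)
  fix f :: "_ \<Rightarrow> ennreal" assume f[measurable]: "f \<in> borel_measurable (gauss J)"
  note ins = product_sigma_finite.product_nn_integral_insert[OF std_normal_product.product_sigma_finite_axioms]
  have two: "(\<integral>\<^sup>+x. h x \<partial>gauss J)
      = (\<integral>\<^sup>+x. \<integral>\<^sup>+z. \<integral>\<^sup>+y. h (x(q := z, p := y)) \<partial>std_normal_distribution \<partial>std_normal_distribution \<partial>gauss K)"
    if h: "h \<in> borel_measurable (gauss J)" for h
  proof -
    have h': "h \<in> borel_measurable (gauss (insert p (insert q K)))" using h K(1) by simp
    have "(\<integral>\<^sup>+x. h x \<partial>gauss J) = (\<integral>\<^sup>+x. \<integral>\<^sup>+y. h (x(p := y)) \<partial>std_normal_distribution \<partial>gauss (insert q K))"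
      unfolding K(1) by (rule ins[OF _ K(2) h']) (use K in simp)
    also have "\<dots> = (\<integral>\<^sup>+x. \<integral>\<^sup>+z. \<integral>\<^sup>+y. h (x(q := z, p := y)) \<partial>std_normal_distribution \<partial>std_normal_distribution \<partial>gauss K)"
    proof (rule ins[OF K(4,3)])
      have "(\<lambda>(x, y). h (x(p := y))) \<in> borel_measurable (gauss (insert q K) \<Otimes>\<^sub>M std_normal_distribution)"
        using measurable_compose[OF measurable_add_dim h'] by (simp add: split_beta')
      then show "(\<lambda>x. \<integral>\<^sup>+y. h (x(p := y)) \<partial>std_normal_distribution) \<in> borel_measurable (gauss (insert q K))"
        by (rule std_normal.borel_measurable_nn_integral)
    qed
    finally show ?thesis .
  qed
  have fT: "(\<lambda>x. f (?T x)) \<in> borel_measurable (gauss J)" by measurable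
  \<comment> \<open>Coordinate \<open>q\<close> is integrated in the outer and \<open>p\<close> in
    the inner integral, so the plane rotation appears with \<open>- s\<close> in place of
    \<open>s\<close>.\<close>
  have "(\<integral>\<^sup>+x. f (?T x) \<partial>gauss J)
      = (\<integral>\<^sup>+x. \<integral>\<^sup>+z. \<integral>\<^sup>+y. f (x(q := c * z - (- s) * y, p := (- s) * z + c * y)) \<partial>std_normal_distribution \<partial>std_normal_distribution \<partial>gauss K)"
    unfolding two[OF fT] using J(4) by (simp add: fun_upd_twist algebra_simps)
  also have "\<dots> = (\<integral>\<^sup>+x. \<integral>\<^sup>+z. \<integral>\<^sup>+y. f (x(q := z, p := y)) \<partial>std_normal_distribution \<partial>std_normal_distribution \<partial>gauss K)"
  proof (rule nn_integral_cong)
    fix x assume x: "x \<in> space (gauss K)"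
    have "(\<lambda>(z, y). x(q := z, p := y)) \<in> measurable (borel \<Otimes>\<^sub>M borel) (gauss J)"
      unfolding split_beta' fun_upd_def using x
      by (intro measurable_PiM_single') (auto simp: space_PiM PiE_iff extensional_def K)
    from measurable_compose[OF this f]
    have "case_prod (\<lambda>z y. f (x(q := z, p := y))) \<in> borel_measurable (borel \<Otimes>\<^sub>M borel)" by (simp add: split_beta')
    then show "(\<integral>\<^sup>+z. \<integral>\<^sup>+y. f (x(q := c * z - (- s) * y, p := (- s) * z + c * y)) \<partial>std_normal_distribution \<partial>std_normal_distribution)
      = (\<integral>\<^sup>+z. \<integral>\<^sup>+y. f (x(q := z, p := y)) \<partial>std_normal_distribution \<partial>std_normal_distribution)"
      by (rule nn_integral_std_normal_rotation[of "\<lambda>z y. f (x(q := z, p := y))"]) (use cs in auto)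
  qed
  also have "\<dots> = (\<integral>\<^sup>+x. f x \<partial>gauss J)" by (rule two[OF f, symmetric])
  finally show "(\<integral>\<^sup>+x. f (?T x) \<partial>gauss J) = (\<integral>\<^sup>+x. f x \<partial>gauss J)" .
qed

definition coord_map :: "'a set \<Rightarrow> ('a \<Rightarrow> 'a \<Rightarrow> real) \<Rightarrow> ('a \<Rightarrow> real) \<Rightarrow> 'a \<Rightarrow> real" where
  "coord_map J Q x = (\<lambda>a\<in>J. \<Sum>b\<in>J. Q a b * x b)"

text \<open>Givens rotations clear column \<open>p\<close> one entry at a time; \<open>S\<close> is the set of columns that may still
  differ from unit vectors.\<close>

lemma preserves_gauss_orthogonal_aux:
  assumes J: "finite J" and S: "finite S" "S \<subseteq> J"
    and cols: "\<And>a b. a \<in> J \<Longrightarrow> b \<in> J \<Longrightarrow> (\<Sum>k\<in>J. Q k a * Q k b) = (if a = b then 1 else 0)"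
    and fixed: "\<And>a b. a \<in> J \<Longrightarrow> b \<in> J - S \<Longrightarrow> Q a b = (if a = b then 1 else 0)"
  shows "preserves_gauss J (coord_map J Q)"
  using S cols fixed
proof (induction S arbitrary: Q rule: finite_induct)
  case empty
  show ?case
  proof (rule preserves_gauss_id)
    fix x :: "'a \<Rightarrow> real" assume x: "x \<in> space (gauss J)"
    have "(\<Sum>b\<in>J. Q a b * x b) = x a" if "a \<in> J" for a
    proof -
      have "(\<Sum>b\<in>J. Q a b * x b) = (\<Sum>b\<in>J. if b = a then x b else 0)"
        using empty that by (intro sum.cong) auto
      then show ?thesis using J that by simp
    qed
    then show "coord_map J Q x = x"
      using x by (auto simp: coord_map_def space_PiM PiE_iff extensional_def restrict_def fun_eq_iff)
  qed
next
  case (insert p S)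
  have p: "p \<in> J" "p \<notin> S" and SJ: "S \<subseteq> J" using insert by auto
  have "preserves_gauss J (coord_map J R)"
    if "\<And>a b. a \<in> J \<Longrightarrow> b \<in> J \<Longrightarrow> (\<Sum>k\<in>J. R k a * R k b) = (if a = b then 1 else 0)"
      "\<And>a b. a \<in> J \<Longrightarrow> b \<in> J - insert p S \<Longrightarrow> R a b = (if a = b then 1 else 0)" for R
    using that
  proof (induction "card {a \<in> S. R a p \<noteq> 0}" arbitrary: R rule: less_induct)
    case less
    note cols = less.prems(1) and fixed = less.prems(2)
    \<comment> \<open>Orthogonality to the columns that are already unit vectors confines column
      \<open>p\<close> to the rows in \<open>insert p S\<close>.\<close>
    have outside: "R a p = 0" if a: "a \<in> J - insert p S" for a
    proof -
      have "(\<Sum>k\<in>J. R k a * R k p) = (\<Sum>k\<in>J. if k = a then R k p else 0)"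
        using fixed a by (intro sum.cong) auto
      then show ?thesis using cols[of a p] a p J by auto
    qed
    show ?case
    proof (cases "{a \<in> S. R a p \<noteq> 0} = {}")
      case True
      then have zero: "R a p = 0" if "a \<in> J" "a \<noteq> p" for a using outside that by auto
      have "(\<Sum>k\<in>J. R k p * R k p) = (\<Sum>k\<in>J. if k = p then R p p * R p p else 0)"
        using zero by (intro sum.cong) auto
      then have "R p p * R p p = 1" using cols[of p p] p J by simp
      then consider "R p p = 1" | "R p p = - 1" by (metis square_eq_1_iff)
      then show ?thesis
      proof cases
        case 1
        show ?thesis
        proof (rule insert.IH[OF SJ cols])
          show "R a b = (if a = b then 1 else 0)" if "a \<in> J" "b \<in> J - S" for a b
            using that fixed[of a b] zero[of a] 1 by (cases "b = p") auto
        qed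
      next
        case 2
        define R' where "R' a b = (if a = p then - R a b else R a b)" for a b
        have "preserves_gauss J (coord_map J R')"
        proof (rule insert.IH[OF SJ])
          show "(\<Sum>k\<in>J. R' k a * R' k b) = (if a = b then 1 else 0)" if "a \<in> J" "b \<in> J" for a b
          proof -
            have "(\<Sum>k\<in>J. R' k a * R' k b) = (\<Sum>k\<in>J. R k a * R k b)" by (intro sum.cong) (auto simp: R'_def)
            then show ?thesis using cols[OF that] by simp
          qed
          show "R' a b = (if a = b then 1 else 0)" if "a \<in> J" "b \<in> J - S" for a b
            using that fixed[of a b] zero[of a] 2 by (cases "b = p") (auto simp: R'_def)
        qed
        then show ?thesis
          by (rule preserves_gauss_comp[OF preserves_gauss_reflect[OF J p(1)]])
            (auto simp: coord_map_def R'_def fun_eq_iff p sum_negf)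
      qed
    next
      case False
      then obtain q where q: "q \<in> S" "R q p \<noteq> 0" by blast
      have qJ: "q \<in> J" "q \<noteq> p" using q p SJ by auto
      define h where "h = sqrt ((R p p)\<^sup>2 + (R q p)\<^sup>2)"
      have h2: "h\<^sup>2 = (R p p)\<^sup>2 + (R q p)\<^sup>2" by (simp add: h_def)
      have h0: "h \<noteq> 0" using q(2) unfolding h_def by (simp add: sum_power2_eq_zero_iff)
      \<comment> \<open>The Givens angle: with this choice \<open>s * R p p + c * R q p = 0\<close>,
        so the entry of \<open>R'\<close> at \<open>(q, p)\<close> vanishes.\<close>
      define c s where "c = R p p / h" and "s = - R q p / h"
      have cs: "c\<^sup>2 + s\<^sup>2 = 1" "s \<noteq> 0"
      proof -
        have "c\<^sup>2 + s\<^sup>2 = ((R p p)\<^sup>2 + (R q p)\<^sup>2) / h\<^sup>2"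
          by (simp add: c_def s_def power_divide add_divide_distrib)
        then show "c\<^sup>2 + s\<^sup>2 = 1" unfolding h2[symmetric] using h0 by simp
      qed (use q h0 in \<open>simp add: s_def\<close>)
      define R' where "R' a b = (if a = p then c * R p b - s * R q b else if a = q then s * R p b + c * R q b else R a b)" for a b
      have split: "(\<Sum>k\<in>J. h k) = h p + (h q + (\<Sum>k\<in>J - {p} - {q}. h k))" for h :: "'a \<Rightarrow> real"
        using J p qJ sum.remove[of J p h] sum.remove[of "J - {p}" q h] by simp
      have pl: "preserves_gauss J (coord_map J R')"
      proof (rule less.hyps)
        have "R' q p = 0" using qJ by (simp add: R'_def c_def s_def)
        moreover have "R' a p = R a p" if "a \<in> S" "a \<noteq> q" for a
        proof -
          have "a \<noteq> p" using that p by blast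
          then show ?thesis unfolding R'_def using that by simp
        qed
        ultimately have "{a \<in> S. R' a p \<noteq> 0} \<subseteq> {a \<in> S. R a p \<noteq> 0} - {q}" by fastforce
        then have "{a \<in> S. R' a p \<noteq> 0} \<subset> {a \<in> S. R a p \<noteq> 0}" using q by blast
        then show "card {a \<in> S. R' a p \<noteq> 0} < card {a \<in> S. R a p \<noteq> 0}"
          using insert.hyps(1) by (intro psubset_card_mono) auto
        show "(\<Sum>k\<in>J. R' k a * R' k b) = (if a = b then 1 else 0)" if ab: "a \<in> J" "b \<in> J" for a b
        proof -
          have "R' p a * R' p b + R' q a * R' q b = (c\<^sup>2 + s\<^sup>2) * (R p a * R p b + R q a * R q b)"
            using qJ by (simp add: R'_def power2_eq_square algebra_simps)
          moreover have "(\<Sum>k\<in>J - {p} - {q}. R' k a * R' k b) = (\<Sum>k\<in>J - {p} - {q}. R k a * R k b)"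
            by (intro sum.cong) (auto simp: R'_def)
          ultimately have "(\<Sum>k\<in>J. R' k a * R' k b) = (\<Sum>k\<in>J. R k a * R k b)"
            unfolding split using cs by simp
          then show ?thesis using cols[OF ab] by simp
        qed
        show "R' a b = (if a = b then 1 else 0)" if ab: "a \<in> J" "b \<in> J - insert p S" for a b
          using fixed[OF ab] fixed[OF p(1) ab(2)] fixed[OF qJ(1) ab(2)] ab q by (auto simp: R'_def)
      qed
      \<comment> \<open>The inverse rotation, which recovers \<open>R\<close> from
        \<open>R'\<close>.\<close>
      have pr: "preserves_gauss J (\<lambda>x. x(p := c * x p - (- s) * x q, q := (- s) * x p + c * x q))"
        using J p qJ cs by (intro preserves_gauss_plane_rotation) auto
      show ?thesis
      proof (rule preserves_gauss_comp[OF pr pl])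
        fix x :: "'a \<Rightarrow> real"
        let ?r = "\<lambda>a. \<Sum>b\<in>J. R a b * x b"
        have 1: "coord_map J R' x p = c * ?r p - s * ?r q" "coord_map J R' x q = s * ?r p + c * ?r q"
          using p qJ by (simp_all add: coord_map_def R'_def sum_subtractf sum.distrib sum_distrib_left algebra_simps)
        have "c * (c * ?r p - s * ?r q) + s * (s * ?r p + c * ?r q) = (c\<^sup>2 + s\<^sup>2) * ?r p"
          "- s * (c * ?r p - s * ?r q) + c * (s * ?r p + c * ?r q) = (c\<^sup>2 + s\<^sup>2) * ?r q"
          by (simp_all add: power2_eq_square algebra_simps)
        then have 2: "c * coord_map J R' x p - (- s) * coord_map J R' x q = ?r p"
          "(- s) * coord_map J R' x p + c * coord_map J R' x q = ?r q"
          unfolding 1 using cs(1) by simp_all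
        have "coord_map J R' x a = coord_map J R x a" if "a \<noteq> p" "a \<noteq> q" for a
          using that by (simp add: coord_map_def R'_def)
        then show "coord_map J R x = (coord_map J R' x)(p := c * coord_map J R' x p - (- s) * coord_map J R' x q,
            q := (- s) * coord_map J R' x p + c * coord_map J R' x q)"
          unfolding 2 using p qJ by (auto simp: fun_eq_iff coord_map_def)
      qed
    qed
  qed
  then show ?case using insert.prems by blast
qed

theorem gauss_orthogonal_invariance:
  assumes J: "finite J"
    and cols: "\<And>a b. a \<in> J \<Longrightarrow> b \<in> J \<Longrightarrow> (\<Sum>k\<in>J. Q k a * Q k b) = (if a = b then 1 else 0)"
  shows "preserves_gauss J (coord_map J Q)"
  by (rule preserves_gauss_orthogonal_aux[OF J J _ cols]) auto

section \<open>Block Krylov matrices\<close>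

lemma L2_set_sq: "(L2_set x J)\<^sup>2 = ip J x x"
  by (simp add: L2_set_def ip_def sum_nonneg power2_eq_square)

lemma L2_set_sum_le: "L2_set (\<lambda>a. \<Sum>i\<in>I. x i a) J \<le> (\<Sum>i\<in>I. L2_set (x i) J)"
proof (induction I rule: infinite_finite_induct)
  case (insert i I)
  then show ?case using L2_set_triangle_ineq[of "x i" "\<lambda>a. \<Sum>i\<in>I. x i a" J] by simp
qed (simp_all add: L2_set_def)

lemma L2_set_scale: "L2_set (\<lambda>a. c * x a) J = \<bar>c\<bar> * L2_set x J"
  by (simp add: L2_set_def power_mult_distrib sum_distrib_left[symmetric] real_sqrt_mult)

lemma abs_ip_le_residual_norm:
  assumes "finite J" "\<And>v. v \<in> set vs \<Longrightarrow> ip J v w = 0"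
  shows "\<bar>ip J x w\<bar> \<le> L2_set (residual J vs x) J * L2_set w J"
proof (rule power2_le_imp_le)
  show "\<bar>ip J x w\<bar>\<^sup>2 \<le> (L2_set (residual J vs x) J * L2_set w J)\<^sup>2"
    unfolding power_mult_distrib L2_set_sq using residual_norm_ge[OF assms] by simp
qed simp

text \<open>Row \<open>i\<close> of the block Krylov matrix \<open>[H, D H, \<dots>, D\<^bsup>t-1\<^esup> H]\<close> with \<open>D = diag \<mu>\<close> and \<open>H = \<omega>\<close>; a
  vector on the index set \<open>krylov_index t b\<close> is a polynomial of degree less than \<open>t\<close> with
  coefficients in \<open>\<real>\<^bsup>b\<^esup>\<close>.\<close>

definition krylov_index :: "nat \<Rightarrow> nat \<Rightarrow> (nat \<times> nat) set" where
  "krylov_index t b = {..<t} \<times> {..<b}"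

definition krylov_row :: "(nat \<Rightarrow> real) \<Rightarrow> (nat \<times> nat \<Rightarrow> real) \<Rightarrow> nat \<Rightarrow> nat \<times> nat \<Rightarrow> real" where
  "krylov_row \<mu> \<omega> i = (\<lambda>(s, c). \<mu> i ^ s * \<omega> (i, c))"

definition krylov_residual ::
  "(nat \<Rightarrow> real) \<Rightarrow> nat \<Rightarrow> nat \<Rightarrow> nat list \<Rightarrow> nat \<Rightarrow> (nat \<times> nat \<Rightarrow> real) \<Rightarrow> nat \<times> nat \<Rightarrow> real" where
  "krylov_residual \<mu> t b L i \<omega> =
     residual (krylov_index t b) (map (krylov_row \<mu> \<omega>) (remove1 i L)) (krylov_row \<mu> \<omega> i)"

definition krylov_dist ::
  "(nat \<Rightarrow> real) \<Rightarrow> nat \<Rightarrow> nat \<Rightarrow> nat list \<Rightarrow> nat \<Rightarrow> (nat \<times> nat \<Rightarrow> real) \<Rightarrow> real" where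
  "krylov_dist \<mu> t b L i \<omega> = L2_set (krylov_residual \<mu> t b L i \<omega>) (krylov_index t b)"

text \<open>The summand 1 makes the weight dominate the absolute entries of the row as well as its
  own square root.\<close>

definition row_weight :: "nat \<Rightarrow> nat \<Rightarrow> (nat \<times> nat \<Rightarrow> real) \<Rightarrow> real" where
  "row_weight b i \<omega> = 1 + (\<Sum>c<b. (\<omega> (i, c))\<^sup>2)"

lemma finite_krylov_index [simp]: "finite (krylov_index t b)"
  by (simp add: krylov_index_def)

lemma krylov_dist_nonneg [simp]: "0 \<le> krylov_dist \<mu> t b L i \<omega>"
  by (simp add: krylov_dist_def)

lemma row_weight_ge_1: "1 \<le> row_weight b i \<omega>"
  by (simp add: row_weight_def sum_nonneg)

lemma sum_abs_row_le: "(\<Sum>c<b. \<bar>\<omega> (i, c)\<bar>) \<le> real b * row_weight b i \<omega>"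
proof -
  have "\<bar>\<omega> (i, c)\<bar> \<le> row_weight b i \<omega>" if "c < b" for c
  proof -
    have "(\<omega> (i, c))\<^sup>2 \<le> (\<Sum>c<b. (\<omega> (i, c))\<^sup>2)" using that by (intro member_le_sum) auto
    moreover have "\<bar>\<omega> (i, c)\<bar> \<le> 1 + (\<omega> (i, c))\<^sup>2"
      using zero_le_power2[of "\<bar>\<omega> (i, c)\<bar> - 1"] by (simp add: power2_diff)
    ultimately show ?thesis by (simp add: row_weight_def)
  qed
  then have "(\<Sum>c<b. \<bar>\<omega> (i, c)\<bar>) \<le> (\<Sum>c<b. row_weight b i \<omega>)" by (intro sum_mono) auto
  then show ?thesis by simp
qed

text \<open>The system biorthogonal to the Krylov rows, that is, the columns of the inverse when the
  rows form a square invertible matrix. Its norms are the reciprocal distances.\<close>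

definition krylov_dual ::
  "(nat \<Rightarrow> real) \<Rightarrow> nat \<Rightarrow> nat \<Rightarrow> nat list \<Rightarrow> nat \<Rightarrow> (nat \<times> nat \<Rightarrow> real) \<Rightarrow> nat \<times> nat \<Rightarrow> real" where
  "krylov_dual \<mu> t b L i \<omega> = (\<lambda>a. 1 / (krylov_dist \<mu> t b L i \<omega>)\<^sup>2 * krylov_residual \<mu> t b L i \<omega> a)"

lemma ip_krylov_dual:
  assumes L: "distinct L" "i \<in> set L" "j \<in> set L" and pos: "0 < krylov_dist \<mu> t b L i \<omega>"
  shows "ip (krylov_index t b) (krylov_row \<mu> \<omega> j) (krylov_dual \<mu> t b L i \<omega>) = (if i = j then 1 else 0)"
proof -
  let ?J = "krylov_index t b" and ?r = "krylov_residual \<mu> t b L i \<omega>"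
  have "ip ?J (krylov_row \<mu> \<omega> i) ?r = ip ?J ?r ?r"
    unfolding krylov_residual_def by (rule residual_selfadjoint[symmetric]) simp
  moreover have "ip ?J ?r ?r = (krylov_dist \<mu> t b L i \<omega>)\<^sup>2" by (simp add: krylov_dist_def L2_set_sq)
  moreover have "ip ?J (krylov_row \<mu> \<omega> j) ?r = 0" if "i \<noteq> j"
    unfolding krylov_residual_def by (rule residual_orthogonal) (use L that in auto)
  ultimately show ?thesis using pos unfolding krylov_dual_def ip_scale_right by auto
qed

lemma L2_set_krylov_dual:
  assumes "0 < krylov_dist \<mu> t b L i \<omega>"
  shows "L2_set (krylov_dual \<mu> t b L i \<omega>) (krylov_index t b) = 1 / krylov_dist \<mu> t b L i \<omega>"
  unfolding krylov_dual_def L2_set_scale using assms by (simp add: krylov_dist_def[symmetric] power2_eq_square)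

text \<open>The coefficient vector of \<open>c + (x - \<nu>) u(x)\<close>.\<close>

definition krylov_lift :: "nat \<Rightarrow> real \<Rightarrow> (nat \<Rightarrow> real) \<Rightarrow> (nat \<times> nat \<Rightarrow> real) \<Rightarrow> nat \<times> nat \<Rightarrow> real" where
  "krylov_lift t \<nu> c u = (\<lambda>(s, e). (if s = 0 then c e else u (s - 1, e)) + (if s < t then - \<nu> * u (s, e) else 0))"

lemma ip_krylov_index:
  "ip (krylov_index t b) x y = (\<Sum>s<t. \<Sum>c<b. x (s, c) * y (s, c))"
  by (simp add: ip_def krylov_index_def sum.cartesian_product)

text \<open>Pairing with row \<open>j\<close> evaluates the vector polynomial at
  \<open>\<mu> j\<close> and takes the inner product with row \<open>j\<close> of the starting
  block. At \<open>\<mu> j = \<nu>\<close> only \<open>c\<close> survives.\<close>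

lemma ip_krylov_lift:
  "ip (krylov_index (Suc t) b) (krylov_row \<mu> \<omega> j) (krylov_lift t \<nu> c u)
    = (\<Sum>e<b. \<omega> (j, e) * c e) + (\<mu> j - \<nu>) * ip (krylov_index t b) (krylov_row \<mu> \<omega> j) u"
proof -
  let ?h = "\<lambda>e. \<omega> (j, e)"
  have "ip (krylov_index (Suc t) b) (krylov_row \<mu> \<omega> j) (krylov_lift t \<nu> c u)
    = (\<Sum>s<Suc t. \<Sum>e<b. \<mu> j ^ s * ?h e * (if s = 0 then c e else u (s - 1, e)))
      + (\<Sum>s<Suc t. \<Sum>e<b. \<mu> j ^ s * ?h e * (if s < t then - \<nu> * u (s, e) else 0))"
    unfolding ip_krylov_index by (simp add: krylov_row_def krylov_lift_def distrib_left sum.distrib del: sum.lessThan_Suc)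
  also have "(\<Sum>s<Suc t. \<Sum>e<b. \<mu> j ^ s * ?h e * (if s < t then - \<nu> * u (s, e) else 0))
    = - \<nu> * ip (krylov_index t b) (krylov_row \<mu> \<omega> j) u"
    by (simp add: ip_krylov_index krylov_row_def sum_distrib_left sum_negf mult_ac)
  also have "(\<Sum>s<Suc t. \<Sum>e<b. \<mu> j ^ s * ?h e * (if s = 0 then c e else u (s - 1, e)))
    = (\<Sum>e<b. ?h e * c e) + \<mu> j * ip (krylov_index t b) (krylov_row \<mu> \<omega> j) u"
    by (subst sum.lessThan_Suc_shift) (simp add: ip_krylov_index krylov_row_def sum_distrib_left mult_ac)
  finally show ?thesis by (simp add: algebra_simps)
qed

text \<open>The coefficients are those of \<open>c\<close>, those of \<open>u\<close> shifted by one
  degree, and those of \<open>u\<close> times \<open>- \<nu>\<close>; the last two have norm at most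
  that of \<open>u\<close>.\<close>

lemma L2_set_krylov_lift_le:
  assumes "0 \<le> \<nu>" "\<nu> \<le> 1"
  shows "L2_set (krylov_lift t \<nu> c u) (krylov_index (Suc t) b) \<le> (\<Sum>e<b. \<bar>c e\<bar>) + 2 * L2_set u (krylov_index t b)"
proof -
  let ?J = "krylov_index (Suc t) b"
  let ?x = "\<lambda>(s, e). if s = 0 then c e else 0 :: real"
  let ?y = "\<lambda>(s, e). if s = 0 then 0 else u (s - 1, e)"
  let ?z = "\<lambda>(s, e). if s < t then u (s, e) else 0"
  have sq: "L2_set w ?J = sqrt (\<Sum>s<Suc t. \<Sum>e<b. (w (s, e))\<^sup>2)" for w :: "nat \<times> nat \<Rightarrow> real"
    by (simp add: L2_set_def krylov_index_def sum.cartesian_product)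
  have u: "L2_set u (krylov_index t b) = sqrt (\<Sum>s<t. \<Sum>e<b. (u (s, e))\<^sup>2)"
    by (simp add: L2_set_def krylov_index_def sum.cartesian_product)
  have x: "L2_set ?x ?J \<le> (\<Sum>e<b. \<bar>c e\<bar>)"
  proof -
    have "L2_set ?x ?J = L2_set c {..<b}"
      unfolding sq by (subst sum.lessThan_Suc_shift) (simp add: L2_set_def)
    then show ?thesis using L2_set_le_sum_abs[of c "{..<b}"] by simp
  qed
  have y: "L2_set ?y ?J = L2_set u (krylov_index t b)"
    unfolding sq u by (subst sum.lessThan_Suc_shift) simp
  have z: "L2_set ?z ?J = L2_set u (krylov_index t b)" unfolding sq u by simp
  have "krylov_lift t \<nu> c u = (\<lambda>a. (?x a + ?y a) + (- \<nu>) * ?z a)"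
    by (auto simp: krylov_lift_def fun_eq_iff)
  then have "L2_set (krylov_lift t \<nu> c u) ?J \<le> L2_set ?x ?J + L2_set ?y ?J + L2_set (\<lambda>a. (- \<nu>) * ?z a) ?J"
    using L2_set_triangle_ineq[of "\<lambda>a. ?x a + ?y a" "\<lambda>a. (- \<nu>) * ?z a" ?J] L2_set_triangle_ineq[of ?x ?y ?J] by simp
  also have "L2_set (\<lambda>a. (- \<nu>) * ?z a) ?J = \<nu> * L2_set u (krylov_index t b)"
    unfolding L2_set_scale z using assms by simp
  also have "\<dots> \<le> L2_set u (krylov_index t b)" using assms by (intro mult_left_le_one_le) auto
  finally show ?thesis using x y by simp
qed

text \<open>Interpolation on the nodes \<open>L'\<close> with one block
  less extends every \<open>c\<close> to a polynomial vanishing on \<open>L'\<close> with value \<open>c\<close> at node \<open>i\<close>. Fewer than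
  \<open>b\<close> nodes are left over, so \<open>c\<close> can be chosen such that it vanishes there as well. The
  choice does not depend on row \<open>i\<close>.\<close>

lemma krylov_dist_step:
  assumes L: "distinct L" "length L \<le> b * Suc t" "i \<in> set L" and b: "0 < b"
    and \<mu>: "\<And>j. j \<in> set L \<Longrightarrow> 0 \<le> \<mu> j" "\<And>j. j \<in> set L \<Longrightarrow> \<mu> j \<le> 1"
    and sep: "\<And>j j'. j \<in> set L \<Longrightarrow> j' \<in> set L \<Longrightarrow> j \<noteq> j' \<Longrightarrow> 1 \<le> K * \<bar>\<mu> j - \<mu> j'\<bar>"
    and K: "0 \<le> K"
    and L': "L' = take (b * t) (remove1 i L)"
    and pos: "\<And>j. j \<in> set L' \<Longrightarrow> 0 < krylov_dist \<mu> t b L' j \<omega>"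
  shows "\<exists>c e0. e0 < b \<and> \<bar>c e0\<bar> = 1 \<and>
    (\<forall>\<omega>'. (\<forall>j e. j \<noteq> i \<longrightarrow> e < b \<longrightarrow> \<omega>' (j, e) = \<omega> (j, e)) \<longrightarrow>
       \<bar>\<Sum>e<b. c e * \<omega>' (i, e)\<bar> \<le> krylov_dist \<mu> (Suc t) b L i \<omega>' *
         (real b * (1 + 2 * K * (\<Sum>j\<in>set L'. row_weight b j \<omega> / krylov_dist \<mu> t b L' j \<omega>))))"
proof -
  let ?J = "krylov_index t b"
  let ?R = "drop (b * t) (remove1 i L)"
  have dist: "distinct L'" using L(1) by (simp add: L')
  have sub: "set L' \<subseteq> set L - {i}" using L(1) set_take_subset[of "b * t" "remove1 i L"] by (auto simp: L')
  have union: "set (remove1 i L) = set L' \<union> set ?R"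
    unfolding L' by (metis append_take_drop_id set_append)
  \<comment> \<open>Without \<open>i\<close> at most \<open>b * Suc t - 1\<close> nodes remain, and
    \<open>b * t\<close> of them are interpolated; the other nodes impose fewer than
    \<open>b\<close> linear conditions on \<open>c\<close>.\<close>
  have "length ?R < b" using L b by (auto simp: length_remove1)
  then have cardR: "card (set ?R) < card {..<b}" using card_length[of ?R] by simp
  \<comment> \<open>The prescribed value of the pairing with \<open>u\<close> at node
    \<open>j\<close>, solving \<open><c, h_j> + (\<mu> j - \<mu> i) * value = 0\<close> for each
    coordinate of \<open>c\<close>.\<close>
  define \<kappa> where "\<kappa> e j = - \<omega> (j, e) / (\<mu> j - \<mu> i)" for e j
  define d where "d = (\<lambda>j. krylov_dual \<mu> t b L' j \<omega>)"
  define u where "u c = (\<lambda>a. \<Sum>j\<in>set L'. (\<Sum>e<b. c e * \<kappa> e j) * d j a)" for c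
  have ipu: "ip ?J (krylov_row \<mu> \<omega> j) (u c) = (\<Sum>j'\<in>set L'. (\<Sum>e<b. c e * \<kappa> e j') * ip ?J (krylov_row \<mu> \<omega> j) (d j'))" for j c
    unfolding u_def by (simp only: ip_sum_right ip_scale_right)
  define M where "M j e = \<omega> (j, e) + (\<mu> j - \<mu> i) * (\<Sum>j'\<in>set L'. \<kappa> e j' * ip ?J (krylov_row \<mu> \<omega> j) (d j'))" for j e
  have ipw: "ip (krylov_index (Suc t) b) (krylov_row \<mu> \<omega> j) (krylov_lift t (\<mu> i) c (u c)) = (\<Sum>e<b. M j e * c e)" for j c
  proof -
    have "(\<Sum>j'\<in>set L'. (\<Sum>e<b. c e * \<kappa> e j') * ip ?J (krylov_row \<mu> \<omega> j) (d j'))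
      = (\<Sum>e<b. c e * (\<Sum>j'\<in>set L'. \<kappa> e j' * ip ?J (krylov_row \<mu> \<omega> j) (d j')))"
      unfolding sum_distrib_right sum_distrib_left by (subst sum.swap) (simp add: mult.assoc)
    moreover have "(\<Sum>e<b. (h e + k * S e) * c e) = (\<Sum>e<b. h e * c e) + k * (\<Sum>e<b. c e * S e)" for h S k
      by (simp add: algebra_simps sum.distrib sum_distrib_left)
    ultimately show ?thesis unfolding ip_krylov_lift ipu M_def by simp
  qed
  obtain c0 where c0: "\<forall>j\<in>set ?R. (\<Sum>e<b. M j e * c0 e) = 0" "\<exists>e<b. c0 e \<noteq> 0"
    using underdetermined_solution[of "set ?R" "{..<b}" M] cardR by auto
  \<comment> \<open>Scaling by the largest entry gives one coefficient of absolute value exactly 1,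
    the one along which the small-ball estimate integrates, and all others at most 1.\<close>
  define mx where "mx = Max ((\<lambda>e. \<bar>c0 e\<bar>) ` {..<b})"
  have mx_in: "mx \<in> (\<lambda>e. \<bar>c0 e\<bar>) ` {..<b}" unfolding mx_def using b by (intro Max_in) auto
  have mx_ge: "\<bar>c0 e\<bar> \<le> mx" if "e < b" for e unfolding mx_def using that by (intro Max_ge) auto
  have mx_pos: "0 < mx"
  proof -
    obtain e where "e < b" "c0 e \<noteq> 0" using c0(2) by blast
    then show ?thesis using mx_ge[of e] by linarith
  qed
  define c where "c e = c0 e / mx" for e
  obtain e0 where e0: "e0 < b" "\<bar>c0 e0\<bar> = mx" using mx_in by auto
  have c1: "\<bar>c e0\<bar> = 1" using e0 mx_pos by (simp add: c_def)
  have cle: "\<bar>c e\<bar> \<le> 1" if "e < b" for e using mx_ge[OF that] mx_pos by (simp add: c_def)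
  have cR: "(\<Sum>e<b. M j e * c e) = 0" if "j \<in> set ?R" for j
  proof -
    have "(\<Sum>e<b. M j e * c e) = (\<Sum>e<b. M j e * c0 e) / mx" by (simp add: c_def sum_divide_distrib)
    then show ?thesis using c0(1) that by simp
  qed
  have cL: "(\<Sum>e<b. M j e * c e) = 0" if j: "j \<in> set L'" for j
  proof -
    have "j \<in> set L" "j \<noteq> i" using sub j by blast+
    then have "\<mu> j - \<mu> i \<noteq> 0" using sep[of j i] L(3) by auto
    moreover have "ip ?J (krylov_row \<mu> \<omega> j) (d j') = (if j' = j then 1 else 0)" if "j' \<in> set L'" for j'
      unfolding d_def by (rule ip_krylov_dual[OF dist that j pos[OF that]])
    then have "(\<Sum>j'\<in>set L'. \<kappa> e j' * ip ?J (krylov_row \<mu> \<omega> j) (d j')) = (\<Sum>j'\<in>set L'. if j' = j then \<kappa> e j' else 0)" for e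
      by (intro sum.cong) auto
    ultimately have "M j e = 0" for e using j by (simp add: M_def \<kappa>_def)
    then show ?thesis by simp
  qed
  let ?w = "krylov_lift t (\<mu> i) c (u c)"
  let ?B = "real b * (1 + 2 * K * (\<Sum>j\<in>set L'. row_weight b j \<omega> / krylov_dist \<mu> t b L' j \<omega>))"
  have wB: "L2_set ?w (krylov_index (Suc t) b) \<le> ?B"
  proof -
    have coef: "\<bar>\<Sum>e<b. c e * \<kappa> e j\<bar> \<le> K * (real b * row_weight b j \<omega>)" if j: "j \<in> set L'" for j
    proof -
      have "j \<in> set L" "j \<noteq> i" using sub j by blast+
      then have "1 \<le> K * \<bar>\<mu> j - \<mu> i\<bar>" using sep[of j i] L(3) by auto
      then have "0 < \<bar>\<mu> j - \<mu> i\<bar>" by (cases "\<mu> j = \<mu> i") auto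
      then have inv: "1 / \<bar>\<mu> j - \<mu> i\<bar> \<le> K" using \<open>1 \<le> K * \<bar>\<mu> j - \<mu> i\<bar>\<close> by (simp add: pos_divide_le_eq)
      have "\<bar>\<Sum>e<b. c e * \<kappa> e j\<bar> \<le> (\<Sum>e<b. \<bar>c e * \<kappa> e j\<bar>)" by (rule sum_abs)
      also have "\<dots> \<le> (\<Sum>e<b. K * \<bar>\<omega> (j, e)\<bar>)"
      proof (rule sum_mono)
        fix e assume e: "e \<in> {..<b}"
        have "\<bar>c e * \<kappa> e j\<bar> = \<bar>c e\<bar> * (1 / \<bar>\<mu> j - \<mu> i\<bar> * \<bar>\<omega> (j, e)\<bar>)" by (simp add: \<kappa>_def abs_mult)
        also have "\<dots> \<le> 1 * (K * \<bar>\<omega> (j, e)\<bar>)" using cle e inv K by (intro mult_mono mult_right_mono) auto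
        finally show "\<bar>c e * \<kappa> e j\<bar> \<le> K * \<bar>\<omega> (j, e)\<bar>" by simp
      qed
      also have "\<dots> \<le> K * (real b * row_weight b j \<omega>)"
        unfolding sum_distrib_left[symmetric] using K by (intro mult_left_mono sum_abs_row_le)
      finally show ?thesis .
    qed
    have "L2_set (u c) ?J \<le> (\<Sum>j\<in>set L'. L2_set (\<lambda>a. (\<Sum>e<b. c e * \<kappa> e j) * d j a) ?J)"
      unfolding u_def by (rule L2_set_sum_le)
    also have "\<dots> \<le> (\<Sum>j\<in>set L'. K * (real b * row_weight b j \<omega>) * (1 / krylov_dist \<mu> t b L' j \<omega>))"
      unfolding L2_set_scale using coef pos
      by (intro sum_mono mult_mono) (auto simp: d_def L2_set_krylov_dual less_imp_le intro: order_trans[OF abs_ge_zero coef])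
    also have "\<dots> = real b * (K * (\<Sum>j\<in>set L'. row_weight b j \<omega> / krylov_dist \<mu> t b L' j \<omega>))"
      by (simp add: sum_distrib_left mult_ac)
    finally have ub: "L2_set (u c) ?J \<le> real b * (K * (\<Sum>j\<in>set L'. row_weight b j \<omega> / krylov_dist \<mu> t b L' j \<omega>))" .
    have "(\<Sum>e<b. \<bar>c e\<bar>) \<le> (\<Sum>e<b. 1)" using cle by (intro sum_mono) auto
    then have "(\<Sum>e<b. \<bar>c e\<bar>) \<le> real b" by simp
    then show ?thesis
      using L2_set_krylov_lift_le[of "\<mu> i" t c "u c" b] \<mu> L(3) ub by (simp add: algebra_simps)
  qed
  show ?thesis
  proof (intro exI[of _ c] exI[of _ e0] conjI allI impI)
    fix \<omega>' assume eq: "\<forall>j e. j \<noteq> i \<longrightarrow> e < b \<longrightarrow> \<omega>' (j, e) = \<omega> (j, e)"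
    \<comment> \<open>The polynomial is built from rows other than \<open>i\<close>, so it still
      annihilates them when row \<open>i\<close> is resampled.\<close>
    have row: "ip (krylov_index (Suc t) b) (krylov_row \<mu> \<omega>' j) ?w = ip (krylov_index (Suc t) b) (krylov_row \<mu> \<omega> j) ?w"
      if "j \<noteq> i" for j
      using eq that by (intro ip_cong) (auto simp: krylov_row_def krylov_index_def)
    have "ip (krylov_index (Suc t) b) v ?w = 0" if v: "v \<in> set (map (krylov_row \<mu> \<omega>') (remove1 i L))" for v
    proof -
      obtain j where j: "j \<in> set (remove1 i L)" "v = krylov_row \<mu> \<omega>' j" using v by auto
      then have "j \<noteq> i" using L(1) by auto
      then show ?thesis using j union row ipw cR cL by auto
    qed
    then have "\<bar>ip (krylov_index (Suc t) b) (krylov_row \<mu> \<omega>' i) ?w\<bar>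
      \<le> krylov_dist \<mu> (Suc t) b L i \<omega>' * L2_set ?w (krylov_index (Suc t) b)"
      unfolding krylov_dist_def krylov_residual_def by (intro abs_ip_le_residual_norm) auto
    also have "\<dots> \<le> krylov_dist \<mu> (Suc t) b L i \<omega>' * ?B" by (intro mult_left_mono wB) simp
    also have "ip (krylov_index (Suc t) b) (krylov_row \<mu> \<omega>' i) ?w = (\<Sum>e<b. c e * \<omega>' (i, e))"
      unfolding ip_krylov_lift by (simp add: mult.commute)
    finally show "\<bar>\<Sum>e<b. c e * \<omega>' (i, e)\<bar> \<le> krylov_dist \<mu> (Suc t) b L i \<omega>' * ?B" .
  qed (use e0 c1 in auto)
qed

section \<open>Gaussian small-ball estimates\<close>

lemma nn_integral_inverse_sqrt: "(\<integral>\<^sup>+x. indicator {-1..1} x / ennreal (sqrt \<bar>x\<bar>) \<partial>lborel) \<le> 4"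
proof -
  let ?g = "\<lambda>x::real. x powr (- 1 / 2) * indicator {0..1} x"
  have "((\<lambda>x::real. x powr (- 1 / 2)) has_integral (1 powr (- 1 / 2 + 1) / (- 1 / 2 + 1))) {0..1}"
    by (rule has_integral_powr_from_0) auto
  then have "((\<lambda>x. if x \<in> {0..1} then x powr (- 1 / 2) else 0) has_integral (2::real)) UNIV"
    unfolding has_integral_restrict_UNIV by simp
  moreover have "(\<lambda>x. if x \<in> {0..1} then x powr (- 1 / 2) else 0) = ?g" by (auto simp: fun_eq_iff)
  ultimately have "(?g has_integral 2) UNIV" by simp
  then have g: "(\<integral>\<^sup>+x. ennreal (?g x) \<partial>lborel) = 2"
    by (subst nn_integral_has_integral_lborel[of _ 2]) (auto simp: indicator_def)
  have g': "(\<integral>\<^sup>+x. ennreal (?g (- x)) \<partial>lborel) = 2"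
    using g nn_integral_real_affine[of "\<lambda>x. ennreal (?g x)" "-1" 0] by simp
  have "(\<integral>\<^sup>+x. indicator {-1..1} x / ennreal (sqrt \<bar>x\<bar>) \<partial>lborel)
    \<le> (\<integral>\<^sup>+x. ennreal (?g x) + ennreal (?g (- x)) \<partial>lborel)"
  proof (rule nn_integral_mono_AE)
    have "AE x in lborel. x \<noteq> (0::real)" by (rule AE_lborel_singleton)
    then show "AE x in lborel. indicator {-1..1} x / ennreal (sqrt \<bar>x\<bar>) \<le> ennreal (?g x) + ennreal (?g (- x))"
    proof eventually_elim
      case (elim x)
      have "1 / ennreal (sqrt \<bar>x\<bar>) = ennreal (\<bar>x\<bar> powr (- 1 / 2))"
        using elim by (simp add: powr_minus powr_half_sqrt divide_ennreal[of 1 "sqrt \<bar>x\<bar>", simplified] inverse_eq_divide)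
      then show ?case using elim by (cases "0 < x") (auto simp: indicator_def)
    qed
  qed
  also have "\<dots> = (\<integral>\<^sup>+x. ennreal (?g x) \<partial>lborel) + (\<integral>\<^sup>+x. ennreal (?g (- x)) \<partial>lborel)"
    by (rule nn_integral_add) auto
  also have "\<dots> = 4" unfolding g g' by simp
  finally show ?thesis .
qed

lemma nn_integral_std_normal_sq: "(\<integral>\<^sup>+x. ennreal (x\<^sup>2) \<partial>std_normal_distribution) = 1"
proof -
  have "has_bochner_integral lborel (\<lambda>x. std_normal_density x * x\<^sup>2) 1"
    using std_normal_moment_even[of 1] by simp
  then have "(\<integral>\<^sup>+x. ennreal (std_normal_density x * x\<^sup>2) \<partial>lborel) = ennreal 1"
    using nn_integral_eq_integral[of lborel "\<lambda>x. std_normal_density x * x\<^sup>2"] by (simp add: has_bochner_integral_iff)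
  then show ?thesis by (simp add: nn_integral_density ennreal_mult)
qed

lemma std_normal_density_weight_le: "std_normal_density x * (1 + x\<^sup>2) \<le> 2"
proof -
  have "1 + x\<^sup>2 / 2 \<le> exp (x\<^sup>2 / 2)" by (rule exp_ge_add_one_self)
  then have "1 + x\<^sup>2 \<le> 2 * exp (x\<^sup>2 / 2)" by linarith
  then have "exp (- x\<^sup>2 / 2) * (1 + x\<^sup>2) \<le> exp (- x\<^sup>2 / 2) * (2 * exp (x\<^sup>2 / 2))" by (intro mult_left_mono) auto
  also have "\<dots> = 2" by (simp add: exp_minus)
  finally have "exp (- x\<^sup>2 / 2) * (1 + x\<^sup>2) \<le> 2" .
  moreover have "1 / sqrt (2 * pi) \<le> 1"
    using pi_gt_zero pi_ge_two by (simp add: divide_le_eq_1)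
  ultimately have "1 / sqrt (2 * pi) * (exp (- x\<^sup>2 / 2) * (1 + x\<^sup>2)) \<le> 1 * 2"
    by (intro mult_mono) auto
  then show ?thesis by (simp add: std_normal_density_def)
qed

text \<open>Where the affine form is at most 1 in absolute value, density times weight is at most 2
  and the singularity integrates to at most 4. Elsewhere the quotient is at most the weight, whose
  mean is 2. Together \<open>2 * 4 + 2 = 10\<close>.\<close>

lemma nn_integral_std_normal_small_ball:
  assumes \<alpha>: "\<bar>\<alpha>\<bar> = 1"
  shows "(\<integral>\<^sup>+x. ennreal (1 + x\<^sup>2) / ennreal (sqrt \<bar>\<alpha> * x + r\<bar>) \<partial>std_normal_distribution) \<le> 10"
proof -
  let ?i = "\<lambda>y::real. indicator {-1..1} y / ennreal (sqrt \<bar>y\<bar>)"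
  have "(\<integral>\<^sup>+x. ennreal (1 + x\<^sup>2) / ennreal (sqrt \<bar>\<alpha> * x + r\<bar>) \<partial>std_normal_distribution)
    \<le> (\<integral>\<^sup>+x. ennreal (std_normal_density x * (1 + x\<^sup>2)) + 2 * ?i (r + \<alpha> * x) \<partial>lborel)"
  proof (subst nn_integral_density)
    show "(\<integral>\<^sup>+x. ennreal (std_normal_density x) * (ennreal (1 + x\<^sup>2) / ennreal (sqrt \<bar>\<alpha> * x + r\<bar>)) \<partial>lborel)
      \<le> (\<integral>\<^sup>+x. ennreal (std_normal_density x * (1 + x\<^sup>2)) + 2 * ?i (r + \<alpha> * x) \<partial>lborel)"
    proof (rule nn_integral_mono)
      fix x :: real
      let ?w = "std_normal_density x * (1 + x\<^sup>2)" and ?y = "\<alpha> * x + r"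
      have "ennreal (std_normal_density x) * (ennreal (1 + x\<^sup>2) / ennreal (sqrt \<bar>?y\<bar>)) = ennreal ?w * (1 / ennreal (sqrt \<bar>?y\<bar>))"
        by (simp add: ennreal_mult ennreal_times_divide)
      also have "\<dots> \<le> ennreal ?w + 2 * ?i ?y"
      proof (cases "\<bar>?y\<bar> \<le> 1")
        case True
        then have eq: "1 / ennreal (sqrt \<bar>?y\<bar>) = ?i ?y" by (simp add: indicator_def abs_le_iff)
        have "ennreal ?w \<le> ennreal 2" by (intro ennreal_leI std_normal_density_weight_le)
        then have "ennreal ?w * ?i ?y \<le> 2 * ?i ?y" by (intro mult_right_mono) auto
        then show ?thesis unfolding eq by (intro add_increasing) auto
      next
        case False
        have "1 / ennreal (sqrt \<bar>?y\<bar>) \<le> 1"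
          using False by (subst ennreal_1[symmetric], subst divide_ennreal) (auto simp: ennreal_le_1)
        then have "ennreal ?w * (1 / ennreal (sqrt \<bar>?y\<bar>)) \<le> ennreal ?w * 1" by (intro mult_left_mono) auto
        then show ?thesis by (simp add: add_increasing2)
      qed
      finally show "ennreal (std_normal_density x) * (ennreal (1 + x\<^sup>2) / ennreal (sqrt \<bar>?y\<bar>)) \<le> ennreal ?w + 2 * ?i (r + \<alpha> * x)"
        by (simp add: add.commute)
    qed
  qed auto
  also have "\<dots> = (\<integral>\<^sup>+x. ennreal (std_normal_density x * (1 + x\<^sup>2)) \<partial>lborel) + 2 * (\<integral>\<^sup>+x. ?i (r + \<alpha> * x) \<partial>lborel)"
    by (subst nn_integral_add) (auto simp: nn_integral_cmult)
  also have "(\<integral>\<^sup>+x. ?i (r + \<alpha> * x) \<partial>lborel) = (\<integral>\<^sup>+x. ?i x \<partial>lborel)"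
    using \<alpha> by (subst nn_integral_real_affine[of ?i \<alpha> r]) auto
  also have "(\<integral>\<^sup>+x. ennreal (std_normal_density x * (1 + x\<^sup>2)) \<partial>lborel) = (\<integral>\<^sup>+x. 1 + ennreal (x\<^sup>2) \<partial>std_normal_distribution)"
    by (simp add: nn_integral_density ennreal_mult ennreal_plus)
  also have "\<dots> = 2"
    using std_normal.emeasure_space_1 by (subst nn_integral_add) (auto simp: nn_integral_std_normal_sq)
  also have "2 + 2 * (\<integral>\<^sup>+x. ?i x \<partial>lborel) \<le> 2 + 2 * 4"
    by (intro add_left_mono mult_left_mono nn_integral_inverse_sqrt) auto
  finally show ?thesis by simp
qed

section \<open>Moments of standard Gaussian vectors\<close>

lemma prob_space_gauss: "prob_space (gauss J)"
  by (rule prob_space_PiM) (rule std_normal.prob_space_axioms)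

lemma nn_integral_gauss_component:
  assumes "finite J" "a \<in> J" and [measurable]: "f \<in> borel_measurable borel"
  shows "(\<integral>\<^sup>+x. f (x a) \<partial>gauss J) = (\<integral>\<^sup>+x. f x \<partial>std_normal_distribution)"
proof -
  have "distr (gauss J) std_normal_distribution (\<lambda>x. x a) = std_normal_distribution"
    using assms(2) by (rule std_normal_product.PiM_component)
  then show ?thesis
    using nn_integral_distr[of "\<lambda>x. x a" "gauss J" std_normal_distribution f] assms(2) by simp
qed

lemma nn_integral_gauss_sum_sq:
  assumes J: "finite J" "K \<subseteq> J"
  shows "(\<integral>\<^sup>+x. ennreal (\<Sum>a\<in>K. (x a)\<^sup>2) \<partial>gauss J) = ennreal (real (card K))"
proof -
  have "(\<integral>\<^sup>+x. ennreal (\<Sum>a\<in>K. (x a)\<^sup>2) \<partial>gauss J) = (\<integral>\<^sup>+x. (\<Sum>a\<in>K. ennreal ((x a)\<^sup>2)) \<partial>gauss J)"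
    by (simp add: sum_ennreal)
  also have "\<dots> = (\<Sum>a\<in>K. \<integral>\<^sup>+x. ennreal ((x a)\<^sup>2) \<partial>gauss J)"
    using J by (intro nn_integral_sum) auto
  also have "\<dots> = (\<Sum>a\<in>K. 1)"
  proof (rule sum.cong[OF refl])
    fix a assume "a \<in> K"
    then show "(\<integral>\<^sup>+x. ennreal ((x a)\<^sup>2) \<partial>gauss J) = 1"
      using nn_integral_gauss_component[of J a "\<lambda>x. ennreal (x\<^sup>2)"] J nn_integral_std_normal_sq by auto
  qed
  finally show ?thesis by (simp add: ennreal_of_nat_eq_real_of_nat)
qed

text \<open>Conditioning on all coordinates but \<open>p\<close> turns the linear form into an
  affine form in one variable. The weight splits by
  \<open>1 + y^2 + q \<le> (1 + q) * (1 + y^2)\<close>, and the mean of \<open>1 + q\<close> is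
  \<open>card J\<close>.\<close>

lemma nn_integral_gauss_small_ball:
  assumes J: "finite J" "p \<in> J" and c: "\<bar>c p\<bar> = 1"
  shows "(\<integral>\<^sup>+x. ennreal (1 + (\<Sum>a\<in>J. (x a)\<^sup>2)) / ennreal (sqrt \<bar>\<Sum>a\<in>J. c a * x a\<bar>) \<partial>gauss J) \<le> ennreal (10 * real (card J))"
proof -
  define K where "K = J - {p}"
  have K: "J = insert p K" "p \<notin> K" "finite K" using J by (auto simp: K_def)
  let ?f = "\<lambda>x. ennreal (1 + (\<Sum>a\<in>J. (x a)\<^sup>2)) / ennreal (sqrt \<bar>\<Sum>a\<in>J. c a * x a\<bar>)"
  have f: "?f \<in> borel_measurable (gauss J)" by measurable
  have "(\<integral>\<^sup>+x. ?f x \<partial>gauss J) = (\<integral>\<^sup>+x. \<integral>\<^sup>+y. ?f (x(p := y)) \<partial>std_normal_distribution \<partial>gauss K)"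
    using product_sigma_finite.product_nn_integral_insert[OF std_normal_product.product_sigma_finite_axioms K(3,2), of ?f] f
    unfolding K(1)[symmetric] by simp
  also have "\<dots> \<le> (\<integral>\<^sup>+x. ennreal (1 + (\<Sum>a\<in>K. (x a)\<^sup>2)) * 10 \<partial>gauss K)"
  proof (rule nn_integral_mono)
    fix x :: "'a \<Rightarrow> real"
    let ?r = "\<Sum>a\<in>K. c a * x a" and ?q = "\<Sum>a\<in>K. (x a)\<^sup>2"
    have q0: "0 \<le> ?q" by (intro sum_nonneg) auto
    have upd: "(\<Sum>a\<in>J. c a * (x(p := y)) a) = c p * y + ?r" "(\<Sum>a\<in>J. ((x(p := y)) a)\<^sup>2) = y\<^sup>2 + ?q" for y
      using K by (auto intro!: sum.cong)
    have "?f (x(p := y)) \<le> ennreal (1 + ?q) * (ennreal (1 + y\<^sup>2) / ennreal (sqrt \<bar>c p * y + ?r\<bar>))" for y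
    proof -
      have "1 + (y\<^sup>2 + ?q) \<le> (1 + ?q) * (1 + y\<^sup>2)" using q0 by (simp add: algebra_simps)
      then have "ennreal (1 + (y\<^sup>2 + ?q)) \<le> ennreal ((1 + ?q) * (1 + y\<^sup>2))" by (rule ennreal_leI)
      also have "\<dots> = ennreal (1 + ?q) * ennreal (1 + y\<^sup>2)" using q0 by (intro ennreal_mult) auto
      finally have "ennreal (1 + (y\<^sup>2 + ?q)) \<le> ennreal (1 + ?q) * ennreal (1 + y\<^sup>2)" .
      then show ?thesis unfolding upd ennreal_times_divide by (intro divide_right_mono_ennreal)
    qed
    then have "(\<integral>\<^sup>+y. ?f (x(p := y)) \<partial>std_normal_distribution)
      \<le> (\<integral>\<^sup>+y. ennreal (1 + ?q) * (ennreal (1 + y\<^sup>2) / ennreal (sqrt \<bar>c p * y + ?r\<bar>)) \<partial>std_normal_distribution)"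
      by (intro nn_integral_mono)
    also have "\<dots> = ennreal (1 + ?q) * (\<integral>\<^sup>+y. ennreal (1 + y\<^sup>2) / ennreal (sqrt \<bar>c p * y + ?r\<bar>) \<partial>std_normal_distribution)"
      by (rule nn_integral_cmult) measurable
    also have "\<dots> \<le> ennreal (1 + ?q) * 10" by (intro mult_left_mono nn_integral_std_normal_small_ball c) auto
    finally show "(\<integral>\<^sup>+y. ?f (x(p := y)) \<partial>std_normal_distribution) \<le> ennreal (1 + ?q) * 10" .
  qed
  also have "\<dots> = (\<integral>\<^sup>+x. (1 + ennreal (\<Sum>a\<in>K. (x a)\<^sup>2)) \<partial>gauss K) * 10"
    by (subst nn_integral_multc) (auto simp: ennreal_plus sum_nonneg)
  also have "(\<integral>\<^sup>+x. (1 + ennreal (\<Sum>a\<in>K. (x a)\<^sup>2)) \<partial>gauss K) = 1 + ennreal (real (card K))"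
    using prob_space.emeasure_space_1[OF prob_space_gauss, of K] K(3)
    by (subst nn_integral_add) (auto simp: nn_integral_gauss_sum_sq)
  also have "1 + ennreal (real (card K)) = ennreal (1 + real (card K))" by (subst ennreal_plus) auto
  also have "1 + real (card K) = real (card J)" using K by simp
  also have "ennreal (real (card J)) * 10 = ennreal (10 * real (card J))"
    using ennreal_mult[of 10 "real (card J)"] by (simp add: mult.commute)
  finally show ?thesis .
qed

section \<open>Negative moments of block Krylov distances\<close>

text \<open>The division is in \<^typ>\<open>ennreal\<close>, so the sum is infinite if some distance vanishes.\<close>

definition krylov_term :: "(nat \<Rightarrow> real) \<Rightarrow> nat \<Rightarrow> nat \<Rightarrow> nat list \<Rightarrow> nat \<Rightarrow> (nat \<times> nat \<Rightarrow> real) \<Rightarrow> ennreal" where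
  "krylov_term \<mu> t b L i \<omega> = ennreal (sqrt (row_weight b i \<omega>)) / ennreal (sqrt (krylov_dist \<mu> t b L i \<omega>))"

text \<open>By subadditivity of the root this dominates the square root of the sum of weight over
  distance that appears in \<open>krylov_dist_step\<close>, so the recursion closes on one
  quantity.\<close>

definition krylov_sum :: "(nat \<Rightarrow> real) \<Rightarrow> nat \<Rightarrow> nat \<Rightarrow> nat list \<Rightarrow> (nat \<times> nat \<Rightarrow> real) \<Rightarrow> ennreal" where
  "krylov_sum \<mu> t b L \<omega> = (\<Sum>i\<in>set L. krylov_term \<mu> t b L i \<omega>)"

lemma krylov_sum_cong:
  assumes "\<And>j e. j \<in> set L \<Longrightarrow> \<omega> (j, e) = \<omega>' (j, e)"
  shows "krylov_sum \<mu> t b L \<omega> = krylov_sum \<mu> t b L \<omega>'"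
proof -
  have row: "krylov_row \<mu> \<omega> j = krylov_row \<mu> \<omega>' j" if "j \<in> set L" for j
    using assms that by (auto simp: krylov_row_def fun_eq_iff)
  have m: "map (krylov_row \<mu> \<omega>) (remove1 i L) = map (krylov_row \<mu> \<omega>') (remove1 i L)" for i
    using row set_remove1_subset[of i L] by (intro map_cong) auto
  have w: "row_weight b j \<omega> = row_weight b j \<omega>'" if "j \<in> set L" for j
    using assms that by (simp add: row_weight_def)
  show ?thesis
    unfolding krylov_sum_def
  proof (rule sum.cong[OF refl])
    fix i assume "i \<in> set L"
    then show "krylov_term \<mu> t b L i \<omega> = krylov_term \<mu> t b L i \<omega>'"
      unfolding krylov_term_def krylov_dist_def krylov_residual_def by (simp only: m row w)
  qed
qed

lemma borel_measurable_ip: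
  assumes "finite J" "\<And>a. a \<in> J \<Longrightarrow> (\<lambda>\<omega>. x \<omega> a) \<in> borel_measurable M" "\<And>a. a \<in> J \<Longrightarrow> (\<lambda>\<omega>. y \<omega> a) \<in> borel_measurable M"
  shows "(\<lambda>\<omega>. ip J (x \<omega>) (y \<omega>)) \<in> borel_measurable M"
  unfolding ip_def using assms by (intro borel_measurable_sum borel_measurable_times) auto

lemma borel_measurable_residual:
  assumes J: "finite J" and v: "\<And>v a. v \<in> set vs \<Longrightarrow> a \<in> J \<Longrightarrow> (\<lambda>\<omega>. v \<omega> a) \<in> borel_measurable M"
    and x: "\<And>a. a \<in> J \<Longrightarrow> (\<lambda>\<omega>. x \<omega> a) \<in> borel_measurable M" and a: "a \<in> J"
  shows "(\<lambda>\<omega>. residual J (map (\<lambda>v. v \<omega>) vs) (x \<omega>) a) \<in> borel_measurable M"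
  using v x a
proof (induction vs arbitrary: x a)
  case (Cons v vs)
  have r: "(\<lambda>\<omega>. residual J (map (\<lambda>v. v \<omega>) vs) (y \<omega>) a) \<in> borel_measurable M"
    if "\<And>a. a \<in> J \<Longrightarrow> (\<lambda>\<omega>. y \<omega> a) \<in> borel_measurable M" "a \<in> J" for y a
    by (rule Cons.IH) (use Cons.prems(1) that in auto)
  show ?case
    using Cons.prems by (auto intro!: borel_measurable_diff borel_measurable_times borel_measurable_divide borel_measurable_ip J r)
qed simp

lemma borel_measurable_krylov_term:
  assumes L: "set L \<subseteq> I" and i: "i \<in> I"
  shows "krylov_term \<mu> t b L i \<in> borel_measurable (gauss (I \<times> {..<b}))"
proof -
  let ?M = "gauss (I \<times> {..<b})"
  have row: "(\<lambda>\<omega>. krylov_row \<mu> \<omega> j a) \<in> borel_measurable ?M" if "j \<in> I" "a \<in> krylov_index t b" for j a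
    using that by (cases a) (auto simp: krylov_row_def krylov_index_def intro!: borel_measurable_times)
  have "(\<lambda>\<omega>. residual (krylov_index t b) (map (\<lambda>v. v \<omega>) (map (\<lambda>j \<omega>. krylov_row \<mu> \<omega> j) (remove1 i L))) (krylov_row \<mu> \<omega> i) a) \<in> borel_measurable ?M"
    if "a \<in> krylov_index t b" for a
    using L i set_remove1_subset[of i L] that by (intro borel_measurable_residual) (auto intro!: row)
  then have "(\<lambda>\<omega>. krylov_residual \<mu> t b L i \<omega> a) \<in> borel_measurable ?M" if "a \<in> krylov_index t b" for a
    using that by (simp add: krylov_residual_def comp_def)
  then have "(\<lambda>\<omega>. krylov_dist \<mu> t b L i \<omega>) \<in> borel_measurable ?M"
    unfolding krylov_dist_def L2_set_def by (auto intro!: borel_measurable_sqrt borel_measurable_sum borel_measurable_power)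
  moreover have "(\<lambda>\<omega>. row_weight b i \<omega>) \<in> borel_measurable ?M"
    unfolding row_weight_def using i by (intro borel_measurable_add borel_measurable_sum borel_measurable_power) auto
  ultimately show ?thesis unfolding krylov_term_def[abs_def] by measurable
qed

lemma borel_measurable_krylov_sum:
  assumes "set L \<subseteq> I"
  shows "krylov_sum \<mu> t b L \<in> borel_measurable (gauss (I \<times> {..<b}))"
  unfolding krylov_sum_def[abs_def] using assms by (intro borel_measurable_sum borel_measurable_krylov_term) auto

lemma sqrt_sum_le_sum_sqrt:
  assumes "\<And>i. i \<in> I \<Longrightarrow> 0 \<le> x i"
  shows "sqrt (\<Sum>i\<in>I. x i) \<le> (\<Sum>i\<in>I. sqrt (x i))"
  using L2_set_le_sum[of I "\<lambda>i. sqrt (x i)"] assms by (simp add: L2_set_def)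

text \<open>The square root of \<open>krylov_dist_step\<close>, as an inequality between possibly
  infinite values. Vanishing of the linear form or of a distance at the lower level only makes the
  right-hand side infinite.\<close>

lemma krylov_term_step:
  assumes L: "distinct L" "length L \<le> b * Suc t" "i \<in> set L" and b: "0 < b"
    and \<mu>: "\<And>j. j \<in> set L \<Longrightarrow> 0 \<le> \<mu> j" "\<And>j. j \<in> set L \<Longrightarrow> \<mu> j \<le> 1"
    and sep: "\<And>j j'. j \<in> set L \<Longrightarrow> j' \<in> set L \<Longrightarrow> j \<noteq> j' \<Longrightarrow> 1 \<le> K * \<bar>\<mu> j - \<mu> j'\<bar>"
    and K: "1 \<le> K" and L': "L' = take (b * t) (remove1 i L)"
  shows "\<exists>c e0. e0 < b \<and> \<bar>c e0\<bar> = 1 \<and>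
    (\<forall>\<omega>'. (\<forall>j e. j \<noteq> i \<longrightarrow> e < b \<longrightarrow> \<omega>' (j, e) = \<omega> (j, e)) \<longrightarrow>
      krylov_term \<mu> (Suc t) b L i \<omega>' \<le> ennreal (real b) * (1 + ennreal (sqrt (2 * K)) * krylov_sum \<mu> t b L' \<omega>)
        * (ennreal (row_weight b i \<omega>') / ennreal (sqrt \<bar>\<Sum>e<b. c e * \<omega>' (i, e)\<bar>)))"
proof (cases "\<forall>j\<in>set L'. 0 < krylov_dist \<mu> t b L' j \<omega>")
  case True
  let ?\<rho> = "\<lambda>j. krylov_dist \<mu> t b L' j \<omega>" and ?S = "\<lambda>j. row_weight b j \<omega>"
  define Q where "Q = (\<Sum>j\<in>set L'. ?S j / ?\<rho> j)"
  define F where "F = (\<Sum>j\<in>set L'. sqrt (?S j) / sqrt (?\<rho> j))"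
  have S: "1 \<le> row_weight b j w" for j w by (rule row_weight_ge_1)
  have S0: "0 \<le> row_weight b j w" for j w using S[of j w] by linarith
  have Q0: "0 \<le> Q" and F0: "0 \<le> F" unfolding Q_def F_def using S0 by (auto intro!: sum_nonneg)
  have KF: "krylov_sum \<mu> t b L' \<omega> = ennreal F"
  proof -
    have "krylov_term \<mu> t b L' j \<omega> = ennreal (sqrt (?S j) / sqrt (?\<rho> j))" if "j \<in> set L'" for j
      unfolding krylov_term_def using True that S0 by (intro divide_ennreal) auto
    then have "krylov_sum \<mu> t b L' \<omega> = (\<Sum>j\<in>set L'. ennreal (sqrt (?S j) / sqrt (?\<rho> j)))"
      unfolding krylov_sum_def by (intro sum.cong) auto
    also have "\<dots> = ennreal F" unfolding F_def using S0 by (intro sum_ennreal) auto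
    finally show ?thesis .
  qed
  have QF: "sqrt Q \<le> F"
    unfolding Q_def F_def using S0 sqrt_sum_le_sum_sqrt[of "set L'" "\<lambda>j. ?S j / ?\<rho> j"] by (simp add: real_sqrt_divide)
  have pos: "0 < ?\<rho> j" if "j \<in> set L'" for j using True that by blast
  have "0 \<le> K" using K by simp
  from krylov_dist_step[where \<mu> = \<mu> and K = K and L' = L' and \<omega> = \<omega>, OF L b \<mu> sep this L' pos]
  obtain c e0 where c: "e0 < b" "\<bar>c e0\<bar> = 1"
    "\<And>\<omega>'. (\<forall>j e. j \<noteq> i \<longrightarrow> e < b \<longrightarrow> \<omega>' (j, e) = \<omega> (j, e)) \<Longrightarrow>
       \<bar>\<Sum>e<b. c e * \<omega>' (i, e)\<bar> \<le> krylov_dist \<mu> (Suc t) b L i \<omega>' * (real b * (1 + 2 * K * Q))"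
    unfolding Q_def[symmetric] by blast
  have bound: "sqrt (real b * (1 + 2 * K * Q)) \<le> real b * (1 + sqrt (2 * K) * F)"
  proof -
    have "sqrt (1 + 2 * K * Q) \<le> sqrt 1 + sqrt (2 * K * Q)" using K Q0 by (intro sqrt_add_le_add_sqrt) auto
    also have "\<dots> \<le> 1 + sqrt (2 * K) * F" using QF K by (simp add: real_sqrt_mult mult_left_mono)
    finally have "sqrt (1 + 2 * K * Q) \<le> 1 + sqrt (2 * K) * F" .
    moreover have "sqrt (real b) \<le> real b" using b sqrt_le_D[of 1] by (intro real_le_lsqrt) (auto simp: power2_eq_square)
    ultimately show ?thesis
      unfolding real_sqrt_mult using K Q0 by (intro mult_mono) auto
  qed
  show ?thesis
  proof (intro exI[of _ c] exI[of _ e0] conjI allI impI)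
    fix \<omega>' assume agree: "\<forall>j e. j \<noteq> i \<longrightarrow> e < b \<longrightarrow> \<omega>' (j, e) = \<omega> (j, e)"
    let ?D = "\<bar>\<Sum>e<b. c e * \<omega>' (i, e)\<bar>" and ?R = "krylov_dist \<mu> (Suc t) b L i \<omega>'" and ?W = "row_weight b i \<omega>'"
    let ?G = "real b * (1 + sqrt (2 * K) * F)"
    have G0: "0 < ?G" using b F0 K by (intro mult_pos_pos add_pos_nonneg) auto
    have rhs: "ennreal (real b) * (1 + ennreal (sqrt (2 * K)) * krylov_sum \<mu> t b L' \<omega>) = ennreal ?G"
    proof -
      have "1 + ennreal (sqrt (2 * K)) * ennreal F = ennreal (1 + sqrt (2 * K) * F)"
        using F0 K by (simp add: ennreal_mult ennreal_plus)
      then show ?thesis unfolding KF using F0 K by (simp add: ennreal_mult)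
    qed
    show "krylov_term \<mu> (Suc t) b L i \<omega>' \<le> ennreal (real b) * (1 + ennreal (sqrt (2 * K)) * krylov_sum \<mu> t b L' \<omega>)
        * (ennreal ?W / ennreal (sqrt ?D))"
    proof (cases "?D = 0")
      case True
      have "ennreal ?W / ennreal (sqrt ?D) = \<top>" using True S[of i \<omega>'] by (simp add: ennreal_divide_zero)
      moreover have "ennreal ?G \<noteq> 0" using G0 by (simp only: ennreal_eq_0_iff not_le)
      ultimately show ?thesis unfolding rhs by (metis ennreal_mult_eq_top_iff top_greatest)
    next
      case False
      then have D: "0 < ?D" by simp
      have DR: "?D \<le> ?R * (real b * (1 + 2 * K * Q))" by (rule c(3)[OF agree])
      then have R: "0 < ?R" using D krylov_dist_nonneg[of \<mu> "Suc t" b L i \<omega>']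
        by (metis less_eq_real_def mult_zero_left not_less)
      have "sqrt ?D \<le> sqrt ?R * ?G"
        using real_sqrt_le_mono[OF DR] bound R unfolding real_sqrt_mult[of ?R]
        by (meson dual_order.trans less_imp_le mult_left_mono real_sqrt_ge_zero)
      moreover have "sqrt ?W \<le> ?W" using S[of i \<omega>'] by (intro real_le_lsqrt) (auto simp: power2_eq_square)
      ultimately have "sqrt ?W * sqrt ?D \<le> ?W * (sqrt ?R * ?G)" using S0 by (intro mult_mono) auto
      then have "sqrt ?W / sqrt ?R \<le> ?G * (?W / sqrt ?D)" using R D by (simp add: field_simps)
      then have "ennreal (sqrt ?W / sqrt ?R) \<le> ennreal (?G * (?W / sqrt ?D))" by (rule ennreal_leI)
      then show ?thesis
        unfolding rhs krylov_term_def using R D S0[of i \<omega>'] G0 by (simp add: divide_ennreal ennreal_mult[symmetric])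
    qed
  qed (use c in auto)
next
  \<comment> \<open>A vanishing distance at the lower level makes \<open>krylov_sum\<close> infinite
    while the last factor is nonzero, so any normalised \<open>c\<close> will do.\<close>
  case False
  then obtain j where j: "j \<in> set L'" "krylov_dist \<mu> t b L' j \<omega> = 0"
    using krylov_dist_nonneg by (metis less_eq_real_def)
  have "krylov_term \<mu> t b L' j \<omega> = \<top>"
    unfolding krylov_term_def j(2) using row_weight_ge_1[of b j \<omega>] by (simp add: ennreal_divide_zero)
  then have "krylov_sum \<mu> t b L' \<omega> = \<top>" unfolding krylov_sum_def using j(1) by auto
  then have "ennreal (real b) * (1 + ennreal (sqrt (2 * K)) * krylov_sum \<mu> t b L' \<omega>)
        * (ennreal (row_weight b i \<omega>') / ennreal (sqrt \<bar>\<Sum>e<b. 1 * \<omega>' (i, e)\<bar>)) = \<top>" for \<omega>'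
    using b K row_weight_ge_1[of b i \<omega>'] by (auto simp: ennreal_mult_top ennreal_top_mult ennreal_mult_eq_top_iff ennreal_divide_eq_0_iff)
  then show ?thesis using b by (intro exI[of _ "\<lambda>_. 1"] exI[of _ 0]) auto
qed

text \<open>Fubini separates row \<open>i\<close> from the others. For fixed other rows the inner
  integral is a small-ball integral with a constant \<open>c\<close>, and its bound is the same for
  all admissible \<open>c\<close>; the choice of \<open>c\<close> thus raises no question of
  measurability.\<close>

lemma nn_integral_krylov_term_le:
  assumes L: "distinct L" "length L \<le> b * Suc t" "i \<in> set L" "set L \<subseteq> {..<n}" and b: "0 < b"
    and \<mu>: "\<And>j. j \<in> set L \<Longrightarrow> 0 \<le> \<mu> j" "\<And>j. j \<in> set L \<Longrightarrow> \<mu> j \<le> 1"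
    and sep: "\<And>j j'. j \<in> set L \<Longrightarrow> j' \<in> set L \<Longrightarrow> j \<noteq> j' \<Longrightarrow> 1 \<le> K * \<bar>\<mu> j - \<mu> j'\<bar>"
    and K: "1 \<le> K" and L': "L' = take (b * t) (remove1 i L)"
  shows "(\<integral>\<^sup>+\<omega>. krylov_term \<mu> (Suc t) b L i \<omega> \<partial>gauss ({..<n} \<times> {..<b}))
    \<le> ennreal (10 * (real b)\<^sup>2) * (1 + ennreal (sqrt (2 * K)) * (\<integral>\<^sup>+\<omega>. krylov_sum \<mu> t b L' \<omega> \<partial>gauss ({..<n} \<times> {..<b})))"
proof -
  define I where "I = ({..<n} - {i}) \<times> {..<b}"
  define R where "R = {i} \<times> {..<b}"
  have IR: "{..<n} \<times> {..<b} = I \<union> R" "I \<inter> R = {}" "finite I" "finite R"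
    using L by (auto simp: I_def R_def)
  note fold = product_sigma_finite.product_nn_integral_fold[OF std_normal_product.product_sigma_finite_axioms IR(2-4)]
  have sub: "set L' \<subseteq> {..<n} - {i}"
    using L set_take_subset[of "b * t" "remove1 i L"] by (auto simp: L')
  let ?F = "krylov_sum \<mu> t b L'"
  let ?k = "ennreal (sqrt (2 * K))"
  have Fm: "?F \<in> borel_measurable (gauss ({..<n} \<times> {..<b}))" "?F \<in> borel_measurable (gauss I)"
    unfolding I_def using sub by (auto intro!: borel_measurable_krylov_sum)
  have affine_measurable: "(\<lambda>x. 1 + c * f x) \<in> borel_measurable M" "(\<lambda>x. c * f x) \<in> borel_measurable M"
    if [measurable]: "f \<in> borel_measurable M" for f :: "'c \<Rightarrow> ennreal" and c M
    by measurable
  note affine_measurable = affine_measurable[OF Fm(2)]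
  have merge_I: "merge I R (x, y) (j, e) = x (j, e)" if "x \<in> space (gauss I)" "j \<noteq> i" for x y j e
    using that by (auto simp: merge_def I_def R_def space_PiM PiE_iff extensional_def)
  have merge_R: "merge I R (x, y) (i, e) = y (i, e)" if "e < b" for x y e
    using that by (auto simp: merge_def I_def R_def)
  have one: "(\<integral>\<^sup>+y. c \<partial>gauss J) = c" for c :: ennreal and J :: "(nat \<times> nat) set"
    using prob_space.emeasure_space_1[OF prob_space_gauss, of J] by simp
  have F_int: "(\<integral>\<^sup>+\<omega>. ?F \<omega> \<partial>gauss ({..<n} \<times> {..<b})) = (\<integral>\<^sup>+x. ?F x \<partial>gauss I)"
  proof -
    have "(\<integral>\<^sup>+\<omega>. ?F \<omega> \<partial>gauss (I \<union> R)) = (\<integral>\<^sup>+x. \<integral>\<^sup>+y. ?F (merge I R (x, y)) \<partial>gauss R \<partial>gauss I)"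
      using Fm(1) unfolding IR(1) by (rule fold)
    also have "\<dots> = (\<integral>\<^sup>+x. \<integral>\<^sup>+y. ?F x \<partial>gauss R \<partial>gauss I)"
    proof (intro nn_integral_cong krylov_sum_cong)
      fix x y j e assume "x \<in> space (gauss I)" "j \<in> set L'"
      moreover from this have "j \<noteq> i" using sub by blast
      ultimately show "merge I R (x, y) (j, e) = x (j, e)" by (intro merge_I)
    qed
    finally show ?thesis unfolding IR(1) one .
  qed
  have Tm: "krylov_term \<mu> (Suc t) b L i \<in> borel_measurable (gauss (I \<union> R))"
    unfolding IR(1)[symmetric] using L by (intro borel_measurable_krylov_term) auto
  have "(\<integral>\<^sup>+\<omega>. krylov_term \<mu> (Suc t) b L i \<omega> \<partial>gauss (I \<union> R))
    = (\<integral>\<^sup>+x. \<integral>\<^sup>+y. krylov_term \<mu> (Suc t) b L i (merge I R (x, y)) \<partial>gauss R \<partial>gauss I)"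
    by (rule fold[OF Tm])
  also have "\<dots> \<le> (\<integral>\<^sup>+x. ennreal (10 * (real b)\<^sup>2) * (1 + ?k * ?F x) \<partial>gauss I)"
  proof (rule nn_integral_mono)
    fix x assume x: "x \<in> space (gauss I)"
    obtain c e0 where c: "e0 < b" "\<bar>c e0\<bar> = 1"
      "\<And>\<omega>'. (\<forall>j e. j \<noteq> i \<longrightarrow> e < b \<longrightarrow> \<omega>' (j, e) = x (j, e)) \<Longrightarrow>
        krylov_term \<mu> (Suc t) b L i \<omega>' \<le> ennreal (real b) * (1 + ?k * ?F x)
        * (ennreal (row_weight b i \<omega>') / ennreal (sqrt \<bar>\<Sum>e<b. c e * \<omega>' (i, e)\<bar>))"
      using krylov_term_step[where \<mu> = \<mu> and K = K and L' = L' and \<omega> = x, OF L(1-3) b \<mu> sep K L'] by blast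
    let ?c = "\<lambda>a. c (snd a)"
    have sumR: "(\<Sum>a\<in>R. h a) = (\<Sum>e<b. h (i, e))" for h :: "nat \<times> nat \<Rightarrow> real"
      unfolding R_def by (rule sum.reindex_bij_witness[of _ "\<lambda>e. (i, e)" snd]) auto
    have le: "krylov_term \<mu> (Suc t) b L i (merge I R (x, y)) \<le> ennreal (real b) * (1 + ?k * ?F x)
        * (ennreal (1 + (\<Sum>a\<in>R. (y a)\<^sup>2)) / ennreal (sqrt \<bar>\<Sum>a\<in>R. ?c a * y a\<bar>))" for y
    proof -
      have "(\<Sum>e<b. (merge I R (x, y) (i, e))\<^sup>2) = (\<Sum>e<b. (y (i, e))\<^sup>2)"
        "(\<Sum>e<b. c e * merge I R (x, y) (i, e)) = (\<Sum>e<b. c e * y (i, e))"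
        by (intro sum.cong; simp add: merge_R)+
      then show ?thesis
        using c(3)[of "merge I R (x, y)"] merge_I[OF x] unfolding row_weight_def sumR by simp
    qed
    have "(\<integral>\<^sup>+y. krylov_term \<mu> (Suc t) b L i (merge I R (x, y)) \<partial>gauss R)
      \<le> (\<integral>\<^sup>+y. ennreal (real b) * (1 + ?k * ?F x)
        * (ennreal (1 + (\<Sum>a\<in>R. (y a)\<^sup>2)) / ennreal (sqrt \<bar>\<Sum>a\<in>R. ?c a * y a\<bar>)) \<partial>gauss R)"
      by (intro nn_integral_mono le)
    also have "\<dots> = ennreal (real b) * (1 + ?k * ?F x)
        * (\<integral>\<^sup>+y. (ennreal (1 + (\<Sum>a\<in>R. (y a)\<^sup>2)) / ennreal (sqrt \<bar>\<Sum>a\<in>R. ?c a * y a\<bar>)) \<partial>gauss R)"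
      by (rule nn_integral_cmult) measurable
    also have "\<dots> \<le> ennreal (real b) * (1 + ?k * ?F x) * ennreal (10 * real (card R))"
      using c IR(4) by (intro mult_left_mono nn_integral_gauss_small_ball[of R "(i, e0)"]) (auto simp: R_def)
    also have "card R = b" by (simp add: R_def)
    also have "ennreal (real b) * (1 + ?k * ?F x) * ennreal (10 * real b) = ennreal (10 * (real b)\<^sup>2) * (1 + ?k * ?F x)"
    proof -
      have "ennreal (10 * (real b)\<^sup>2) = ennreal (real b) * ennreal (10 * real b)"
        by (subst ennreal_mult[symmetric]) (auto simp: power2_eq_square mult_ac)
      then show ?thesis by (simp only: mult_ac)
    qed
    finally show "(\<integral>\<^sup>+y. krylov_term \<mu> (Suc t) b L i (merge I R (x, y)) \<partial>gauss R) \<le> ennreal (10 * (real b)\<^sup>2) * (1 + ?k * ?F x)" .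
  qed
  also have "\<dots> = ennreal (10 * (real b)\<^sup>2) * (\<integral>\<^sup>+x. 1 + ?k * ?F x \<partial>gauss I)"
    by (rule nn_integral_cmult[OF affine_measurable(1)])
  also have "(\<integral>\<^sup>+x. 1 + ?k * ?F x \<partial>gauss I) = 1 + ?k * (\<integral>\<^sup>+x. ?F x \<partial>gauss I)"
  proof -
    have "(\<integral>\<^sup>+x. 1 + ?k * ?F x \<partial>gauss I) = (\<integral>\<^sup>+x. 1 \<partial>gauss I) + (\<integral>\<^sup>+x. ?k * ?F x \<partial>gauss I)"
      by (rule nn_integral_add[OF _ affine_measurable(2)]) simp
    then show ?thesis unfolding one nn_integral_cmult[OF Fm(2)] .
  qed
  finally show ?thesis unfolding F_int unfolding IR(1) .
qed

theorem nn_integral_krylov_sum_le: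
  assumes L: "distinct L" "length L \<le> b * t" "set L \<subseteq> {..<n}" "length L \<le> m" and b: "0 < b" and m: "1 \<le> m"
    and \<mu>: "\<And>j. j \<in> set L \<Longrightarrow> 0 \<le> \<mu> j" "\<And>j. j \<in> set L \<Longrightarrow> \<mu> j \<le> 1"
    and sep: "\<And>j j'. j \<in> set L \<Longrightarrow> j' \<in> set L \<Longrightarrow> j \<noteq> j' \<Longrightarrow> 1 \<le> K * \<bar>\<mu> j - \<mu> j'\<bar>"
    and K: "1 \<le> K"
  shows "(\<integral>\<^sup>+\<omega>. krylov_sum \<mu> t b L \<omega> \<partial>gauss ({..<n} \<times> {..<b}))
    \<le> ennreal ((real m * (10 * (real b)\<^sup>2 * (1 + sqrt (2 * K)))) ^ t)"
  using L \<mu> sep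
proof (induction t arbitrary: L)
  \<comment> \<open>Without blocks the list has length 0, so the sum is empty.\<close>
  case 0
  then show ?case by (simp add: krylov_sum_def)
next
  case (Suc t)
  let ?N = "gauss ({..<n} \<times> {..<b})"
  let ?c = "10 * (real b)\<^sup>2" and ?k = "sqrt (2 * K)"
  define X where "X = real m * (?c * (1 + ?k))"
  have k0: "0 \<le> ?k" using K by simp
  have c1: "1 \<le> ?c * (1 + ?k)"
  proof -
    have "1 \<le> (real b)\<^sup>2" using b by (intro one_le_power) simp
    then have "1 * 1 \<le> ?c * (1 + ?k)" using k0 by (intro mult_mono) linarith+
    then show ?thesis by simp
  qed
  have X1: "1 \<le> X"
  proof -
    have "1 * 1 \<le> X" unfolding X_def using m c1 by (intro mult_mono) auto
    then show ?thesis by simp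
  qed
  have tle: "(\<integral>\<^sup>+\<omega>. krylov_term \<mu> (Suc t) b L i \<omega> \<partial>?N) \<le> ennreal (?c * (1 + ?k) * X ^ t)" if i: "i \<in> set L" for i
  proof -
    let ?L = "take (b * t) (remove1 i L)"
    have sub: "set ?L \<subseteq> set L" by (meson order_trans set_remove1_subset set_take_subset)
    have "(\<integral>\<^sup>+\<omega>. krylov_sum \<mu> t b ?L \<omega> \<partial>?N) \<le> ennreal (X ^ t)"
      unfolding X_def
    proof (rule Suc.IH)
      have "length ?L \<le> length (remove1 i L)" by simp
      also have "\<dots> \<le> length L" by (simp add: length_remove1)
      finally show "length ?L \<le> m" using Suc.prems(4) by simp
      show "1 \<le> K * \<bar>\<mu> j - \<mu> j'\<bar>" if "j \<in> set ?L" "j' \<in> set ?L" "j \<noteq> j'" for j j'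
        using Suc.prems(7) sub that by blast
    qed (use Suc.prems sub in \<open>auto intro: distinct_take distinct_remove1\<close>)
    then have "ennreal ?c * (1 + ennreal ?k * (\<integral>\<^sup>+\<omega>. krylov_sum \<mu> t b ?L \<omega> \<partial>?N)) \<le> ennreal ?c * (1 + ennreal ?k * ennreal (X ^ t))"
      by (intro mult_left_mono add_left_mono) auto
    also have "\<dots> = ennreal (?c * (1 + ?k * X ^ t))"
      using k0 X1 by (simp add: ennreal_mult ennreal_plus)
    \<comment> \<open>The additive 1 is absorbed through \<open>1 \<le> X ^ t\<close>, which makes
      the recursion purely multiplicative.\<close>
    also have "\<dots> \<le> ennreal (?c * (1 + ?k) * X ^ t)"
    proof (rule ennreal_leI)
      have "?c * (1 + ?k * X ^ t) \<le> ?c * (X ^ t + ?k * X ^ t)" using X1 by (intro mult_left_mono add_right_mono) auto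
      then show "?c * (1 + ?k * X ^ t) \<le> ?c * (1 + ?k) * X ^ t" by (simp add: algebra_simps)
    qed
    finally have "ennreal ?c * (1 + ennreal ?k * (\<integral>\<^sup>+\<omega>. krylov_sum \<mu> t b ?L \<omega> \<partial>?N)) \<le> ennreal (?c * (1 + ?k) * X ^ t)" .
    moreover have "(\<integral>\<^sup>+\<omega>. krylov_term \<mu> (Suc t) b L i \<omega> \<partial>?N) \<le> ennreal ?c * (1 + ennreal ?k * (\<integral>\<^sup>+\<omega>. krylov_sum \<mu> t b ?L \<omega> \<partial>?N))"
      by (rule nn_integral_krylov_term_le[OF Suc.prems(1,2) i Suc.prems(3) b Suc.prems(5,6,7) K refl])
    ultimately show ?thesis by order
  qed
  have "(\<integral>\<^sup>+\<omega>. krylov_sum \<mu> (Suc t) b L \<omega> \<partial>?N) = (\<Sum>i\<in>set L. \<integral>\<^sup>+\<omega>. krylov_term \<mu> (Suc t) b L i \<omega> \<partial>?N)"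
    unfolding krylov_sum_def using Suc.prems(3) by (intro nn_integral_sum borel_measurable_krylov_term) auto
  also have "\<dots> \<le> (\<Sum>i\<in>set L. ennreal (?c * (1 + ?k) * X ^ t))" by (intro sum_mono tle)
  also have "\<dots> = ennreal (real (card (set L)) * (?c * (1 + ?k) * X ^ t))"
    using X1 k0 by (simp add: ennreal_mult ennreal_of_nat_eq_real_of_nat)
  also have "\<dots> \<le> ennreal (real m * (?c * (1 + ?k) * X ^ t))"
    using X1 k0 Suc.prems(4) card_length[of L] by (intro ennreal_leI mult_right_mono) auto
  also have "real m * (?c * (1 + ?k) * X ^ t) = X ^ Suc t" by (simp add: X_def)
  finally show ?case unfolding X_def .
qed

section \<open>A high-probability event and Chebyshev polynomials\<close>

text \<open>The block of coefficients of the Gaussian columns in the eigenbasis, written as one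
  orthogonal map on all \<open>n * b\<close> entries that leaves the column index alone. Rotation
  invariance then applies to it.\<close>

definition row_coords :: "nat \<Rightarrow> nat \<Rightarrow> (nat \<Rightarrow> nat \<Rightarrow> real) \<Rightarrow> (nat \<times> nat \<Rightarrow> real) \<Rightarrow> nat \<times> nat \<Rightarrow> real" where
  "row_coords n b u = coord_map ({..<n} \<times> {..<b}) (\<lambda>(i, c) (r, e). if c = e then u i r else 0)"

lemma row_coords_apply:
  assumes "i < n" "c < b"
  shows "row_coords n b u \<omega> (i, c) = ip {..<n} (u i) (\<lambda>r. \<omega> (r, c))"
proof -
  have "row_coords n b u \<omega> (i, c) = (\<Sum>a\<in>{..<n} \<times> {..<b}. (case a of (r, e) \<Rightarrow> if c = e then u i r else 0) * \<omega> a)"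
    using assms by (simp add: row_coords_def coord_map_def)
  also have "\<dots> = (\<Sum>r<n. \<Sum>e<b. (if c = e then u i r else 0) * \<omega> (r, e))"
    by (simp add: sum.cartesian_product split_beta')
  also have "\<dots> = (\<Sum>r<n. \<Sum>e<b. if e = c then u i r * \<omega> (r, e) else 0)"
    by (intro sum.cong) auto
  finally show ?thesis using assms by (simp add: ip_def)
qed

lemma preserves_gauss_row_coords:
  assumes u: "orthonormal {..<n} n u"
  shows "preserves_gauss ({..<n} \<times> {..<b}) (row_coords n b u)"
  unfolding row_coords_def
proof (rule gauss_orthogonal_invariance)
  fix x y assume "x \<in> {..<n} \<times> {..<b}" "y \<in> {..<n} \<times> {..<b}"
  then obtain r e r' e' where xy: "x = (r, e)" "y = (r', e')" "r < n" "r' < n" "e < b" "e' < b" by auto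
  let ?Q = "\<lambda>(i :: nat, c :: nat) (r :: nat, e :: nat). if c = e then u i r else 0"
  have "(\<Sum>k\<in>{..<n} \<times> {..<b}. h k) = (\<Sum>i<n. \<Sum>c<b. h (i, c))" for h :: "nat \<times> nat \<Rightarrow> real"
    by (simp add: sum.cartesian_product)
  then have "(\<Sum>k\<in>{..<n} \<times> {..<b}. ?Q k x * ?Q k y) = (\<Sum>i<n. \<Sum>c<b. ?Q (i, c) x * ?Q (i, c) y)" .
  also from xy have "\<dots> = (\<Sum>i<n. \<Sum>c<b. if c = e then (if e = e' then u i r * u i r' else 0) else 0)"
    by (intro sum.cong) auto
  also have "\<dots> = (if e = e' then (\<Sum>i<n. u i r * u i r') else 0)" using xy by simp
  also have "\<dots> = (if x = y then 1 else 0)" using orthonormal_dual[OF u] xy by auto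
  finally show "(\<Sum>k\<in>{..<n} \<times> {..<b}. ?Q k x * ?Q k y) = (if x = y then 1 else 0)" .
qed simp

text \<open>Markov's inequality for the sum of the two normalised quantities.\<close>

lemma gaussian_event:
  assumes u: "orthonormal {..<n} n u"
    and F: "F \<in> borel_measurable (gaussian_entries n b)" "(\<integral>\<^sup>+\<omega>. F \<omega> \<partial>gaussian_entries n b) \<le> ennreal Y" "0 < Y"
    and nb: "0 < n" "0 < b" and \<delta>: "0 < \<delta>"
  shows "\<exists>E\<in>sets (gaussian_entries n b). 1 - \<delta> \<le> measure (gaussian_entries n b) E \<and>
    (\<forall>\<omega>\<in>E. F (row_coords n b u \<omega>) \<le> ennreal (2 * Y / \<delta>) \<and>
      (\<Sum>a\<in>{..<n} \<times> {..<b}. (row_coords n b u \<omega> a)\<^sup>2) \<le> 2 * real (n * b) / \<delta>)"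
proof -
  let ?J = "{..<n} \<times> {..<b}"
  let ?T = "row_coords n b u"
  have N: "gaussian_entries n b = gauss ?J" by (simp add: gaussian_entries_def)
  have prob: "prob_space (gauss ?J)" by (rule prob_space_gauss)
  let ?s = "\<lambda>\<omega>. ennreal (\<Sum>a\<in>?J. (\<omega> a)\<^sup>2)"
  \<comment> \<open>The scalings make each of the two quantities contribute at most
    \<open>\<delta> / 2\<close> to the mean of \<open>g\<close>. Where \<open>g < 1\<close>, both
    bounds hold at once.\<close>
  define p where "p = \<delta> / (2 * Y)"
  define r where "r = \<delta> / (2 * real (n * b))"
  have pr: "0 < p" "0 < r" using F(3) nb \<delta> by (auto simp: p_def r_def)
  define g where "g \<omega> = ennreal p * F \<omega> + ennreal r * ?s \<omega>" for \<omega>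
  have Fm[measurable]: "F \<in> borel_measurable (gauss ?J)" using F(1) N by simp
  have sm[measurable]: "?s \<in> borel_measurable (gauss ?J)" by measurable
  have pF: "(\<lambda>\<omega>. ennreal p * F \<omega>) \<in> borel_measurable (gauss ?J)" by measurable
  have rs: "(\<lambda>\<omega>. ennreal r * ?s \<omega>) \<in> borel_measurable (gauss ?J)" by measurable
  have gm: "g \<in> borel_measurable (gauss ?J)" unfolding g_def[abs_def] using pF rs by (rule borel_measurable_add)
  have T: "?T \<in> measurable (gauss ?J) (gauss ?J)"
    "(\<integral>\<^sup>+\<omega>. g (?T \<omega>) \<partial>gauss ?J) = (\<integral>\<^sup>+\<omega>. g \<omega> \<partial>gauss ?J)"
    using preserves_gauss_row_coords[OF u, of b] gm by (auto simp: preserves_gauss_def)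
  have gT: "(\<lambda>\<omega>. g (?T \<omega>)) \<in> borel_measurable (gauss ?J)" by (rule measurable_compose[OF T(1) gm])
  have "(\<integral>\<^sup>+\<omega>. g \<omega> \<partial>gauss ?J) = ennreal p * (\<integral>\<^sup>+\<omega>. F \<omega> \<partial>gauss ?J) + ennreal r * (\<integral>\<^sup>+\<omega>. ?s \<omega> \<partial>gauss ?J)"
    unfolding g_def nn_integral_add[OF pF rs] nn_integral_cmult[OF Fm] nn_integral_cmult[OF sm] ..
  also have "\<dots> \<le> ennreal p * ennreal Y + ennreal r * ennreal (real (n * b))"
    using F(2) nn_integral_gauss_sum_sq[of ?J ?J] unfolding N
    by (intro add_mono mult_left_mono) (auto simp: card_cartesian_product)
  also have "\<dots> = ennreal (p * Y + r * real (n * b))"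
    using pr F(3) by (simp add: ennreal_mult ennreal_plus)
  also have "p * Y + r * real (n * b) = \<delta>" using F(3) nb by (simp add: p_def r_def)
  finally have int: "(\<integral>\<^sup>+\<omega>. g (?T \<omega>) \<partial>gauss ?J) \<le> ennreal \<delta>" unfolding T(2) .
  define Bad where "Bad = {\<omega> \<in> space (gauss ?J). 1 \<le> g (?T \<omega>)}"
  have Bad: "Bad \<in> sets (gauss ?J)" unfolding Bad_def using gT by measurable
  have "emeasure (gauss ?J) Bad \<le> 1 * (\<integral>\<^sup>+\<omega>. g (?T \<omega>) * indicator (space (gauss ?J)) \<omega> \<partial>gauss ?J)"
    unfolding Bad_def
    using nn_integral_Markov_inequality[of "\<lambda>\<omega>. g (?T \<omega>)" "space (gauss ?J)" "gauss ?J" 1] gT by simp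
  also have "\<dots> = (\<integral>\<^sup>+\<omega>. g (?T \<omega>) \<partial>gauss ?J)" by (simp cong: nn_integral_cong)
  finally have "emeasure (gauss ?J) Bad \<le> ennreal \<delta>" using int by order
  then have "measure (gauss ?J) Bad \<le> \<delta>" 
    using \<delta> by (simp add: finite_measure.emeasure_eq_measure[OF prob_space.finite_measure[OF prob]])
  then have meas: "1 - \<delta> \<le> measure (gauss ?J) (space (gauss ?J) - Bad)" using prob_space.prob_compl[OF prob Bad] by simp
  show ?thesis
    unfolding N
  proof (intro bexI[of _ "space (gauss ?J) - Bad"] conjI ballI meas)
    fix \<omega> assume "\<omega> \<in> space (gauss ?J) - Bad"
    then have g1: "g (?T \<omega>) < 1" by (auto simp: Bad_def not_le)
    have "ennreal p * F (?T \<omega>) \<le> g (?T \<omega>)" by (simp add: g_def)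
    then have lt: "ennreal p * F (?T \<omega>) < 1" using g1 by order
    have "F (?T \<omega>) = ennreal (1 / p) * (ennreal p * F (?T \<omega>))"
      using pr by (simp add: mult.assoc[symmetric] ennreal_mult[symmetric])
    also have "\<dots> \<le> ennreal (1 / p) * 1" using lt by (intro mult_left_mono) auto
    finally show "F (?T \<omega>) \<le> ennreal (2 * Y / \<delta>)" by (simp add: p_def)
    have "ennreal (r * (\<Sum>a\<in>?J. (?T \<omega> a)\<^sup>2)) \<le> g (?T \<omega>)"
      using pr by (simp add: g_def ennreal_mult sum_nonneg)
    then have "ennreal (r * (\<Sum>a\<in>?J. (?T \<omega> a)\<^sup>2)) < ennreal 1" using g1 unfolding ennreal_1 by order
    then have "r * (\<Sum>a\<in>?J. (?T \<omega> a)\<^sup>2) < 1"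
      using pr by (subst (asm) ennreal_less_iff) (auto intro!: mult_nonneg_nonneg sum_nonneg)
    then show "(\<Sum>a\<in>?J. (?T \<omega> a)\<^sup>2) \<le> 2 * real (n * b) / \<delta>"
      using nb \<delta> by (simp add: r_def field_simps)
  qed (use Bad in auto)
qed

section \<open>Chebyshev polynomials and gap amplification\<close>

fun chebyshev :: "nat \<Rightarrow> real poly" where
  "chebyshev 0 = 1"
| "chebyshev (Suc 0) = [:0, 1:]"
| "chebyshev (Suc (Suc n)) = [:0, 2:] * chebyshev (Suc n) - chebyshev n"

lemma degree_chebyshev: "degree (chebyshev n) \<le> n"
proof (induction n rule: chebyshev.induct)
  case (3 n)
  have "degree ([:0, 2:] * chebyshev (Suc n)) \<le> degree [:0, 2 :: real:] + degree (chebyshev (Suc n))" by (rule degree_mult_le)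
  also have "\<dots> \<le> Suc (Suc n)" using 3 by simp
  finally show ?case using 3 by (auto intro!: degree_diff_le simp del: mult_pCons_left)
qed auto

lemma chebyshev_cos: "poly (chebyshev n) (cos \<theta>) = cos (real n * \<theta>)"
proof (induction n rule: chebyshev.induct)
  case (3 n)
  have "cos (real (Suc (Suc n)) * \<theta>) + cos (real n * \<theta>) = 2 * cos \<theta> * cos (real (Suc n) * \<theta>)"
  proof -
    have "real (Suc (Suc n)) * \<theta> = real (Suc n) * \<theta> + \<theta>" "real n * \<theta> = real (Suc n) * \<theta> - \<theta>"
      by (simp_all add: algebra_simps)
    then show ?thesis by (simp only: cos_add cos_diff) simp
  qed
  then show ?case using 3 by simp
qed auto

lemma abs_chebyshev_le:
  assumes "\<bar>x\<bar> \<le> 1"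
  shows "\<bar>poly (chebyshev n) x\<bar> \<le> 1"
proof -
  have "x = cos (arccos x)" using assms by (simp add: abs_le_iff)
  then show ?thesis using chebyshev_cos[of n "arccos x"] by (metis abs_cos_le_one)
qed

text \<open>Outside the interval twice the polynomial is \<open>(x + w)^n + (x - w)^n\<close> with
  \<open>w = sqrt (x^2 - 1)\<close>. Growth governed by the root of \<open>x - 1\<close> is what
  turns the gap into its square root in the iteration count.\<close>

lemma chebyshev_ge:
  assumes x: "1 \<le> x"
  shows "(1 + sqrt (x - 1)) ^ n / 2 \<le> poly (chebyshev n) x"
proof -
  define w where "w = sqrt (x\<^sup>2 - 1)"
  have x2: "1 \<le> x\<^sup>2" using x by (rule one_le_power)
  have w2: "w\<^sup>2 = x\<^sup>2 - 1" using x2 by (simp add: w_def)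
  have prod: "(x + w) * (x - w) = 1" using w2 by (simp add: algebra_simps power2_eq_square)
  have "2 * poly (chebyshev n) x = (x + w) ^ n + (x - w) ^ n"
  proof (induction n rule: chebyshev.induct)
    case (3 n)
    have "(x + w) ^ Suc (Suc n) + (x - w) ^ Suc (Suc n)
      = 2 * x * ((x + w) ^ Suc n + (x - w) ^ Suc n) - ((x + w) * (x - w)) * ((x + w) ^ n + (x - w) ^ n)"
      by (simp add: algebra_simps)
    also have "\<dots> = 2 * x * (2 * poly (chebyshev (Suc n)) x) - 2 * poly (chebyshev n) x"
      unfolding prod 3 by simp
    finally show ?case by simp
  qed auto
  moreover have "0 \<le> x - w"
  proof -
    have "w \<le> x" unfolding w_def using x by (intro real_le_lsqrt) auto
    then show ?thesis by simp
  qed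
  moreover have "(1 + sqrt (x - 1)) ^ n \<le> (x + w) ^ n"
  proof (rule power_mono)
    have "x - 1 \<le> x\<^sup>2 - 1" using x by (simp add: power2_eq_square)
    then have "sqrt (x - 1) \<le> w" unfolding w_def by (rule real_sqrt_le_mono)
    then show "1 + sqrt (x - 1) \<le> x + w" using x by simp
  qed (use x in simp)
  ultimately have "(1 + sqrt (x - 1)) ^ n \<le> 2 * poly (chebyshev n) x" using zero_le_power[of "x - w" n] by linarith
  then show ?thesis by simp
qed

lemma gap_amplifying_polynomial:
  assumes "0 \<le> \<alpha>" "\<alpha> < \<beta>"
  obtains p :: "real poly" where "degree p \<le> D" "\<And>x. 0 \<le> x \<Longrightarrow> x \<le> \<alpha> \<Longrightarrow> \<bar>poly p x\<bar> \<le> 1"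
    "\<And>x. \<beta> \<le> x \<Longrightarrow> (1 + sqrt ((\<beta> - \<alpha>) / \<beta>)) ^ D / 2 \<le> poly p x"
proof -
  \<comment> \<open>The interval is rescaled by \<open>\<alpha>\<close>, which may be 0 or tiny;
    then \<open>\<beta> / 2\<close> takes over, and \<open>\<beta> / a - 1 = 1\<close> still exceeds
    the relative gap.\<close>
  define a where "a = max \<alpha> (\<beta> / 2)"
  have a: "0 < a" "\<alpha> \<le> a" using assms by (auto simp: a_def)
  define p where "p = pcompose (chebyshev D) [:0, 1 / a:]"
  have px: "poly p x = poly (chebyshev D) (x / a)" for x by (simp add: p_def poly_pcompose)
  have "degree p \<le> D" using degree_chebyshev[of D] a by (simp add: p_def degree_pcompose)
  moreover have "\<bar>poly p x\<bar> \<le> 1" if "0 \<le> x" "x \<le> \<alpha>" for x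
    unfolding px using that a by (intro abs_chebyshev_le) (auto simp: abs_le_iff)
  moreover have "(1 + sqrt ((\<beta> - \<alpha>) / \<beta>)) ^ D / 2 \<le> poly p x" if x: "\<beta> \<le> x" for x
  proof -
    have g: "(\<beta> - \<alpha>) / \<beta> \<le> x / a - 1"
    proof (cases "\<beta> / 2 \<le> \<alpha>")
      case True
      then have "a = \<alpha>" by (simp add: a_def)
      have "(\<beta> - \<alpha>) / \<beta> \<le> (\<beta> - \<alpha>) / \<alpha>" using assms a \<open>a = \<alpha>\<close> by (intro divide_left_mono) auto
      also have "\<dots> = \<beta> / a - 1" using a \<open>a = \<alpha>\<close> by (simp add: diff_divide_distrib)
      also have "\<dots> \<le> x / a - 1" using x a by (simp add: divide_right_mono)
      finally show ?thesis .
    next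
      case False
      then have "a = \<beta> / 2" by (simp add: a_def)
      have "(\<beta> - \<alpha>) / \<beta> \<le> 1" using assms by simp
      also have "\<dots> = \<beta> / a - 1" using assms by (subst \<open>a = \<beta> / 2\<close>) simp
      also have "\<dots> \<le> x / a - 1" using x a by (simp add: divide_right_mono)
      finally show ?thesis .
    qed
    have g0: "0 \<le> (\<beta> - \<alpha>) / \<beta>" using assms by simp
    have "(1 + sqrt ((\<beta> - \<alpha>) / \<beta>)) ^ D / 2 \<le> (1 + sqrt (x / a - 1)) ^ D / 2"
      using g g0 by (intro divide_right_mono power_mono) auto
    also have "\<dots> \<le> poly p x" unfolding px using g g0 by (intro chebyshev_ge) simp
    finally show ?thesis .
  qed
  ultimately show thesis by (rule that)
qed

section \<open>Success of the iteration on the good event\<close>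

context gram_basis
begin

text \<open>Reduces the task to exhibiting polynomials: each family \<open>P j\<close> yields a
  vector \<open>x j\<close> in the range of \<open>Z\<close> with known coefficients in the
  eigenbasis.\<close>

lemma rbki_solves_lra:
  assumes eigval: "\<And>i. lam i = eigval A (Suc i)"
    and G: "G \<in> carrier_mat n b" and b: "0 < b"
    and out: "rbki_output A G q k A'"
    and k: "1 \<le> k" "k \<le> m" "0 < lam (k - 1)"
    and P: "\<And>j c. j < k \<Longrightarrow> c < b \<Longrightarrow> degree (P j c) < q"
    and top: "\<And>i j. j < k \<Longrightarrow> i < n \<Longrightarrow> i < m \<Longrightarrow>
      (\<Sum>c<b. poly (P j c) (lam i) * ipn (u i) (\<lambda>r. G $$ (r, c))) = (if i = j then 1 else 0)"
    and tail: "\<And>i j. j < k \<Longrightarrow> m \<le> i \<Longrightarrow> i < n \<Longrightarrow>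
      lam j * (\<Sum>c<b. poly (P j c) (lam i) * ipn (u i) (\<lambda>r. G $$ (r, c)))\<^sup>2 \<le> \<tau> * lam i"
    and \<tau>: "0 \<le> \<tau>" "real n * real n * \<tau> \<le> min 1 \<epsilon>" and \<epsilon>: "0 < \<epsilon>"
    and N: "N \<in> {frobenius_norm, spectral_norm}"
  shows "solves_lra N k \<epsilon> A A'"
proof -
  obtain r Z B where Z: "Z \<in> carrier_mat n r" "transpose_mat Z * Z = 1\<^sub>m r"
    and cs: "vec_space.col_space n Z = vec_space.col_space n (krylov_mat A G q)"
    and B: "best_rank_approx k (transpose_mat Z * A) B" and A': "A' = Z * B"
    using out unfolding rbki_output_def carrier_matD(1)[OF A] by blast
  define Q where "Q j xy \<longleftrightarrow> (\<forall>i<n. fst xy i = (\<Sum>p<r. Z $$ (i, p) * snd xy p)) \<and>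
    (\<forall>i<n. ipn (u i) (fst xy) = (\<Sum>c<b. poly (P j c) (lam i) * ipn (u i) (\<lambda>r. G $$ (r, c))))" for j xy
  have "\<forall>j\<in>{..<k}. \<exists>xy. Q j xy"
  proof
    fix j assume "j \<in> {..<k}"
    then show "\<exists>xy. Q j xy"
      using krylov_polynomial_combination[OF G b Z(1) cs, of "P j"] P unfolding Q_def by auto
  qed
  then obtain f where f: "\<forall>j\<in>{..<k}. Q j (f j)" using bchoice by metis
  define x y where "x j = fst (f j)" and "y j = snd (f j)" for j
  have xy: "x j i = (\<Sum>p<r. Z $$ (i, p) * y j p)"
    "ipn (u i) (x j) = (\<Sum>c<b. poly (P j c) (lam i) * ipn (u i) (\<lambda>r. G $$ (r, c)))" if "j < k" "i < n" for i j
    using f that by (auto simp: Q_def x_def y_def)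
  show ?thesis
    unfolding A'
    by (rule projected_best_approx_solves_lra[OF eigval Z B k xy(1) _ _ \<tau> \<epsilon> N]) (use xy(2) top tail in auto)
qed


text \<open>The polynomial \<open>x p(x) w\<^sub>j(x)\<close>, where \<open>w\<^sub>j\<close> is the \<open>j\<close>-th dual vector of the Krylov rows: it
  interpolates \<open>u\<^sub>j\<close> on the first \<open>m\<close> eigenvectors, \<open>p\<close> damps the others, and the factor
  \<open>x\<close> makes the damped part proportional to the eigenvalue.\<close>

lemma krylov_event_solves_lra:
  assumes eigval: "\<And>i. lam i = eigval A (Suc i)"
    and out: "rbki_output A (mat n b \<omega>) q k A'"
    and b: "0 < b" and k: "1 \<le> k" "k < l" "l \<le> m"
    and pos: "0 < lam (k - 1)" and gap: "lam (l - 1) < lam (k - 1)"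
    and event: "krylov_sum (\<lambda>i. lam i / lam 0) t b [0..<min m n] (row_coords n b u \<omega>) \<le> ennreal R" "0 < R"
      "(\<Sum>a\<in>{..<n} \<times> {..<b}. (row_coords n b u \<omega> a)\<^sup>2) \<le> H"
    and q: "D + t < q"
    and acc: "real n * real n * (4 * real t * H * R ^ 4 / (1 + sqrt ((lam (k - 1) - lam (l - 1)) / lam (k - 1))) ^ (2 * D)) \<le> min 1 \<epsilon>"
    and \<epsilon>: "0 < \<epsilon>" and N: "N \<in> {frobenius_norm, spectral_norm}"
  shows "solves_lra N k \<epsilon> A A'"
proof -
  let ?\<mu> = "\<lambda>i. lam i / lam 0"
  \<comment> \<open>There are only \<open>n\<close> eigenvectors, whereas \<open>m\<close> can be
    \<open>n + 1\<close>.\<close>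
  let ?L = "[0..<min m n]"
  let ?J = "krylov_index t b"
  define h where "h = row_coords n b u \<omega>"
  define g where "g = sqrt ((lam (k - 1) - lam (l - 1)) / lam (k - 1))"
  have g0: "0 \<le> g" using gap pos by (simp add: g_def)
  have lam0: "0 < lam 0" using pos lam_antimono[of 0 "k - 1"] by simp
  have posj: "0 < lam j" if "j < k" for j using pos lam_antimono[of j "k - 1"] that by fastforce
  have "k - 1 < n" using pos lam_zero by (metis less_irrefl linorder_not_le)
  then have kn: "k \<le> n" using k by simp
  have H0: "0 \<le> H" by (rule order_trans[OF sum_nonneg event(3)]) simp
  have G: "mat n b \<omega> \<in> carrier_mat n b" by simp
  have hG: "ipn (u i) (\<lambda>r. mat n b \<omega> $$ (r, c)) = h (i, c)" if "i < n" "c < b" for i c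
  proof -
    have "ipn (u i) (\<lambda>r. mat n b \<omega> $$ (r, c)) = ipn (u i) (\<lambda>r. \<omega> (r, c))" using that by (intro ip_cong) auto
    then show ?thesis using that by (simp add: h_def row_coords_apply)
  qed
  obtain p :: "real poly" where p: "degree p \<le> D" "\<And>x. 0 \<le> x \<Longrightarrow> x \<le> lam (l - 1) \<Longrightarrow> \<bar>poly p x\<bar> \<le> 1"
    "\<And>x. lam (k - 1) \<le> x \<Longrightarrow> (1 + g) ^ D / 2 \<le> poly p x"
    using gap_amplifying_polynomial[OF lam_nonneg gap, of D] unfolding g_def by blast
  have pj: "(1 + g) ^ D / 2 \<le> poly p (lam j)" if "j < k" for j
    using p(3) lam_antimono[of j "k - 1"] that by simp
  have B0: "0 < (1 + g) ^ D / 2" using g0 by simp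
  define d where "d j = krylov_dual ?\<mu> t b ?L j h" for j
  have jL: "j \<in> set ?L" if "j < k" for j using that k kn by auto
  \<comment> \<open>A single term of the sum already controls the distance of row \<open>j\<close>,
    since its weight is at least 1; squaring undoes the root in \<open>krylov_term\<close>.\<close>
  have \<rho>: "0 < krylov_dist ?\<mu> t b ?L j h" "1 / krylov_dist ?\<mu> t b ?L j h \<le> R\<^sup>2" if "j < k" for j
  proof -
    let ?r = "krylov_dist ?\<mu> t b ?L j h" and ?S = "row_weight b j h"
    have S: "1 \<le> ?S" by (rule row_weight_ge_1)
    have "krylov_term ?\<mu> t b ?L j h \<le> krylov_sum ?\<mu> t b ?L h"
      unfolding krylov_sum_def using jL[OF that] by (intro member_le_sum) auto
    then have le: "krylov_term ?\<mu> t b ?L j h \<le> ennreal R" using event(1) by (simp add: h_def)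
    have "?r \<noteq> 0"
    proof
      assume "?r = 0"
      then have "krylov_term ?\<mu> t b ?L j h = \<top>" using S by (simp add: krylov_term_def ennreal_divide_zero)
      then show False using le by (simp add: top_unique)
    qed
    then show r: "0 < ?r" using krylov_dist_nonneg[of ?\<mu> t b ?L j h] by linarith
    then have "krylov_term ?\<mu> t b ?L j h = ennreal (sqrt ?S / sqrt ?r)"
      using S by (simp add: krylov_term_def divide_ennreal)
    then have "sqrt ?S / sqrt ?r \<le> R" using le event(2) by simp
    then have "(sqrt ?S / sqrt ?r)\<^sup>2 \<le> R\<^sup>2" using S r by (intro power_mono) auto
    then have "?S / ?r \<le> R\<^sup>2" using S r by (simp add: power_divide)
    moreover have "1 / ?r \<le> ?S / ?r" using S r by (intro divide_right_mono) auto
    ultimately show "1 / ?r \<le> R\<^sup>2" by linarith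
  qed
  have R0: "0 \<le> R\<^sup>2" by simp
  \<comment> \<open>Dividing by powers of \<open>lam 0\<close> undoes the normalisation of the nodes
    to \<open>[0, 1]\<close>.\<close>
  define W where "W j c = (\<Sum>s<t. Polynomial.monom (d j (s, c) / lam 0 ^ s) s)" for j c
  define coef where "coef j = 1 / (lam j * poly p (lam j))" for j
  define P where "P j c = Polynomial.smult (coef j) ([:0, 1:] * p * W j c)" for j c
  have degP: "degree (P j c) < q" for j c
  proof -
    have "degree ([:0, 1:] * p * W j c) \<le> D + t"
    proof (cases "t = 0")
      case True
      then show ?thesis by (simp add: W_def)
    next
      case False
      have "degree (W j c) \<le> t - 1"
        unfolding W_def by (intro degree_sum_le) (use False in \<open>auto intro: order_trans[OF degree_monom_le]\<close>)
      moreover have "degree ([:0, 1:] * p) \<le> 1 + D"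
        using degree_mult_le[of "[:0, 1:]" p] p(1) by simp
      ultimately show ?thesis using degree_mult_le[of "[:0, 1:] * p" "W j c"] False by linarith
    qed
    then show ?thesis
      unfolding P_def using degree_smult_le[of "coef j" "[:0, 1:] * p * W j c"] q by linarith
  qed
  have polyW: "poly (W j c) x = (\<Sum>s<t. d j (s, c) * (x / lam 0) ^ s)" for j c x
    by (simp add: W_def poly_sum poly_monom power_divide)
  have val: "(\<Sum>c<b. poly (P j c) (lam i) * ipn (u i) (\<lambda>r. mat n b \<omega> $$ (r, c)))
      = coef j * (lam i * poly p (lam i)) * ip ?J (krylov_row ?\<mu> h i) (d j)" if "i < n" for i j
  proof -
    have "(\<Sum>c<b. poly (P j c) (lam i) * ipn (u i) (\<lambda>r. mat n b \<omega> $$ (r, c)))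
      = (\<Sum>c<b. \<Sum>s<t. coef j * (lam i * poly p (lam i)) * ((lam i / lam 0) ^ s * h (i, c) * d j (s, c)))"
      using hG[OF that] by (intro sum.cong) (auto simp: P_def polyW sum_distrib_left sum_distrib_right mult_ac)
    also have "\<dots> = coef j * (lam i * poly p (lam i)) * (\<Sum>c<b. \<Sum>s<t. (lam i / lam 0) ^ s * h (i, c) * d j (s, c))"
      by (simp add: sum_distrib_left)
    also have "(\<Sum>c<b. \<Sum>s<t. (lam i / lam 0) ^ s * h (i, c) * d j (s, c)) = ip ?J (krylov_row ?\<mu> h i) (d j)"
      unfolding ip_krylov_index by (subst sum.swap) (simp add: krylov_row_def)
    finally show ?thesis .
  qed
  \<comment> \<open>Cauchy-Schwarz for row \<open>i\<close> and the dual vector gives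
    \<open>t * H\<close> times \<open>(R^2)^2\<close>; the ratio of the values of \<open>p\<close>
    contributes the square of \<open>2 / (1 + g)^D\<close>.\<close>
  define \<tau> where "\<tau> = 4 * real t * H * R ^ 4 / (1 + g) ^ (2 * D)"
  show ?thesis
  proof (rule rbki_solves_lra[OF eigval G b out k(1) _ pos _ _ _ _ _ \<epsilon> N, where m = m and \<tau> = \<tau>])
    show "k \<le> m" using k by simp
    show "degree (P j c) < q" for j c by (rule degP)
    show "(\<Sum>c<b. poly (P j c) (lam i) * ipn (u i) (\<lambda>r. mat n b \<omega> $$ (r, c))) = (if i = j then 1 else 0)"
      if "j < k" "i < n" "i < m" for i j
    proof -
      have "ip ?J (krylov_row ?\<mu> h i) (d j) = (if j = i then 1 else 0)"
        unfolding d_def by (rule ip_krylov_dual[OF _ jL[OF that(1)] _ \<rho>(1)[OF that(1)]]) (use that in auto)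
      moreover have "coef j * (lam j * poly p (lam j)) = 1"
        using posj[OF that(1)] pj[OF that(1)] B0 by (simp add: coef_def)
      ultimately show ?thesis unfolding val[OF that(2)] by (cases "i = j") simp_all
    qed
    show "lam j * (\<Sum>c<b. poly (P j c) (lam i) * ipn (u i) (\<lambda>r. mat n b \<omega> $$ (r, c)))\<^sup>2 \<le> \<tau> * lam i"
      if j: "j < k" and i: "m \<le> i" "i < n" for i j
    proof -
      let ?B = "(1 + g) ^ D / 2"
      have li: "lam i \<le> lam (l - 1)" "lam i \<le> lam j" using i k j by (auto intro!: lam_antimono)
      have dj: "ip ?J (d j) (d j) \<le> (R\<^sup>2)\<^sup>2"
        unfolding L2_set_sq[symmetric] d_def L2_set_krylov_dual[OF \<rho>(1)[OF j]]
        using \<rho>[OF j] by (intro power_mono) auto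
      have row: "ip ?J (krylov_row ?\<mu> h i) (krylov_row ?\<mu> h i) \<le> real t * H"
      proof -
        have "?\<mu> i \<le> 1" "0 \<le> ?\<mu> i" using lam0 lam_antimono[of 0 i] lam_nonneg[of i] by (auto simp: divide_le_eq_1)
        then have mu: "(?\<mu> i ^ s)\<^sup>2 \<le> 1" for s by (simp add: power_le_one)
        have "ip ?J (krylov_row ?\<mu> h i) (krylov_row ?\<mu> h i) = (\<Sum>s<t. \<Sum>c<b. (?\<mu> i ^ s)\<^sup>2 * (h (i, c))\<^sup>2)"
          unfolding ip_krylov_index krylov_row_def by (simp add: power2_eq_square mult_ac)
        also have "\<dots> \<le> (\<Sum>s<t. \<Sum>c<b. (h (i, c))\<^sup>2)"
          using mu by (intro sum_mono) (auto intro: mult_left_le_one_le)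
        also have "\<dots> = real t * (\<Sum>c<b. (h (i, c))\<^sup>2)" by simp
        also have "(\<Sum>c<b. (h (i, c))\<^sup>2) = (\<Sum>a\<in>{i} \<times> {..<b}. (h a)\<^sup>2)"
          by (rule sum.reindex_bij_witness[of _ snd "\<lambda>c. (i, c)"]) auto
        also have "real t * (\<Sum>a\<in>{i} \<times> {..<b}. (h a)\<^sup>2) \<le> real t * (\<Sum>a\<in>{..<n} \<times> {..<b}. (h a)\<^sup>2)"
          using i by (intro mult_left_mono sum_mono2) auto
        also have "\<dots> \<le> real t * H" using event(3) by (intro mult_left_mono) (auto simp: h_def)
        finally show ?thesis .
      qed
      have "(ip ?J (krylov_row ?\<mu> h i) (d j))\<^sup>2 \<le> (real t * H) * (R\<^sup>2)\<^sup>2"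
        using row dj H0 by (intro order_trans[OF ip_Cauchy_Schwarz] mult_mono) auto
      then have ipb: "(ip ?J (krylov_row ?\<mu> h i) (d j))\<^sup>2 \<le> real t * H * R ^ 4" by (simp flip: power_mult)
      have "(poly p (lam i))\<^sup>2 \<le> 1" using p(2)[OF lam_nonneg li(1)] by (simp add: abs_square_le_1)
      have B: "?B\<^sup>2 \<le> (poly p (lam j))\<^sup>2" using pj[OF j] B0 by (intro power_mono) auto
      \<comment> \<open>The factor \<open>x\<close> of the polynomial yields \<open>lam i\<close>
        squared over \<open>lam j\<close>, of which \<open>lam i / lam j \<le> 1\<close> is
        discarded and one \<open>lam i\<close> is kept.\<close>
      have "lam j * (coef j * (lam i * poly p (lam i)))\<^sup>2 = (lam i / lam j * lam i) * (poly p (lam i))\<^sup>2 / (poly p (lam j))\<^sup>2"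
        using posj[OF j] by (simp add: coef_def power2_eq_square field_simps)
      also have "\<dots> \<le> (1 * lam i) * 1 / ?B\<^sup>2"
        using li posj[OF j] lam_nonneg[of i] \<open>(poly p (lam i))\<^sup>2 \<le> 1\<close>
        by (intro frac_le[OF _ _ zero_less_power[OF B0] B] mult_mono mult_right_mono) auto
      finally have c: "lam j * (coef j * (lam i * poly p (lam i)))\<^sup>2 \<le> lam i / ?B\<^sup>2" by simp
      have "lam j * (coef j * (lam i * poly p (lam i)) * ip ?J (krylov_row ?\<mu> h i) (d j))\<^sup>2
        = (lam j * (coef j * (lam i * poly p (lam i)))\<^sup>2) * (ip ?J (krylov_row ?\<mu> h i) (d j))\<^sup>2"
        by (simp only: power_mult_distrib mult.assoc)
      also have "\<dots> \<le> lam i / ?B\<^sup>2 * (real t * H * R ^ 4)"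
        using c ipb lam_nonneg[of i] posj[OF j] by (intro mult_mono) auto
      also have "\<dots> = \<tau> * lam i" by (simp add: \<tau>_def power_divide power_mult[symmetric] mult.commute)
      finally show ?thesis unfolding val[OF i(2)] .
    qed
    show "0 \<le> \<tau>" unfolding \<tau>_def using H0 g0 by (intro divide_nonneg_nonneg mult_nonneg_nonneg) auto
    show "real n * real n * \<tau> \<le> min 1 \<epsilon>" using acc unfolding \<tau>_def g_def .
  qed
qed

text \<open>For \<open>n = 1\<close> any nonzero sample spans the whole space and constant
  polynomials suffice. The general argument asks for \<open>q > t\<close>, which a very small
  \<open>log_accuracy\<close> does not guarantee.\<close>

lemma one_dimensional_solves_lra:
  assumes eigval: "\<And>i. lam i = eigval A (Suc i)"
    and n: "n = 1" and pos: "0 < lam 0" and q: "0 < q" and \<omega>: "\<omega> (0, 0) \<noteq> 0"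
    and out: "rbki_output A (mat 1 1 \<omega>) q 1 A'"
    and \<epsilon>: "0 < \<epsilon>" and N: "N \<in> {frobenius_norm, spectral_norm}"
  shows "solves_lra N 1 \<epsilon> A A'"
proof -
  have u: "u 0 0 * u 0 0 = 1" using ip_u[of 0 0] n by (simp add: ip_def)
  then have u0: "u 0 0 \<noteq> 0" by auto
  have ip1: "ipn (u 0) (\<lambda>r. mat 1 1 \<omega> $$ (r, 0)) = u 0 0 * \<omega> (0, 0)" by (simp add: ip_def n)
  show ?thesis
  proof (rule rbki_solves_lra[OF eigval _ _ out, where m = 1 and \<tau> = 0 and P = "\<lambda>_ _. [:1 / (u 0 0 * \<omega> (0, 0)):]"])
    fix i j :: nat assume "i < n" "j < 1"
    then show "(\<Sum>c<1. poly [:1 / (u 0 0 * \<omega> (0, 0)):] (lam i) * ipn (u i) (\<lambda>r. mat 1 1 \<omega> $$ (r, c))) = (if i = j then 1 else 0)"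
      using n u0 \<omega> ip1 by simp
  qed (use n pos q \<epsilon> N in auto)
qed

end

section \<open>Spectral parameters and iteration count\<close>

context gram_basis
begin

text \<open>A vanishing eigenvalue would make its relative gap 0 by the convention for division, so
  a positive minimum also forces positivity of the eigenvalues involved.\<close>

lemma min_rel_gap_imp:
  assumes eigval: "\<And>i. lam i = eigval A (Suc i)" and \<Delta>: "0 < min_rel_gap A m" and i: "i < m - 1"
  shows "0 < lam i" "min_rel_gap A m * lam i \<le> lam i - lam (Suc i)"
proof -
  have "min_rel_gap A m \<le> (eigval A (Suc i) - eigval A (Suc i + 1)) / eigval A (Suc i)"
    unfolding min_rel_gap_def using i by (intro Min_le) auto
  then have le: "min_rel_gap A m \<le> (lam i - lam (Suc i)) / lam i" by (simp add: eigval)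
  then have "lam i \<noteq> 0" using \<Delta> by auto
  then show "0 < lam i" using lam_nonneg[of i] by simp
  then show "min_rel_gap A m * lam i \<le> lam i - lam (Suc i)" using le by (simp add: pos_le_divide_eq)
qed

text \<open>Normalised nodes differ by at least \<open>\<Delta> * lam (m - 2) / lam 0\<close>, which
  is \<open>1 / K\<close>. The bound \<open>m - 1 \<le> K\<close> comes from adding up the gaps and
  later hides powers of \<open>m\<close> in \<open>ln K\<close>.\<close>

lemma cond_number_div_min_rel_gap:
  assumes eigval: "\<And>i. lam i = eigval A (Suc i)" and \<Delta>: "0 < min_rel_gap A m" and m: "2 \<le> m"
  defines "K \<equiv> cond_number A m / min_rel_gap A m"
  shows "1 \<le> K" "real m - 1 \<le> K"
    "\<And>j j'. j < m \<Longrightarrow> j' < m \<Longrightarrow> j \<noteq> j' \<Longrightarrow> 1 \<le> K * \<bar>lam j / lam 0 - lam j' / lam 0\<bar>"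
proof -
  let ?\<Delta> = "min_rel_gap A m"
  note gap = min_rel_gap_imp[OF eigval \<Delta>]
  have kap: "cond_number A m = lam 0 / lam (m - 2)"
    using m by (simp add: cond_number_def eigval Suc_diff_le numeral_2_eq_2 flip: Suc_diff_Suc)
  have last: "0 < lam (m - 2)" and lam0: "0 < lam 0" using gap(1)[of "m - 2"] gap(1)[of 0] m by auto
  have "?\<Delta> * lam 0 \<le> lam 0" using gap(2)[of 0] lam_nonneg[of "Suc 0"] m by simp
  then have \<Delta>1: "?\<Delta> \<le> 1" using lam0 by simp
  \<comment> \<open>Going up from \<open>lam (m - 2)\<close>, each step adds at least
    \<open>\<Delta>\<close> times the smallest of these eigenvalues.\<close>
  have tel: "lam (m - 2) * (1 + ?\<Delta> * real i) \<le> lam (m - 2 - i)" if "i \<le> m - 2" for i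
    using that
  proof (induction i)
    case (Suc i)
    let ?j = "m - 2 - Suc i"
    have j: "?j < m - 1" "Suc ?j = m - 2 - i" using Suc.prems by auto
    have "lam (m - 2) \<le> lam ?j" by (intro lam_antimono) simp
    then have "?\<Delta> * lam (m - 2) \<le> ?\<Delta> * lam ?j" using \<Delta> by simp
    then have "lam (m - 2 - i) + ?\<Delta> * lam (m - 2) \<le> lam ?j" using gap(2)[OF j(1)] j(2) by simp
    then show ?case using Suc by (simp add: algebra_simps)
  qed simp
  have "1 + ?\<Delta> * (real m - 2) \<le> lam 0 / lam (m - 2)"
    using tel[of "m - 2"] last m by (simp add: pos_le_divide_eq of_nat_diff mult.commute)
  then have "(1 + ?\<Delta> * (real m - 2)) / ?\<Delta> \<le> K"
    unfolding K_def kap using \<Delta> by (intro divide_right_mono) auto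
  moreover have "(1 + ?\<Delta> * (real m - 2)) / ?\<Delta> = 1 / ?\<Delta> + (real m - 2)" using \<Delta> by (simp add: add_divide_distrib)
  moreover have "1 \<le> 1 / ?\<Delta>" using \<Delta> \<Delta>1 by simp
  ultimately show m1: "real m - 1 \<le> K" by linarith
  then show K1: "1 \<le> K" using m by linarith
  have sep: "1 \<le> K * (lam j / lam 0 - lam j' / lam 0)" if "j < j'" "j' < m" for j j'
  proof -
    have "lam j' \<le> lam (Suc j)" using that by (intro lam_antimono) auto
    moreover have "lam (m - 2) \<le> lam j" using that by (intro lam_antimono) auto
    then have "?\<Delta> * lam (m - 2) \<le> ?\<Delta> * lam j" using \<Delta> by simp
    moreover have "j < m - 1" using that by simp
    note gap(2)[OF this]
    ultimately have "?\<Delta> * lam (m - 2) \<le> lam j - lam j'" by linarith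
    then have "?\<Delta> * lam (m - 2) / lam 0 \<le> lam j / lam 0 - lam j' / lam 0"
      using lam0 by (simp add: diff_divide_distrib[symmetric] divide_right_mono)
    then have "K * (?\<Delta> * lam (m - 2) / lam 0) \<le> K * (lam j / lam 0 - lam j' / lam 0)" using K1 by (intro mult_left_mono) auto
    moreover have "K * (?\<Delta> * lam (m - 2) / lam 0) = 1" unfolding K_def kap using \<Delta> last lam0 by simp
    ultimately show ?thesis by linarith
  qed
  show "1 \<le> K * \<bar>lam j / lam 0 - lam j' / lam 0\<bar>" if "j < m" "j' < m" "j \<noteq> j'" for j j'
  proof (cases "j < j'")
    case True
    then show ?thesis using sep[OF True that(2)] mult_left_mono[OF abs_ge_self, of K] K1 by (meson order_trans zero_le_one)
  next
    case False
    then have "j' < j" using that by simp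
    then show ?thesis
      using sep[OF _ that(1)] mult_left_mono[OF abs_ge_self, of K] K1
      by (subst abs_minus_commute) (meson order_trans zero_le_one)
  qed
qed

end

section \<open>Logarithmic bounds for the iteration count\<close>

lemma half_le_ln_one_plus:
  fixes x :: real
  assumes "0 \<le> x" "x \<le> 1"
  shows "x / 2 \<le> ln (1 + x)"
proof -
  have "exp (x / 2) \<le> 1 + x / 2 + (x / 2)\<^sup>2" using assms by (intro exp_bound) auto
  also have "\<dots> \<le> 1 + x" using assms mult_right_mono[of x 1 x] by (simp add: power2_eq_square field_simps)
  finally show ?thesis using assms by (subst ln_ge_iff) auto
qed

lemma ln_2_ge_half: "1 / 2 \<le> ln (2::real)"
  using half_le_ln_one_plus[of 1] by simp

lemma log_accuracy_expand:
  assumes "0 < n" "0 < \<delta>" "0 < \<epsilon>"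
  shows "log_accuracy n \<delta> \<epsilon> = ln (real n) - ln \<delta> - ln (min 1 \<epsilon>)"
proof -
  have "0 < min 1 \<epsilon>" using assms by simp
  then show ?thesis using assms unfolding log_accuracy_def by (subst ln_div) (auto simp: ln_mult simp del: min_less_iff_conj)
qed

text \<open>The factor gained per block in \<open>nn_integral_krylov_sum_le\<close>.\<close>

definition krylov_base :: "nat \<Rightarrow> nat \<Rightarrow> real \<Rightarrow> real" where
  "krylov_base m b K = real m * (10 * (real b)\<^sup>2 * (1 + sqrt (2 * K)))"

text \<open>For \<open>m \<ge> 3\<close> one has \<open>K \<ge> 2\<close> and
  \<open>m \<le> K^2\<close>, so \<open>ln K\<close> absorbs the constant and the power of
  \<open>m\<close>. For \<open>m = 2\<close> the ratio \<open>K\<close> may be 1, and the constant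
  \<open>8 * ln 2\<close> remains to be paid elsewhere.\<close>

lemma ln_krylov_base_le:
  assumes m: "2 \<le> m" and b: "0 < b" "b < m" and K: "1 \<le> K" "real m - 1 \<le> K"
  shows "ln (krylov_base m b K) \<le> 12 * ln K \<or> m = 2 \<and> ln (krylov_base m b K) \<le> 8 * ln 2 + ln K"
proof -
  have "sqrt (2 * K) \<le> 2 * K" using K by (intro real_le_lsqrt) (auto simp: power2_eq_square)
  then have "1 + sqrt (2 * K) \<le> 3 * K" using K by simp
  moreover have "(real b)\<^sup>2 \<le> (real m)\<^sup>2" using b by (intro power_mono) auto
  ultimately have "krylov_base m b K \<le> real m * (10 * (real m)\<^sup>2 * (3 * K))"
    unfolding krylov_base_def using K by (intro mult_left_mono mult_mono) auto
  also have "\<dots> = 30 * real m ^ 3 * K" by (simp add: power2_eq_square power3_eq_cube)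
  also have "\<dots> \<le> 2 ^ 5 * real m ^ 3 * K" using K by (intro mult_right_mono) auto
  finally have le: "krylov_base m b K \<le> 2 ^ 5 * real m ^ 3 * K" .
  have pos: "0 < krylov_base m b K" unfolding krylov_base_def using m b K by (intro mult_pos_pos add_pos_nonneg) auto
  have "ln (krylov_base m b K) \<le> ln (2 ^ 5 * real m ^ 3 * K)" by (rule ln_mono[OF le pos])
  also have "\<dots> = 5 * ln 2 + 3 * ln (real m) + ln K"
    using m K ln_realpow[of "2 :: real" 5] by (simp add: ln_mult ln_realpow)
  finally have *: "ln (krylov_base m b K) \<le> 5 * ln 2 + 3 * ln (real m) + ln K" .
  show ?thesis
  proof (cases "m = 2")
    case True
    then show ?thesis using * by simp
  next
    case False
    then have m3: "3 \<le> real m" using m by simp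
    have K2: "2 \<le> K" using m3 K by linarith
    have "real m \<le> (real m - 1) * 2" using m3 by simp
    also have "\<dots> \<le> K * K" using K K2 m3 by (intro mult_mono) auto
    finally have "ln (real m) \<le> ln (K * K)" using m by simp
    then have "ln (real m) \<le> 2 * ln K" using K by (simp add: ln_mult)
    moreover have "ln 2 \<le> ln K" using K2 by simp
    ultimately show ?thesis using * by linarith
  qed
qed

text \<open>Of the \<open>q\<close> iterations about \<open>t\<close> serve the inversion of the
  Krylov matrix, and the other \<open>q - t - 1\<close> are the degree of the Chebyshev polynomial.
  After taking logarithms everything is linear in \<open>T = t * ln K\<close> and the accuracy
  \<open>L\<close>.\<close>

lemma iteration_count_sufficient:
  fixes n m t b :: nat and K g \<delta> \<epsilon> :: real
  assumes n: "2 \<le> n" and m: "2 \<le> m" "m = b * t" "m \<le> n + 1" and b: "0 < b" "b < m"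
    and K: "1 \<le> K" "real m - 1 \<le> K" and \<delta>: "0 < \<delta>" "\<delta> < 1" and \<epsilon>: "0 < \<epsilon>" and g: "0 < g" "g \<le> 1"
  defines "q \<equiv> nat \<lceil>100 * (real t / sqrt g * ln K + 1 / sqrt g * log_accuracy n \<delta> \<epsilon>)\<rceil>"
  defines "Y \<equiv> krylov_base m b K ^ t"
  shows "(q - t - 1) + t < q"
    "real n * real n * (4 * real t * (2 * real (n * b) / \<delta>) * (2 * Y / \<delta>) ^ 4 / (1 + sqrt g) ^ (2 * (q - t - 1))) \<le> min 1 \<epsilon>"
proof -
  define L where "L = log_accuracy n \<delta> \<epsilon>"
  define e where "e = min 1 \<epsilon>"
  define s where "s = sqrt g"
  have e: "0 < e" "e \<le> 1" using \<epsilon> by (auto simp: e_def)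
  have s: "0 < s" "s \<le> 1" using g by (auto simp: s_def)
  have L: "L = ln (real n) - ln \<delta> - ln e" unfolding L_def e_def using n \<delta> \<epsilon> by (intro log_accuracy_expand) auto
  have lnd: "ln \<delta> \<le> 0" "ln e \<le> 0" using \<delta> e by auto
  have "ln 2 \<le> ln (real n)" using n by simp
  then have L2: "ln 2 \<le> L" using L lnd by linarith
  then have L1: "1 \<le> 2 * L" using ln_2_ge_half by linarith
  have lnK: "0 \<le> ln K" using K by simp
  define T where "T = real t * ln K"
  have T0: "0 \<le> T" using lnK by (simp add: T_def)
  have m2: "t = 2" if "m = 2"
  proof -
    have "b = 1" using that b by simp
    then show ?thesis using m that by simp
  qed
  have m3: "1 \<le> 2 * ln K" if "m \<noteq> 2"
  proof -
    have "2 \<le> K" using that m K by linarith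
    then have "ln 2 \<le> ln K" by simp
    then show ?thesis using ln_2_ge_half by linarith
  qed
  have t1: "real t + 1 \<le> 2 * T + 6 * L"
  proof (cases "m = 2")
    case True
    then show ?thesis using m2 L1 T0 by simp
  next
    case False
    then have "real t * 1 \<le> real t * (2 * ln K)" using m3 by (intro mult_left_mono) auto
    then show ?thesis using L1 by (simp add: T_def)
  qed
  have "100 * (T / s + L / s) \<le> real q"
    unfolding q_def T_def L_def s_def by (rule order_trans[OF _ real_nat_ceiling_ge]) simp
  then have "100 * (T + L) / s \<le> real q" by (simp add: add_divide_distrib)
  then have qs: "100 * (T + L) \<le> real q * s" using s by (simp add: pos_divide_le_eq)
  have "real t + 1 \<le> 100 * (T + L)" using t1 T0 L1 unfolding distrib_left by linarith
  also note qs
  also have "real q * s \<le> real q * 1" using s by (intro mult_left_mono) auto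
  finally have "real t + 1 \<le> real q" by simp
  then have tq: "t + 1 \<le> q" by linarith
  then show "(q - t - 1) + t < q" by simp
  define D where "D = q - t - 1"
  have "real D = real q - (real t + 1)" using tq by (simp add: D_def of_nat_diff)
  then have "real D * s = real q * s - (real t + 1) * s" by (simp add: left_diff_distrib)
  moreover have "(real t + 1) * s \<le> (real t + 1) * 1" using s by (intro mult_left_mono) auto
  \<comment> \<open>The budget \<open>100 * (T + L)\<close> minus
    \<open>t + 1 \<le> 2 * T + 6 * L\<close> leaves ample room. Of the retained part,
    \<open>48 * T + 64 * L\<close> pays for \<open>Y ^ 4\<close> and \<open>13 * L\<close> for
    \<open>2 ^ 8 * n ^ 4 / (e * \<delta> ^ 5)\<close>.\<close>
  ultimately have Ds: "77 * L + 48 * T \<le> real D * s" using qs t1 T0 L1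
    unfolding distrib_left mult_1_right by linarith
  have X: "0 < krylov_base m b K" unfolding krylov_base_def using m b K by (intro mult_pos_pos add_pos_nonneg) auto
  have Y: "0 < Y" and lnY: "ln Y = real t * ln (krylov_base m b K)" using X by (auto simp: Y_def ln_realpow)
  have lnY4: "4 * ln Y \<le> 48 * T + 64 * L"
    using ln_krylov_base_le[OF m(1) b K]
  proof
    assume "ln (krylov_base m b K) \<le> 12 * ln K"
    then have "ln Y \<le> real t * (12 * ln K)" unfolding lnY by (intro mult_left_mono) auto
    then show ?thesis using L1 by (simp add: T_def)
  next
    assume a: "m = 2 \<and> ln (krylov_base m b K) \<le> 8 * ln 2 + ln K"
    then have "ln Y \<le> 2 * (8 * ln 2 + ln K)" "T = 2 * ln K" unfolding lnY using m2 by (auto simp: T_def)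
    then show ?thesis using L2 lnK unfolding distrib_left by linarith
  qed
  define Q where "Q = (1 + s) ^ (2 * D)"
  have Q: "0 < Q" using s by (simp add: Q_def)
  \<comment> \<open>The exponent \<open>2 * D\<close> compensates the factor 1/2 in
    \<open>half_le_ln_one_plus\<close>.\<close>
  have "real D * s \<le> real D * (2 * ln (1 + s))"
    using half_le_ln_one_plus[of s] s by (intro mult_left_mono) auto
  then have lnQ: "real D * s \<le> ln Q" using s by (simp add: Q_def ln_realpow)
  have "ln (2 ^ 8 * real n ^ 4 * Y ^ 4) = 8 * ln 2 + 4 * ln (real n) + 4 * ln Y"
    using n Y ln_realpow[of "2 :: real" 8] by (simp add: ln_mult ln_realpow)
  also have "\<dots> \<le> ln e + 5 * ln \<delta> + ln Q"
    using lnY4 lnQ Ds L L2 lnd \<open>ln 2 \<le> ln (real n)\<close> ln_2_ge_half by linarith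
  also have "\<dots> = ln (e * \<delta> ^ 5 * Q)" using e \<delta> Q by (simp add: ln_mult ln_realpow)
  finally have main: "2 ^ 8 * real n ^ 4 * Y ^ 4 \<le> e * \<delta> ^ 5 * Q"
    using n Y e \<delta> Q by (subst (asm) ln_le_cancel_iff) (auto intro!: mult_pos_pos)
  \<comment> \<open>The fifth power of \<open>\<delta>\<close> arises from Markov's inequality: one
    factor from the norm bound and four from \<open>R ^ 4\<close>. The product \<open>b * t\<close>
    is at most \<open>n + 1\<close>, hence at most \<open>2 * n\<close>.\<close>
  have "real n * real n * (4 * real t * (2 * real (n * b) / \<delta>) * (2 * Y / \<delta>) ^ 4 / Q)
    = 128 * real n ^ 3 * real (b * t) * Y ^ 4 / (\<delta> ^ 5 * Q)"
    using \<delta> Q by (simp add: field_simps power_divide eval_nat_numeral)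
  also have "\<dots> \<le> 128 * real n ^ 3 * (2 * real n) * Y ^ 4 / (\<delta> ^ 5 * Q)"
    using m n Y Q \<delta> by (intro divide_right_mono mult_right_mono mult_left_mono) (auto simp flip: of_nat_mult)
  also have "\<dots> = 2 ^ 8 * real n ^ 4 * Y ^ 4 / (\<delta> ^ 5 * Q)" by (simp add: eval_nat_numeral)
  also have "\<dots> \<le> e" using main Q \<delta> by (subst pos_divide_le_eq) (auto simp: mult_ac)
  finally show "real n * real n * (4 * real t * (2 * real (n * b) / \<delta>) * (2 * Y / \<delta>) ^ 4 / (1 + sqrt g) ^ (2 * (q - t - 1))) \<le> min 1 \<epsilon>"
    unfolding Q_def s_def D_def e_def .
qed

text \<open>For \<open>n \<ge> 2\<close> rounding up costs at most twice the accuracy term, raising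
  its constant to 102. Rounding \<open>l / b\<close> up gives \<open>b * t \<le> 2 * l\<close>,
  raising the other to 200; 202 covers both.\<close>

lemma matvec_product_count:
  fixes n t b l :: nat and K g \<delta> \<epsilon> :: real
  assumes n: "2 \<le> n" and b: "b < l" "b * t \<le> l + b" and K: "1 \<le> K" and \<delta>: "0 < \<delta>" "\<delta> < 1" and \<epsilon>: "0 < \<epsilon>" and g: "0 < g" "g \<le> 1"
  defines "q \<equiv> nat \<lceil>100 * (real t / sqrt g * ln K + 1 / sqrt g * log_accuracy n \<delta> \<epsilon>)\<rceil>"
  shows "real (b * q) \<le> 202 * (real l / sqrt g * ln K + real b / sqrt g * log_accuracy n \<delta> \<epsilon>)"
proof -
  define L where "L = log_accuracy n \<delta> \<epsilon>"
  define s where "s = sqrt g"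
  have s: "0 < s" "s \<le> 1" using g by (auto simp: s_def)
  have "L = ln (real n) - ln \<delta> - ln (min 1 \<epsilon>)" unfolding L_def using n \<delta> \<epsilon> by (intro log_accuracy_expand) auto
  moreover have "ln 2 \<le> ln (real n)" "ln \<delta> \<le> 0" "ln (min 1 \<epsilon>) \<le> 0" using n \<delta> \<epsilon> by auto
  ultimately have L1: "1 \<le> 2 * L" using ln_2_ge_half by linarith
  have lnK: "0 \<le> ln K" using K by simp
  define a where "a = real t / s * ln K"
  define c where "c = 1 / s * L"
  let ?x = "100 * (a + c)"
  have x0: "0 \<le> ?x" unfolding a_def c_def using s L1 lnK by (intro mult_nonneg_nonneg add_nonneg_nonneg) auto
  have "real q \<le> ?x + 1" unfolding q_def s_def[symmetric] L_def[symmetric] a_def[symmetric] c_def[symmetric] using x0 by linarith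
  moreover have "1 \<le> 2 * c"
  proof -
    have "1 * L \<le> 1 / s * L" using s L1 by (intro mult_right_mono) auto
    then show ?thesis using L1 by (simp add: c_def)
  qed
  ultimately have "real q \<le> 100 * a + 102 * c" unfolding distrib_left by linarith
  then have "real q \<le> 100 * (real t / s * ln K) + 102 * (1 / s * L)" unfolding a_def c_def .
  then have "real b * real q \<le> real b * (100 * (real t / s * ln K) + 102 * (1 / s * L))" by (intro mult_left_mono) auto
  also have "\<dots> = 100 * (real (b * t) * (ln K / s)) + 102 * (real b / s * L)" by (simp add: algebra_simps)
  also have "\<dots> \<le> 100 * ((2 * real l) * (ln K / s)) + 202 * (real b / s * L)"
  proof (intro add_mono mult_left_mono mult_right_mono)
    show "real (b * t) \<le> 2 * real l" using b by linarith
  qed (use s lnK L1 in auto)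
  also have "\<dots> \<le> 202 * (real l / s * ln K + real b / s * L)"
  proof -
    have "0 \<le> real l / s * ln K" using s lnK by simp
    moreover have "(2 * real l) * (ln K / s) = 2 * (real l / s * ln K)" by simp
    ultimately show ?thesis unfolding distrib_left by linarith
  qed
  finally show ?thesis by (simp add: s_def L_def)
qed

section \<open>The exceptional null event and the combination of all estimates\<close>

lemma gaussian_entries_nonzero:
  assumes "(0, 0) \<in> {..<n} \<times> {..<b}"
  shows "\<exists>E\<in>sets (gaussian_entries n b). measure (gaussian_entries n b) E = 1 \<and> (\<forall>\<omega>\<in>E. \<omega> (0, 0) \<noteq> 0)"
proof -
  let ?J = "{..<n} \<times> {..<b}"
  let ?Z = "{\<omega> \<in> space (gauss ?J). \<omega> (0, 0) = 0}"
  have prob: "prob_space (gauss ?J)" by (rule prob_space_gauss)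
  have m: "(\<lambda>\<omega>. \<omega> (0, 0)) \<in> borel_measurable (gauss ?J)" using assms by measurable
  have Z: "?Z \<in> sets (gauss ?J)" using m by measurable
  have "emeasure (gauss ?J) ?Z = (\<integral>\<^sup>+\<omega>. indicator {0} (\<omega> (0, 0)) \<partial>gauss ?J)"
    unfolding nn_integral_indicator[OF Z, symmetric] by (intro nn_integral_cong) (auto simp: indicator_def)
  also have "\<dots> = (\<integral>\<^sup>+x. indicator {0} x \<partial>std_normal_distribution)"
    using assms by (intro nn_integral_gauss_component) auto
  also have "\<dots> = (\<integral>\<^sup>+x. ennreal (std_normal_density x) * indicator {0} x \<partial>lborel)"
    by (rule nn_integral_density) auto
  also have "\<dots> = (\<integral>\<^sup>+(x :: real). 0 \<partial>lborel)"
  proof (rule nn_integral_cong_AE)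
    show "AE x in lborel. ennreal (std_normal_density x) * indicator {0} x = 0"
      using AE_lborel_singleton[of "0::real"] by eventually_elim auto
  qed
  finally have "emeasure (gauss ?J) ?Z = 0" by simp
  then have "measure (gauss ?J) (space (gauss ?J) - ?Z) = 1"
    using prob_space.prob_compl[OF prob Z] by (simp add: measure_def)
  then show ?thesis
    unfolding gaussian_entries_def using Z by (intro bexI[of _ "space (gauss ?J) - ?Z"]) auto
qed

text \<open>Positivity of \<open>min_rel_gap\<close> supplies every nondegeneracy: positive leading
  eigenvalues, a strict gap between positions \<open>k\<close> and \<open>l\<close> because
  \<open>k < m\<close>, and \<open>m \<le> n + 1\<close>.\<close>

theorem rbki_solves_lra_with_high_probability:
  fixes n d k b l :: nat and A :: "real mat" and \<epsilon> \<delta> :: real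
  assumes A: "A \<in> carrier_mat n d" and k: "1 \<le> k" "k < l" and b: "1 \<le> b" "b \<le> k"
    and \<epsilon>: "0 < \<epsilon>" and \<delta>: "0 < \<delta>" "\<delta> < 1"
  defines "t \<equiv> nat \<lceil>real l / real b\<rceil>"
  defines "m \<equiv> b * t"
  defines "g \<equiv> rel_gap A k l"
  defines "K \<equiv> cond_number A m / min_rel_gap A m"
  defines "q \<equiv> nat \<lceil>100 * (real t / sqrt g * ln K + 1 / sqrt g * log_accuracy n \<delta> \<epsilon>)\<rceil>"
  assumes \<Delta>: "0 < min_rel_gap A m"
  shows "N \<in> {frobenius_norm, spectral_norm} \<Longrightarrow> \<exists>E\<in>sets (gaussian_entries n b). 1 - \<delta> \<le> measure (gaussian_entries n b) E \<and>
      (\<forall>\<omega>\<in>E. \<forall>A'. rbki_output A (mat n b \<omega>) q k A' \<longrightarrow> solves_lra N k \<epsilon> A A')"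
    and "2 \<le> n \<Longrightarrow> real (b * q) \<le> 202 * (real l / sqrt g * ln K + real b / sqrt g * log_accuracy n \<delta> \<epsilon>)"
proof -
  define lam where "lam i = eigval A (Suc i)" for i
  obtain u where u: "orthonormal {..<n} n u"
    "\<And>i r. i < n \<Longrightarrow> r < n \<Longrightarrow> matvec n (\<lambda>r j. (A * transpose_mat A) $$ (r, j)) (u i) r = lam i * u i r"
    "\<And>i. 0 \<le> lam i" "\<And>i j. i \<le> j \<Longrightarrow> lam j \<le> lam i" "\<And>i. n \<le> i \<Longrightarrow> lam i = 0"
    using gram_eigenbasis[OF A] unfolding lam_def by metis
  interpret gram_basis n d A u lam by unfold_locales (use A u in auto)
  have tb: "real l \<le> real b * real t" "real b * real t \<le> real l + real b"
  proof -
    have "0 \<le> real l / real b" by simp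
    then have "real l / real b \<le> real t" "real t \<le> real l / real b + 1"
      unfolding t_def by linarith+
    then show "real l \<le> real b * real t" "real b * real t \<le> real l + real b"
      using b by (simp_all add: field_simps)
  qed
  have lm: "l \<le> m" "m \<le> l + b"
    using tb unfolding m_def by (simp_all flip: of_nat_mult of_nat_add)
  have m2: "2 \<le> m" using lm k by linarith
  have b0: "0 < b" "b < m" using b k lm by linarith+
  note gap = min_rel_gap_imp[OF lam_def \<Delta>]
  note K = cond_number_div_min_rel_gap[OF lam_def \<Delta> m2, folded K_def]
  have pos: "0 < lam (k - 1)" using gap(1)[of "k - 1"] k lm by linarith
  have lt: "lam (l - 1) < lam (k - 1)"
  proof -
    have "k - 1 < m - 1" using k lm by linarith
    note gap(2)[OF this]
    moreover have "0 < min_rel_gap A m * lam (k - 1)" using \<Delta> pos by simp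
    moreover have "lam (l - 1) \<le> lam (Suc (k - 1))" using k by (intro lam_antimono) simp
    ultimately show ?thesis by linarith
  qed
  have sv: "(singval A i)\<^sup>2 = lam (i - 1)" if "1 \<le> i" for i
    using that lam_nonneg[of "i - 1"] by (simp add: singval_def lam_def)
  have g: "g = (lam (k - 1) - lam (l - 1)) / lam (k - 1)" using k by (simp add: g_def rel_gap_def sv)
  have g01: "0 < g" "g \<le> 1" unfolding g using lt pos lam_nonneg[of "l - 1"] by auto
  \<comment> \<open>The last relative gap divides by \<open>lam (m - 2)\<close>, which must
    therefore be positive and have index below \<open>n\<close>.\<close>
  have mn: "m \<le> n + 1"
  proof (rule ccontr)
    assume "\<not> m \<le> n + 1"
    then have "lam (m - 2) = 0" by (intro lam_zero) simp
    moreover have "m - 2 < m - 1" using m2 by linarith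
    note gap(1)[OF this]
    ultimately show False by simp
  qed
  have n0: "0 < n" using mn m2 by simp
  show "2 \<le> n \<Longrightarrow> real (b * q) \<le> 202 * (real l / sqrt g * ln K + real b / sqrt g * log_accuracy n \<delta> \<epsilon>)"
    unfolding q_def using b k lm K(1) \<delta> \<epsilon> g01 by (intro matvec_product_count) (auto simp: m_def)
  show "\<exists>E\<in>sets (gaussian_entries n b). 1 - \<delta> \<le> measure (gaussian_entries n b) E \<and>
      (\<forall>\<omega>\<in>E. \<forall>A'. rbki_output A (mat n b \<omega>) q k A' \<longrightarrow> solves_lra N k \<epsilon> A A')"
    if N: "N \<in> {frobenius_norm, spectral_norm}"
  \<comment> \<open>Here \<open>m = 2\<close> and \<open>k = b = 1\<close>; the count is at least 1
    because \<open>\<delta> < 1\<close> keeps the logarithm positive.\<close>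
  proof (cases "n = 1")
    case True
    have "m = 2" using True mn m2 by simp
    then have k1: "k = 1" "b = 1" using k lm b by linarith+
    have "0 < log_accuracy n \<delta> \<epsilon>"
    proof -
      have "log_accuracy n \<delta> \<epsilon> = ln (real n) - ln \<delta> - ln (min 1 \<epsilon>)" using True \<delta> \<epsilon> by (intro log_accuracy_expand) auto
      moreover have "ln \<delta> < 0" "ln (min 1 \<epsilon>) \<le> 0" using \<delta> \<epsilon> by auto
      ultimately show ?thesis using True by simp
    qed
    then have "0 < real t / sqrt g * ln K + 1 / sqrt g * log_accuracy n \<delta> \<epsilon>"
      using g01 K(1) by (intro add_nonneg_pos mult_nonneg_nonneg mult_pos_pos) auto
    then have q0: "0 < q" unfolding q_def by simp
    have lam0: "0 < lam 0" using pos k1 by simp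
    have sol: "solves_lra N k \<epsilon> A A'" if nz: "\<omega> (0, 0) \<noteq> 0" and "rbki_output A (mat n b \<omega>) q k A'" for \<omega> A'
    proof -
      have "rbki_output A (mat 1 1 \<omega>) q 1 A'" using that(2) unfolding True k1 .
      then show ?thesis unfolding k1(1) by (rule one_dimensional_solves_lra[where \<omega> = \<omega>, OF lam_def True lam0 q0 nz _ \<epsilon> N])
    qed
    obtain E where E: "E \<in> sets (gaussian_entries n b)" "measure (gaussian_entries n b) E = 1" "\<forall>\<omega>\<in>E. \<omega> (0, 0) \<noteq> 0"
      using gaussian_entries_nonzero[of n b] n0 b0 by auto
    show ?thesis
    proof (intro bexI[OF _ E(1)] conjI ballI allI impI)
      show "1 - \<delta> \<le> measure (gaussian_entries n b) E" using E(2) \<delta> by simp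
      fix \<omega> A' assume "\<omega> \<in> E" "rbki_output A (mat n b \<omega>) q k A'"
      then show "solves_lra N k \<epsilon> A A'" using E(3) sol[of \<omega> A'] by blast
    qed
  next
    case False
    then have n2: "2 \<le> n" using n0 by simp
    let ?\<mu> = "\<lambda>i. lam i / lam 0" and ?L = "[0..<min m n]"
    define Y where "Y = krylov_base m b K ^ t"
    have lam0: "0 < lam 0" using gap(1)[of 0] m2 by simp
    have Y: "0 < Y"
      unfolding Y_def krylov_base_def using m2 b0 K(1) by (intro zero_less_power mult_pos_pos add_pos_nonneg) auto
    have "(\<integral>\<^sup>+\<omega>. krylov_sum ?\<mu> t b ?L \<omega> \<partial>gauss ({..<n} \<times> {..<b})) \<le> ennreal Y"
      unfolding Y_def krylov_base_def
    proof (rule nn_integral_krylov_sum_le)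
      show "0 \<le> ?\<mu> j" "?\<mu> j \<le> 1" if "j \<in> set ?L" for j
        using lam_nonneg lam0 lam_antimono[of 0 j] by (auto simp: divide_le_eq_1)
      show "1 \<le> K * \<bar>?\<mu> j - ?\<mu> j'\<bar>" if "j \<in> set ?L" "j' \<in> set ?L" "j \<noteq> j'" for j j'
        using that by (intro K(3)) auto
    qed (use m2 b0 K(1) in \<open>auto simp: m_def\<close>)
    moreover have "krylov_sum ?\<mu> t b ?L \<in> borel_measurable (gaussian_entries n b)"
      unfolding gaussian_entries_def by (rule borel_measurable_krylov_sum) auto
    ultimately obtain E where E: "E \<in> sets (gaussian_entries n b)" "1 - \<delta> \<le> measure (gaussian_entries n b) E"
      "\<And>\<omega>. \<omega> \<in> E \<Longrightarrow> krylov_sum ?\<mu> t b ?L (row_coords n b u \<omega>) \<le> ennreal (2 * Y / \<delta>)"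
      "\<And>\<omega>. \<omega> \<in> E \<Longrightarrow> (\<Sum>a\<in>{..<n} \<times> {..<b}. (row_coords n b u \<omega> a)\<^sup>2) \<le> 2 * real (n * b) / \<delta>"
      using gaussian_event[OF orthonormal _ _ Y n0 b0(1) \<delta>(1), of "krylov_sum ?\<mu> t b ?L"]
      unfolding gaussian_entries_def by blast
    \<comment> \<open>The bounds \<open>R = 2 * Y / \<delta>\<close> and
      \<open>H = 2 * n * b / \<delta>\<close> on the event are the ones for which the iteration
      count was computed.\<close>
    note suff = iteration_count_sufficient[OF n2 m2 meta_eq_to_obj_eq[OF m_def] mn b0 K(1,2) \<delta> \<epsilon> g01, folded q_def Y_def]
    show ?thesis
    proof (intro bexI[OF _ E(1)] conjI E(2) ballI allI impI)
      fix \<omega> A' assume \<omega>: "\<omega> \<in> E" and out: "rbki_output A (mat n b \<omega>) q k A'"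
      show "solves_lra N k \<epsilon> A A'"
        by (rule krylov_event_solves_lra[OF lam_def out b0(1) k lm(1) pos lt E(3)[OF \<omega>] _ E(4)[OF \<omega>] suff(1) _ \<epsilon> N])
          (use Y \<delta> suff(2) in \<open>auto simp: g\<close>)
    qed
  qed
qed

theorem theorem3:
  shows "\<exists>c > 0. \<exists>C > 0. \<forall>n d k b l :: nat. \<forall>A :: real mat. \<forall>\<epsilon> \<delta> :: real.
    A \<in> carrier_mat n d \<longrightarrow> 1 \<le> k \<longrightarrow> 1 \<le> b \<longrightarrow> b \<le> k \<longrightarrow> k < l \<longrightarrow>
    0 < \<epsilon> \<longrightarrow> 0 < \<delta> \<longrightarrow> \<delta> < 1 \<longrightarrow>
    (let t = nat \<lceil>real l / real b\<rceil>;
         l' = b * t;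
         gap = rel_gap A k l;
         \<Delta> = min_rel_gap A l';
         \<kappa> = cond_number A l';
         q = nat \<lceil>c * (real t / sqrt gap * ln (\<kappa> / \<Delta>) + 1 / sqrt gap * log_accuracy n \<delta> \<epsilon>)\<rceil>
     in 0 < \<Delta> \<longrightarrow>
        (\<forall>N \<in> {frobenius_norm, spectral_norm}.
           \<exists>E \<in> sets (gaussian_entries n b).
             measure (gaussian_entries n b) E \<ge> 1 - \<delta> \<and>
             (\<forall>\<omega> \<in> E. \<forall>A'. rbki_output A (Matrix.mat n b \<omega>) q k A' \<longrightarrow> solves_lra N k \<epsilon> A A')) \<and>
        (2 \<le> n \<longrightarrow>
           real (b * q) \<le> C * (real l / sqrt gap * ln (\<kappa> / \<Delta>)
                               + real b / sqrt gap * log_accuracy n \<delta> \<epsilon>)))"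
  unfolding Let_def
  by (intro exI[of _ 100] exI[of _ 202] conjI allI impI ballI;
      (rule rbki_solves_lra_with_high_probability; assumption | simp))

end
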